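(* Let $p>1$ be odd and let $\epsilon\in\mathbb{C}$ be a primitive $p$th root of unity. For every $\lambda\in\mathbb{Z}$, the irreducible highest weight $U_\epsilon^{res}(sl_2)$-module $V_\epsilon^{res}(\lambda)$ of type 1 and highest weight $\lambda$ is isomorphic to a subquotient (a submodule, or a quotient of a submodule) of one of the restricted q-Fock spaces $\mathcal{F}_\epsilon^1(2)$, $\mathcal{F}_\epsilon^2(2)$, regarded as $U_\epsilon^{res}(sl_2)$-modules. Consequently every irreducible highest weight $U_\epsilon^{res}(sl_2)$-module of type 1 arises in this way.
   Context: Let $q$ be an indeterminate, $\mathcal{A}=\mathbb{C}[q,q^{-1}]$, $\mathbb{N}=\{1,2,\dots\}$, $\mathbb{Z}^+=\{0,1,2,\dots\}$. For $n\in\mathbb{Z}$, $m\in\mathbb{N}$: $[n]_q=\frac{q^n-q^{-n}}{q-q^{-1}}$, $[m]_q!=[m]_q\cdots[1]_q$, $\left[{n\atop m}\right]_q=\frac{[n]_q[n-1]_q\cdots[n-m+1]_q}{[m]_q!}$; also $\left[{n\atop 0}\right]_q=1$ and $\left[{n\atop m}\right]_q=0$ for $m<0$. These lie in $\mathcal{A}$, and $\left[{n\atop m}\right]_\epsilon$ denotes the value at $q=\epsilon$. $U_q(sl_2)$ is the associative $\mathbb{C}(q)$-algebra with generators $e,f,K^{\pm1}$ and relations $KK^{-1}=K^{-1}K=1$, $KeK^{-1}=q^2e$, $KfK^{-1}=q^{-2}f$, $[e,f]=\frac{K-K^{-1}}{q-q^{-1}}$. $U_{\mathcal{A}}^{res}(sl_2)$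 is its $\mathcal{A}$-subalgebra generated by $K^{\pm1}$, $e^{(r)}=e^r/[r]_q!$, $f^{(r)}=f^r/[r]_q!$ ($r\in\mathbb{N}$). $U_\epsilon^{res}(sl_2)=U_{\mathcal{A}}^{res}(sl_2)\otimes_{\mathcal{A}}\mathbb{C}$ via $q\mapsto\epsilon$; elements $x\otimes1$ are written $x$. A $U_\epsilon^{res}(sl_2)$-module is of type 1 if $K$ is diagonalizable on it and $K^{\pm p}=1$. Let $\left[{K;0\atop p}\right]_q=\prod_{s=1}^p\frac{Kq^{1-s}-K^{-1}q^{s-1}}{q^s-q^{-s}}\in U_{\mathcal{A}}^{res}(sl_2)$. For $m\in\mathbb{Z}$, the weight space of weight $m$ of a type 1 module $V$ is $\{v\in V: Kv=\epsilon^m v,\ \left[{K;0\atop p}\right]_q v=\left[{m\atop p}\right]_\epsilon v\}$. A type 1 module is a highest weight module of highest weight $\lambda\in\mathbb{Z}$ if it is generated by a nonzero vector $v_\lambda$ of weight $\lambda$ with $ev_\lambda=e^{(p)}v_\lambda=0$. $V_\epsilon^{res}(\lambda)$ denotes the irreducible highest weight module of type 1 of highest weight $\lambda$ (unique up to isomorphism). $\mathcal{F}_\epsilon^1(2)$ is the complex vector space with basis $\{f(r_1,r_2): r_1,r_2\in\mathbb{Z}^+\}$ and action (for $r\in\mathbb{N}$) $K^{\pm1}f(r_1,r_2)=\epsilon^{\pm(r_1-r_2)}f(r_1,r_2)$, $e^{(r)}f(r_1,r_2)=\left[{r+r_1\atop r}\right]_\epsilon f(r_1+r,r_2-r)$,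 $f^{(r)}f(r_1,r_2)=\left[{r+r_2\atop r}\right]_\epsilon f(r_1-r,r_2+r)$. $\mathcal{F}_\epsilon^2(2)$ is the complex vector space with basis $\{g(r_1,r_2): r_1,r_2\in\mathbb{Z}^+\}$ and action $K^{\pm1}g(r_1,r_2)=\epsilon^{\mp(r_1+r_2+1)}g(r_1,r_2)$, $e^{(r)}g(r_1,r_2)=\left[{r_2\atop r_2-r}\right]_\epsilon g(r_1-r,r_2-r)$, $f^{(r)}g(r_1,r_2)=(-1)^r\left[{r+r_1\atop r}\right]_\epsilon g(r_1+r,r_2+r)$. In both cases a symbol $f(\cdot,\cdot)$ or $g(\cdot,\cdot)$ with a negative index means $0$. (These are specializations at $q=\epsilon$ of $\mathcal{A}$-forms of the q-Fock space of the rank-2 q-boson algebra, with $f(r_1,r_2)=a_1^{+(r_1)}a_2^{+(r_2)}|0\rangle$ and $g(r_1,r_2)=a_1^{+(r_1)}a_2^{+r_2}|0\rangle$.) *)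

theory Defs
  imports
    Complex_Main
    "HOL-Library.Poly_Mapping"
    "HOL-Computational_Algebra.Polynomial"
    "HOL-Computational_Algebra.Fraction_Field"
    "HOL-Algebra.Module"
    "HOL-Algebra.QuotRing"
begin

section \<open>The coefficient rings\<close>

type_synonym cq = "complex poly fract"

definition qvar :: cq where
  "qvar = Fraction_Field.Fract [:0, 1:] 1"

text \<open>
  \<open>laurent P n\<close> is the Laurent polynomial \<open>P(q) / q^n\<close>; these elements form the
  subring \<open>C[q, 1/q]\<close> of \<open>C(q)\<close>.
\<close>

definition laurent :: "complex poly \<Rightarrow> nat \<Rightarrow> cq" where
  "laurent P n = Fraction_Field.Fract P 1 / qvar ^ n"

definition laurent_ring :: "cq set" where
  "laurent_ring = {laurent P n | P n. True}"

text \<open>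
  The value of a Laurent polynomial at \<open>q = \<epsilon>\<close>, meaningful for \<open>\<epsilon> \<noteq> 0\<close>;
  see \<open>laurent_eval_laurent\<close> below.
\<close>

definition laurent_eval :: "complex \<Rightarrow> cq \<Rightarrow> complex" where
  "laurent_eval \<epsilon> s = (THE c. \<exists>P n. s = laurent P n \<and> c = poly P \<epsilon> / \<epsilon> ^ n)"

lemma qvar_power: "qvar ^ n = Fraction_Field.Fract (monom 1 n) 1"
  by (induction n) (simp_all add: qvar_def One_fract_def monom_Suc mult.commute)

lemma laurent_eval_laurent:
  assumes "\<epsilon> \<noteq> 0"
  shows "laurent_eval \<epsilon> (laurent P n) = poly P \<epsilon> / \<epsilon> ^ n"
  unfolding laurent_eval_def
proof (rule the_equality)
  fix c assume "\<exists>Q m. laurent P n = laurent Q m \<and> c = poly Q \<epsilon> / \<epsilon> ^ m"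
  then obtain Q m where eq: "laurent P n = laurent Q m" and c: "c = poly Q \<epsilon> / \<epsilon> ^ m"
    by blast
  have "P * monom 1 m = Q * monom 1 n"
    using eq by (simp add: laurent_def qvar_power eq_fract mult.commute)
  then have "poly (P * monom 1 m) \<epsilon> = poly (Q * monom 1 n) \<epsilon>"
    by simp
  then show "c = poly P \<epsilon> / \<epsilon> ^ n"
    using assms c by (simp add: poly_monom frac_eq_eq)
qed blast

definition qint :: "int \<Rightarrow> cq" where
  "qint n = (qvar powi n - qvar powi (- n)) / (qvar - inverse qvar)"

definition qfact :: "nat \<Rightarrow> cq" where
  "qfact m = (\<Prod>i = 1..m. qint (int i))"

definition qbinom :: "int \<Rightarrow> int \<Rightarrow> cq" where
  "qbinom n m =
     (if m < 0 then 0 else (\<Prod>i < nat m. qint (n - int i)) / qfact (nat m))"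

abbreviation qbinom_at :: "complex \<Rightarrow> int \<Rightarrow> int \<Rightarrow> complex" where
  "qbinom_at \<epsilon> n m \<equiv> laurent_eval \<epsilon> (qbinom n m)"

section \<open>The quantised enveloping algebra over \<open>C(q)\<close>\<close>

datatype gen = GE | GF | GK | GKinv

datatype word = Word "gen list"

text \<open>
  Concatenation is written additively because \<^typ>\<open>'a \<Rightarrow>\<^sub>0 'b\<close> carries the convolution
  product of an additive monoid; \<open>word \<Rightarrow>\<^sub>0 cq\<close> is thus the free associative algebra.
\<close>

instantiation word :: monoid_add
begin

definition "0 = Word []"

fun plus_word :: "word \<Rightarrow> word \<Rightarrow> word" where
  "Word u + Word v = Word (u @ v)"

instance
proof
  fix a b c :: word
  show "a + b + c = a + (b + c)"
    by (cases a; cases b; cases c) simp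
  show "0 + a = a" "a + 0 = a"
    by (cases a; simp add: zero_word_def)+
qed

end

type_synonym free_alg = "word \<Rightarrow>\<^sub>0 cq"

definition free_gen :: "gen \<Rightarrow> free_alg" where
  "free_gen x = Poly_Mapping.single (Word [x]) 1"

definition free_const :: "cq \<Rightarrow> free_alg" where
  "free_const c = Poly_Mapping.single 0 c"

definition sl2_rels :: "free_alg set" where
  "sl2_rels =
    (let E = free_gen GE; F = free_gen GF; K = free_gen GK; K' = free_gen GKinv in
     {K * K' - 1,
      K' * K - 1,
      K * E * K' - free_const (qvar ^ 2) * E,
      K * F * K' - free_const (inverse (qvar ^ 2)) * F,
      E * F - F * E - free_const (inverse (qvar - inverse qvar)) * (K - K')})"

inductive_set sl2_ideal :: "free_alg set" where
  zero: "0 \<in> sl2_ideal"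
| rel: "r \<in> sl2_rels \<Longrightarrow> a * r * b \<in> sl2_ideal"
| add: "x \<in> sl2_ideal \<Longrightarrow> y \<in> sl2_ideal \<Longrightarrow> x + y \<in> sl2_ideal"

lemma sl2_ideal_uminus: "x \<in> sl2_ideal \<Longrightarrow> - x \<in> sl2_ideal"
proof (induction rule: sl2_ideal.induct)
  case (rel r a b)
  then show ?case
    using sl2_ideal.rel[of r "- a" b] by simp
next
  case (add x y)
  then show ?case
    using sl2_ideal.add[of "- x" "- y"] by (simp add: add.commute)
qed (simp add: sl2_ideal.zero)

lemma sl2_ideal_mult_left: "x \<in> sl2_ideal \<Longrightarrow> z * x \<in> sl2_ideal"
proof (induction rule: sl2_ideal.induct)
  case (rel r a b)
  then show ?case
    using sl2_ideal.rel[of r "z * a" b] by (simp add: mult.assoc)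
qed (auto simp: distrib_left intro: sl2_ideal.intros)

lemma sl2_ideal_mult_right: "x \<in> sl2_ideal \<Longrightarrow> x * z \<in> sl2_ideal"
proof (induction rule: sl2_ideal.induct)
  case (rel r a b)
  then show ?case
    using sl2_ideal.rel[of r a "b * z"] by (simp add: mult.assoc)
qed (auto simp: distrib_right intro: sl2_ideal.intros)

text \<open>The counit, used only to see that the quotient below is not the zero ring.\<close>

fun counit_word :: "word \<Rightarrow> cq" where
  "counit_word (Word u) = (if GE \<in> set u \<or> GF \<in> set u then 0 else 1)"

definition counit :: "free_alg \<Rightarrow> cq" where
  "counit x = (\<Sum>w\<in>Poly_Mapping.keys x. Poly_Mapping.lookup x w * counit_word w)"

lemma counit_word_add: "counit_word (u + v) = counit_word u * counit_word v"
  by (cases u; cases v) auto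

lemma counit_superset:
  assumes "finite S" "Poly_Mapping.keys x \<subseteq> S"
  shows "counit x = (\<Sum>w\<in>S. Poly_Mapping.lookup x w * counit_word w)"
  unfolding counit_def
  by (rule sum.mono_neutral_left[OF assms]) (auto simp: in_keys_iff)

lemma counit_add: "counit (x + y) = counit x + counit y"
proof -
  let ?S = "Poly_Mapping.keys x \<union> Poly_Mapping.keys y"
  have "counit (x + y) = (\<Sum>w\<in>?S. Poly_Mapping.lookup (x + y) w * counit_word w)"
    by (rule counit_superset) (auto simp: keys_add)
  also have "\<dots> = counit x + counit y"
    by (simp add: counit_superset[of ?S x] counit_superset[of ?S y] lookup_add
        distrib_right sum.distrib)
  finally show ?thesis .
qed

lemma counit_zero: "counit 0 = 0"
  by (simp add: counit_def)

lemma counit_single: "counit (Poly_Mapping.single w c) = c * counit_word w"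
  by (simp add: counit_superset[of "{w}"])

lemma counit_diff: "counit (x - y) = counit x - counit y"
  using counit_add[of "x - y" y] by simp

lemma poly_mapping_single_induct [case_names zero add]:
  assumes "P 0" and "\<And>x w c. P x \<Longrightarrow> P (Poly_Mapping.single w c + x)"
  shows "P (x :: 'a \<Rightarrow>\<^sub>0 'b::comm_monoid_add)"
proof (induction x rule: update_induct)
  case const
  show ?case by (rule assms(1))
next
  case (update x w c)
  have "Poly_Mapping.update w c x = Poly_Mapping.single w c + x"
    using update(1)
    by (intro poly_mapping_eqI)
      (auto simp: lookup_add lookup_single lookup_update when_def in_keys_iff)
  then show ?case
    using assms(2)[OF update(3)] by simp
qed

lemma counit_mult: "counit (x * y) = counit x * counit y"
proof (induction x rule: poly_mapping_single_induct)
  case (add x u c)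
  have "counit (Poly_Mapping.single u c * y) = counit (Poly_Mapping.single u c) * counit y"
  proof (induction y rule: poly_mapping_single_induct)
    case (add y v d)
    then show ?case
      by (simp add: distrib_left counit_add mult_single counit_single counit_word_add)
  qed (simp add: counit_zero)
  with add show ?case
    by (simp add: distrib_right counit_add)
qed (simp add: counit_zero)

lemma counit_sl2_ideal: "x \<in> sl2_ideal \<Longrightarrow> counit x = 0"
proof (induction rule: sl2_ideal.induct)
  case (rel r a b)
  have "counit 1 = 1"
    by (simp add: counit_single zero_word_def flip: single_one)
  then have "counit r = 0"
    using rel
    by (auto simp: sl2_rels_def Let_def counit_diff counit_mult counit_single free_gen_def
        free_const_def)
  then show ?case
    by (simp add: counit_mult)
qed (simp_all add: counit_zero counit_add)

definition sl2_cong :: "free_alg \<Rightarrow> free_alg \<Rightarrow> bool" where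
  "sl2_cong x y \<longleftrightarrow> x - y \<in> sl2_ideal"

lemma equivp_sl2_cong: "equivp sl2_cong"
proof (rule equivpI)
  show "reflp sl2_cong"
    by (simp add: reflp_def sl2_cong_def sl2_ideal.zero)
  show "symp sl2_cong"
    unfolding symp_def sl2_cong_def using sl2_ideal_uminus by fastforce
  show "transp sl2_cong"
    unfolding transp_def sl2_cong_def using sl2_ideal.add by fastforce
qed

quotient_type uq = free_alg / sl2_cong
  by (rule equivp_sl2_cong)

instantiation uq :: ring_1
begin

lift_definition zero_uq :: uq is 0 .

lift_definition one_uq :: uq is 1 .

lift_definition plus_uq :: "uq \<Rightarrow> uq \<Rightarrow> uq" is "(+)"
  unfolding sl2_cong_def by (metis add_diff_add sl2_ideal.add)

lift_definition uminus_uq :: "uq \<Rightarrow> uq" is uminus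
  unfolding sl2_cong_def by (metis minus_diff_minus sl2_ideal_uminus)

lift_definition minus_uq :: "uq \<Rightarrow> uq \<Rightarrow> uq" is "(-)"
proof -
  fix a a' b b' :: free_alg
  assume "sl2_cong a a'" "sl2_cong b b'"
  then have "(a - a') + - (b - b') \<in> sl2_ideal"
    unfolding sl2_cong_def by (intro sl2_ideal.add sl2_ideal_uminus)
  moreover have "(a - b) - (a' - b') = (a - a') + - (b - b')"
    by simp
  ultimately show "sl2_cong (a - b) (a' - b')"
    unfolding sl2_cong_def by (simp only:)
qed

lift_definition times_uq :: "uq \<Rightarrow> uq \<Rightarrow> uq" is "(*)"
proof -
  fix a a' b b' :: free_alg
  assume "sl2_cong a a'" "sl2_cong b b'"
  then have "(a - a') * b + a' * (b - b') \<in> sl2_ideal"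
    unfolding sl2_cong_def
    by (intro sl2_ideal.add sl2_ideal_mult_left sl2_ideal_mult_right)
  moreover have "a * b - a' * b' = (a - a') * b + a' * (b - b')"
    by (simp add: algebra_simps)
  ultimately show "sl2_cong (a * b) (a' * b')"
    unfolding sl2_cong_def by simp
qed

instance
proof
  fix a b c :: uq
  show "a + b + c = a + (b + c)"
    by transfer (simp add: add.assoc sl2_cong_def sl2_ideal.zero)
  show "a + b = b + a"
    by transfer (simp add: add.commute sl2_cong_def sl2_ideal.zero)
  show "0 + a = a"
    by transfer (simp add: sl2_cong_def sl2_ideal.zero)
  show "- a + a = 0"
    by transfer (simp add: sl2_cong_def sl2_ideal.zero)
  show "a - b = a + - b"
    by transfer (simp add: sl2_cong_def sl2_ideal.zero)
  show "a * b * c = a * (b * c)"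
    by transfer (simp add: mult.assoc sl2_cong_def sl2_ideal.zero)
  show "(a + b) * c = a * c + b * c"
    by transfer (simp add: distrib_right sl2_cong_def sl2_ideal.zero)
  show "a * (b + c) = a * b + a * c"
    by transfer (simp add: distrib_left sl2_cong_def sl2_ideal.zero)
  show "1 * a = a" "a * 1 = a"
    by (transfer; simp add: sl2_cong_def sl2_ideal.zero)+
  show "(0::uq) \<noteq> 1"
  proof
    assume "(0::uq) = 1"
    then have "(0::free_alg) - 1 \<in> sl2_ideal"
      by transfer (simp add: sl2_cong_def)
    then have "counit (0 - 1) = 0"
      by (rule counit_sl2_ideal)
    moreover have "counit 1 = 1"
      by (simp add: counit_single zero_word_def flip: single_one)
    ultimately show False
      using counit_diff[of 0 1] counit_zero by simp
  qed
qed

end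

definition uq_gen :: "gen \<Rightarrow> uq" where
  "uq_gen x = abs_uq (free_gen x)"

definition uq_scale :: "cq \<Rightarrow> uq \<Rightarrow> uq" where
  "uq_scale c u = abs_uq (free_const c) * u"

section \<open>The restricted integral form\<close>

definition e_div :: "nat \<Rightarrow> uq" where
  "e_div r = uq_scale (inverse (qfact r)) (uq_gen GE ^ r)"

definition f_div :: "nat \<Rightarrow> uq" where
  "f_div r = uq_scale (inverse (qfact r)) (uq_gen GF ^ r)"

definition K_binom :: "nat \<Rightarrow> uq" where
  "K_binom p =
     (\<Prod>s\<leftarrow>[1..<p + 1].
        uq_scale (inverse (qvar powi int s - qvar powi (- int s)))
          (uq_scale (qvar powi (1 - int s)) (uq_gen GK)
             - uq_scale (qvar powi (int s - 1)) (uq_gen GKinv)))"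

inductive_set U_int :: "uq set" where
  one: "1 \<in> U_int"
| K: "uq_gen GK \<in> U_int"
| Kinv: "uq_gen GKinv \<in> U_int"
| e_div: "1 \<le> r \<Longrightarrow> e_div r \<in> U_int"
| f_div: "1 \<le> r \<Longrightarrow> f_div r \<in> U_int"
| add: "x \<in> U_int \<Longrightarrow> y \<in> U_int \<Longrightarrow> x + y \<in> U_int"
| mult: "x \<in> U_int \<Longrightarrow> y \<in> U_int \<Longrightarrow> x * y \<in> U_int"
| scale: "s \<in> laurent_ring \<Longrightarrow> x \<in> U_int \<Longrightarrow> uq_scale s x \<in> U_int"

section \<open>Specialisation at \<open>q = \<epsilon>\<close>\<close>

text \<open>
  The tensor product over \<open>C[q, 1/q]\<close> of \<^const>\<open>U_int\<close> with \<open>C\<close> is the free abelian group on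
  pairs \<open>(x, c)\<close> modulo the subgroup generated by the additivity and balancing relations.
  Giving the pairs the product \<open>(x, c) (y, d) = (x y, c d)\<close>, again written additively, makes
  the free abelian group a ring in which this subgroup is an ideal; the quotient ring is the
  tensor product of algebras.
\<close>

datatype tpair = TPair uq complex

instantiation tpair :: monoid_add
begin

definition "0 = TPair 1 1"

fun plus_tpair :: "tpair \<Rightarrow> tpair \<Rightarrow> tpair" where
  "TPair x c + TPair y d = TPair (x * y) (c * d)"

instance
proof
  fix a b c :: tpair
  show "a + b + c = a + (b + c)"
    by (cases a; cases b; cases c) (simp add: mult.assoc)
  show "0 + a = a" "a + 0 = a"
    by (cases a; simp add: zero_tpair_def)+
qed

end

type_synonym pretensor = "tpair \<Rightarrow>\<^sub>0 int"

definition pt :: "uq \<Rightarrow> complex \<Rightarrow> pretensor" where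
  "pt x c = Poly_Mapping.single (TPair x c) 1"

definition pretensor_ring :: "pretensor ring" where
  "pretensor_ring =
     \<lparr>carrier = {t. \<forall>w \<in> Poly_Mapping.keys t. \<exists>x \<in> U_int. \<exists>c. w = TPair x c},
      mult = (*), one = 1, zero = 0, add = (+)\<rparr>"

inductive_set tensor_rels :: "complex \<Rightarrow> pretensor set" for \<epsilon> :: complex where
  add_left: "x \<in> U_int \<Longrightarrow> y \<in> U_int \<Longrightarrow> pt (x + y) c - pt x c - pt y c \<in> tensor_rels \<epsilon>"
| add_right: "x \<in> U_int \<Longrightarrow> pt x (c + d) - pt x c - pt x d \<in> tensor_rels \<epsilon>"
| balanced: "x \<in> U_int \<Longrightarrow> s \<in> laurent_ring \<Longrightarrow>
    pt (uq_scale s x) c - pt x (laurent_eval \<epsilon> s * c) \<in> tensor_rels \<epsilon>"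

inductive_set tensor_null :: "complex \<Rightarrow> pretensor set" for \<epsilon> :: complex where
  zero: "0 \<in> tensor_null \<epsilon>"
| add: "t \<in> tensor_null \<epsilon> \<Longrightarrow> r \<in> tensor_rels \<epsilon> \<Longrightarrow> t + r \<in> tensor_null \<epsilon>"
| diff: "t \<in> tensor_null \<epsilon> \<Longrightarrow> r \<in> tensor_rels \<epsilon> \<Longrightarrow> t - r \<in> tensor_null \<epsilon>"

lemma free_const_central: "free_const c * x = x * free_const c"
proof (induction x rule: poly_mapping_single_induct)
  case (add x w d)
  then show ?case
    by (simp add: free_const_def mult_single distrib_left distrib_right mult.commute)
qed simp

lemma uq_scale_mult_right: "uq_scale s (x * y) = x * uq_scale s y"
proof -
  have "abs_uq (free_const s) * x = x * abs_uq (free_const s)"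
    by (induction x rule: uq.abs_induct) (simp add: times_uq.abs_eq free_const_central)
  then show ?thesis
    by (simp add: uq_scale_def flip: mult.assoc)
qed

lemma uq_scale_mult_left: "uq_scale s (x * y) = uq_scale s x * y"
  by (simp add: uq_scale_def mult.assoc)

lemma pt_mult: "pt x c * pt y d = pt (x * y) (c * d)"
  by (simp add: pt_def mult_single)

lemma tensor_null_plus:
  "u \<in> tensor_null \<epsilon> \<Longrightarrow> t \<in> tensor_null \<epsilon> \<Longrightarrow> t + u \<in> tensor_null \<epsilon>"
proof (induction rule: tensor_null.induct)
  case (add u r)
  then show ?case
    using tensor_null.add[of "t + u" \<epsilon> r] by (simp add: add.assoc)
next
  case (diff u r)
  then show ?case
    using tensor_null.diff[of "t + u" \<epsilon> r] by (simp add: add_diff_eq)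
qed simp

lemma tensor_null_uminus: "t \<in> tensor_null \<epsilon> \<Longrightarrow> - t \<in> tensor_null \<epsilon>"
proof (induction rule: tensor_null.induct)
  case (add t r)
  then show ?case
    using tensor_null.diff[of "- t" \<epsilon> r] by simp
next
  case (diff t r)
  then show ?case
    using tensor_null.add[of "- t" \<epsilon> r] by simp
qed (simp add: tensor_null.zero)

lemma tensor_null_minus:
  "t \<in> tensor_null \<epsilon> \<Longrightarrow> u \<in> tensor_null \<epsilon> \<Longrightarrow> t - u \<in> tensor_null \<epsilon>"
  using tensor_null_plus[OF tensor_null_uminus, of u \<epsilon> t] by simp

lemma tensor_null_sum:
  "(\<And>i. i \<in> I \<Longrightarrow> t i \<in> tensor_null \<epsilon>) \<Longrightarrow> sum t I \<in> tensor_null \<epsilon>"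
  by (induction I rule: infinite_finite_induct)
    (auto intro: tensor_null.zero tensor_null_plus)

lemma tensor_null_of_int:
  assumes "t \<in> tensor_null \<epsilon>"
  shows "of_int k * t \<in> tensor_null \<epsilon>"
proof (induction k rule: int_induct[where k = 0])
  case base
  show ?case by (simp add: tensor_null.zero)
next
  case (step1 k)
  then show ?case
    using assms by (simp add: distrib_right tensor_null_plus)
next
  case (step2 k)
  then show ?case
    using assms by (simp add: left_diff_distrib tensor_null_minus)
qed

lemma tensor_rels_mult_left:
  assumes "r \<in> tensor_rels \<epsilon>" "z \<in> U_int"
  shows "pt z d * r \<in> tensor_rels \<epsilon>"
  using assms(1)
proof cases
  case (add_left x y c)
  then show ?thesis
    using tensor_rels.add_left[of "z * x" "z * y" "d * c" \<epsilon>] assms(2)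
    by (simp add: right_diff_distrib pt_mult distrib_left U_int.mult)
next
  case (add_right x c c')
  then show ?thesis
    using tensor_rels.add_right[of "z * x" "d * c" "d * c'" \<epsilon>] assms(2)
    by (simp add: right_diff_distrib pt_mult distrib_left U_int.mult)
next
  case (balanced x s c)
  then show ?thesis
    using tensor_rels.balanced[of "z * x" s "d * c" \<epsilon>] assms(2)
    by (simp add: right_diff_distrib pt_mult uq_scale_mult_right mult.left_commute U_int.mult)
qed

lemma tensor_rels_mult_right:
  assumes "r \<in> tensor_rels \<epsilon>" "z \<in> U_int"
  shows "r * pt z d \<in> tensor_rels \<epsilon>"
  using assms(1)
proof cases
  case (add_left x y c)
  then show ?thesis
    using tensor_rels.add_left[of "x * z" "y * z" "c * d" \<epsilon>] assms(2)
    by (simp add: left_diff_distrib pt_mult distrib_right U_int.mult)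
next
  case (add_right x c c')
  then show ?thesis
    using tensor_rels.add_right[of "x * z" "c * d" "c' * d" \<epsilon>] assms(2)
    by (simp add: left_diff_distrib pt_mult distrib_right U_int.mult)
next
  case (balanced x s c)
  then show ?thesis
    using tensor_rels.balanced[of "x * z" s "c * d" \<epsilon>] assms(2)
    by (simp add: left_diff_distrib pt_mult uq_scale_mult_left mult.assoc U_int.mult)
qed

lemma tensor_null_pt_left:
  "t \<in> tensor_null \<epsilon> \<Longrightarrow> z \<in> U_int \<Longrightarrow> pt z d * t \<in> tensor_null \<epsilon>"
proof (induction rule: tensor_null.induct)
  case (add t r)
  then show ?case
    by (simp add: distrib_left tensor_null.add tensor_rels_mult_left)
next
  case (diff t r)
  then show ?case
    by (simp add: right_diff_distrib tensor_null.diff tensor_rels_mult_left)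
qed (simp add: tensor_null.zero)

lemma tensor_null_pt_right:
  "t \<in> tensor_null \<epsilon> \<Longrightarrow> z \<in> U_int \<Longrightarrow> t * pt z d \<in> tensor_null \<epsilon>"
proof (induction rule: tensor_null.induct)
  case (add t r)
  then show ?case
    by (simp add: distrib_right tensor_null.add tensor_rels_mult_right)
next
  case (diff t r)
  then show ?case
    by (simp add: left_diff_distrib tensor_null.diff tensor_rels_mult_right)
qed (simp add: tensor_null.zero)

lemma poly_mapping_sum_single:
  "(\<Sum>w\<in>Poly_Mapping.keys x. Poly_Mapping.single w (Poly_Mapping.lookup x w)) = x"
  by (rule poly_mapping_eqI)
    (auto simp: lookup_sum lookup_single when_def in_keys_iff sum.delta)

lemma single_eq_of_int_pt: "Poly_Mapping.single (TPair x c) k = of_int k * pt x c"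
proof -
  have "Poly_Mapping.single 0 (of_int k :: int) = (of_int k :: pretensor)"
    by (rule single_of_int)
  then have "(of_int k :: pretensor) = Poly_Mapping.single 0 k"
    unfolding of_int_eq_id id_apply by (rule sym)
  then show ?thesis
    by (simp add: pt_def mult_single)
qed

lemma tensor_null_mult_left:
  assumes "t \<in> tensor_null \<epsilon>" "s \<in> carrier pretensor_ring"
  shows "s * t \<in> tensor_null \<epsilon>"
proof -
  have "(\<Sum>w\<in>Poly_Mapping.keys s. Poly_Mapping.single w (Poly_Mapping.lookup s w) * t)
      \<in> tensor_null \<epsilon>"
  proof (rule tensor_null_sum)
    fix w assume "w \<in> Poly_Mapping.keys s"
    then obtain x c where "x \<in> U_int" "w = TPair x c"
      using assms(2) by (auto simp: pretensor_ring_def)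
    then show "Poly_Mapping.single w (Poly_Mapping.lookup s w) * t \<in> tensor_null \<epsilon>"
      using assms(1)
      by (simp add: single_eq_of_int_pt mult.assoc tensor_null_of_int tensor_null_pt_left)
  qed
  then show ?thesis
    by (simp add: poly_mapping_sum_single flip: sum_distrib_right)
qed

lemma tensor_null_mult_right:
  assumes "t \<in> tensor_null \<epsilon>" "s \<in> carrier pretensor_ring"
  shows "t * s \<in> tensor_null \<epsilon>"
proof -
  have "(\<Sum>w\<in>Poly_Mapping.keys s. t * Poly_Mapping.single w (Poly_Mapping.lookup s w))
      \<in> tensor_null \<epsilon>"
  proof (rule tensor_null_sum)
    fix w assume "w \<in> Poly_Mapping.keys s"
    then obtain x c where xc: "x \<in> U_int" "w = TPair x c"
      using assms(2) by (auto simp: pretensor_ring_def)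
    have "t * Poly_Mapping.single w k = of_int k * (t * pt x c)" for k
      using xc(2) mult_of_int_commute[of k t]
      by (simp add: single_eq_of_int_pt flip: mult.assoc)
    then show "t * Poly_Mapping.single w (Poly_Mapping.lookup s w) \<in> tensor_null \<epsilon>"
      using assms(1) xc(1) by (simp add: tensor_null_of_int tensor_null_pt_right)
  qed
  then show ?thesis
    by (simp add: poly_mapping_sum_single flip: sum_distrib_left)
qed

lemma pretensor_ring_simps:
  "add pretensor_ring = (+)" "zero pretensor_ring = 0"
  "mult pretensor_ring = (*)" "one pretensor_ring = 1"
  by (simp_all add: pretensor_ring_def)

lemma pt_carrier: "x \<in> U_int \<Longrightarrow> pt x c \<in> carrier pretensor_ring"
  by (simp add: pt_def pretensor_ring_def)

lemma pretensor_carrier_add: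
  "s \<in> carrier pretensor_ring \<Longrightarrow> t \<in> carrier pretensor_ring \<Longrightarrow>
     s + t \<in> carrier pretensor_ring"
  using keys_add[of s t] by (auto simp: pretensor_ring_def)

lemma pretensor_carrier_uminus:
  "s \<in> carrier pretensor_ring \<Longrightarrow> - s \<in> carrier pretensor_ring"
  by (simp add: pretensor_ring_def in_keys_iff)

lemma pretensor_carrier_minus:
  "s \<in> carrier pretensor_ring \<Longrightarrow> t \<in> carrier pretensor_ring \<Longrightarrow>
     s - t \<in> carrier pretensor_ring"
  using pretensor_carrier_add[OF _ pretensor_carrier_uminus, of s t] by simp

lemma pretensor_carrier_mult:
  assumes "s \<in> carrier pretensor_ring" "t \<in> carrier pretensor_ring"
  shows "s * t \<in> carrier pretensor_ring"
proof -
  have "\<exists>x\<in>U_int. \<exists>c. w = TPair x c" if "w \<in> Poly_Mapping.keys (s * t)" for w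
  proof -
    have "w \<in> {a + b |a b. a \<in> Poly_Mapping.keys s \<and> b \<in> Poly_Mapping.keys t}"
      using that keys_mult[of s t] by blast
    then obtain a b where "w = a + b" "a \<in> Poly_Mapping.keys s" "b \<in> Poly_Mapping.keys t"
      by blast
    with assms show ?thesis
      by (fastforce simp: pretensor_ring_def intro: U_int.mult)
  qed
  then show ?thesis
    by (simp add: pretensor_ring_def)
qed

lemma pretensor_carrier_zero: "0 \<in> carrier pretensor_ring"
  by (simp add: pretensor_ring_def)

lemma pt_one: "pt 1 1 = 1"
  unfolding pt_def zero_tpair_def[symmetric] by (rule single_one)

lemma pretensor_carrier_one: "1 \<in> carrier pretensor_ring"
  using pt_carrier[OF U_int.one, of 1] by (simp only: pt_one)

lemma ring_pretensor_ring: "ring pretensor_ring"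
proof (rule ringI)
  show "abelian_group pretensor_ring"
  proof (rule abelian_groupI, unfold pretensor_ring_simps)
    fix s assume "s \<in> carrier pretensor_ring"
    then show "\<exists>t\<in>carrier pretensor_ring. t + s = 0"
      by (intro bexI[of _ "- s"] pretensor_carrier_uminus) simp_all
  qed (simp_all add: pretensor_carrier_add pretensor_carrier_zero add_ac)
  show "Group.monoid pretensor_ring"
    by (rule monoidI, unfold pretensor_ring_simps)
      (simp_all add: pretensor_carrier_mult pretensor_carrier_one mult.assoc)
qed (simp_all add: pretensor_ring_simps distrib_left distrib_right)

lemma tensor_rels_carrier: "r \<in> tensor_rels \<epsilon> \<Longrightarrow> r \<in> carrier pretensor_ring"
  by (induction rule: tensor_rels.induct)
    (auto intro!: pretensor_carrier_minus pt_carrier U_int.add U_int.scale)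

lemma tensor_null_carrier: "t \<in> tensor_null \<epsilon> \<Longrightarrow> t \<in> carrier pretensor_ring"
proof (induction rule: tensor_null.induct)
  case zero
  show ?case by (rule pretensor_carrier_zero)
qed (auto intro: pretensor_carrier_add pretensor_carrier_minus tensor_rels_carrier)

lemma ideal_tensor_null: "ideal (tensor_null \<epsilon>) pretensor_ring"
proof (rule idealI)
  show "ring pretensor_ring"
    by (rule ring_pretensor_ring)
  interpret ring pretensor_ring
    by (rule ring_pretensor_ring)
  show "subgroup (tensor_null \<epsilon>) (add_monoid pretensor_ring)"
  proof (rule add.subgroupI)
    show "tensor_null \<epsilon> \<subseteq> carrier pretensor_ring"
      using tensor_null_carrier by blast
    show "tensor_null \<epsilon> \<noteq> {}"
      using tensor_null.zero by blast
  next
    fix t assume t: "t \<in> tensor_null \<epsilon>"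
    have "\<ominus>\<^bsub>pretensor_ring\<^esub> t = - t"
    proof (rule minus_equality)
      show "- t \<oplus>\<^bsub>pretensor_ring\<^esub> t = \<zero>\<^bsub>pretensor_ring\<^esub>"
        by (simp add: pretensor_ring_simps)
    qed (use t in \<open>auto intro: tensor_null_carrier tensor_null_uminus\<close>)
    then show "\<ominus>\<^bsub>pretensor_ring\<^esub> t \<in> tensor_null \<epsilon>"
      using t by (simp add: tensor_null_uminus)
  next
    fix s t assume "s \<in> tensor_null \<epsilon>" "t \<in> tensor_null \<epsilon>"
    then show "s \<oplus>\<^bsub>pretensor_ring\<^esub> t \<in> tensor_null \<epsilon>"
      by (simp add: pretensor_ring_simps tensor_null_plus)
  qed
next
  fix t s assume "t \<in> tensor_null \<epsilon>" "s \<in> carrier pretensor_ring"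
  then show "s \<otimes>\<^bsub>pretensor_ring\<^esub> t \<in> tensor_null \<epsilon>" "t \<otimes>\<^bsub>pretensor_ring\<^esub> s \<in> tensor_null \<epsilon>"
    by (simp_all add: pretensor_ring_simps tensor_null_mult_left tensor_null_mult_right)
qed

type_synonym ures = "pretensor set"

definition U_res :: "complex \<Rightarrow> ures ring" where
  "U_res \<epsilon> = pretensor_ring Quot tensor_null \<epsilon>"

lemma ring_U_res: "ring (U_res \<epsilon>)"
  unfolding U_res_def by (rule ideal.quotient_is_ring[OF ideal_tensor_null])

definition tensor :: "complex \<Rightarrow> uq \<Rightarrow> complex \<Rightarrow> ures" where
  "tensor \<epsilon> x c = tensor_null \<epsilon> +>\<^bsub>pretensor_ring\<^esub> pt x c"

abbreviation spec :: "complex \<Rightarrow> uq \<Rightarrow> ures" where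
  "spec \<epsilon> x \<equiv> tensor \<epsilon> x 1"

text \<open>
  A module over \<^const>\<open>U_res\<close> is a complex vector space through the second tensor factor.
\<close>

abbreviation scal :: "complex \<Rightarrow> complex \<Rightarrow> ures" where
  "scal \<epsilon> c \<equiv> tensor \<epsilon> 1 c"

section \<open>Modules over a noncommutative ring\<close>

text \<open>
  The library locale \<^locale>\<open>module\<close> insists on a commutative ring. As there, the
  \<open>mult\<close> and \<open>one\<close> fields of the record for \<open>M\<close> play no role.
\<close>

locale left_module = R?: ring R + M?: abelian_group M for R (structure) and M (structure) +
  assumes smult_closed:
      "\<lbrakk>a \<in> carrier R; x \<in> carrier M\<rbrakk> \<Longrightarrow> a \<odot>\<^bsub>M\<^esub> x \<in> carrier M"
    and smult_l_distr:
      "\<lbrakk>a \<in> carrier R; b \<in> carrier R; x \<in> carrier M\<rbrakk> \<Longrightarrow>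
        (a \<oplus> b) \<odot>\<^bsub>M\<^esub> x = a \<odot>\<^bsub>M\<^esub> x \<oplus>\<^bsub>M\<^esub> b \<odot>\<^bsub>M\<^esub> x"
    and smult_r_distr:
      "\<lbrakk>a \<in> carrier R; x \<in> carrier M; y \<in> carrier M\<rbrakk> \<Longrightarrow>
        a \<odot>\<^bsub>M\<^esub> (x \<oplus>\<^bsub>M\<^esub> y) = a \<odot>\<^bsub>M\<^esub> x \<oplus>\<^bsub>M\<^esub> a \<odot>\<^bsub>M\<^esub> y"
    and smult_assoc:
      "\<lbrakk>a \<in> carrier R; b \<in> carrier R; x \<in> carrier M\<rbrakk> \<Longrightarrow>
        (a \<otimes> b) \<odot>\<^bsub>M\<^esub> x = a \<odot>\<^bsub>M\<^esub> (b \<odot>\<^bsub>M\<^esub> x)"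
    and smult_one:
      "x \<in> carrier M \<Longrightarrow> \<one> \<odot>\<^bsub>M\<^esub> x = x"

definition quot_module :: "('r, 'm) module \<Rightarrow> 'm set \<Rightarrow> ('r, 'm set) module" where
  "quot_module M N =
     \<lparr>carrier = a_rcosets\<^bsub>M\<^esub> N, mult = (\<lambda>X Y. N), one = N, zero = N, add = set_add M,
      smult = (\<lambda>a X. \<Union>x\<in>X. N +>\<^bsub>M\<^esub> (a \<odot>\<^bsub>M\<^esub> x))\<rparr>"

text \<open>Submodules of \<open>M\<close> are covered, up to isomorphism, by \<open>N' = {0}\<close>.\<close>

definition subquotient ::
    "('r, 's) ring_scheme \<Rightarrow> ('r, 'm) module \<Rightarrow> ('r, 'm set) module \<Rightarrow> bool" where
  "subquotient R M S \<longleftrightarrow>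
     (\<exists>N N'. submodule N R M \<and> submodule N' R (M\<lparr>carrier := N\<rparr>) \<and>
        S = quot_module (M\<lparr>carrier := N\<rparr>) N')"

definition module_iso ::
    "('r, 's) ring_scheme \<Rightarrow> ('r, 'm) module \<Rightarrow> ('r, 'n) module \<Rightarrow> bool" where
  "module_iso R V W \<longleftrightarrow>
     (\<exists>\<phi>. bij_betw \<phi> (carrier V) (carrier W) \<and>
        (\<forall>x\<in>carrier V. \<forall>y\<in>carrier V. \<phi> (x \<oplus>\<^bsub>V\<^esub> y) = \<phi> x \<oplus>\<^bsub>W\<^esub> \<phi> y) \<and>
        (\<forall>a\<in>carrier R. \<forall>x\<in>carrier V. \<phi> (a \<odot>\<^bsub>V\<^esub> x) = a \<odot>\<^bsub>W\<^esub> \<phi> x))"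

definition irreducible_module :: "('r, 's) ring_scheme \<Rightarrow> ('r, 'm) module \<Rightarrow> bool" where
  "irreducible_module R V \<longleftrightarrow>
     left_module R V \<and> carrier V \<noteq> {\<zero>\<^bsub>V\<^esub>} \<and>
     (\<forall>N. submodule N R V \<longrightarrow> N = {\<zero>\<^bsub>V\<^esub>} \<or> N = carrier V)"

section \<open>Highest weight modules of type 1\<close>

definition K_eigenvectors :: "complex \<Rightarrow> (ures, 'v) module \<Rightarrow> 'v set" where
  "K_eigenvectors \<epsilon> V =
     {v \<in> carrier V. \<exists>c. spec \<epsilon> (uq_gen GK) \<odot>\<^bsub>V\<^esub> v = scal \<epsilon> c \<odot>\<^bsub>V\<^esub> v}"

definition K_diagonalizable :: "complex \<Rightarrow> (ures, 'v) module \<Rightarrow> bool" where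
  "K_diagonalizable \<epsilon> V \<longleftrightarrow>
     (\<forall>v\<in>carrier V. \<exists>S. finite S \<and> S \<subseteq> K_eigenvectors \<epsilon> V \<and> v = (\<Oplus>\<^bsub>V\<^esub>x\<in>S. x))"

definition type1 :: "nat \<Rightarrow> complex \<Rightarrow> (ures, 'v) module \<Rightarrow> bool" where
  "type1 p \<epsilon> V \<longleftrightarrow>
     left_module (U_res \<epsilon>) V \<and> K_diagonalizable \<epsilon> V \<and>
     (\<forall>v\<in>carrier V. spec \<epsilon> (uq_gen GK ^ p) \<odot>\<^bsub>V\<^esub> v = v \<and>
        spec \<epsilon> (uq_gen GKinv ^ p) \<odot>\<^bsub>V\<^esub> v = v)"

definition weight_space ::
    "nat \<Rightarrow> complex \<Rightarrow> (ures, 'v) module \<Rightarrow> int \<Rightarrow> 'v set" where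
  "weight_space p \<epsilon> V m =
     {v \<in> carrier V.
        spec \<epsilon> (uq_gen GK) \<odot>\<^bsub>V\<^esub> v = scal \<epsilon> (\<epsilon> powi m) \<odot>\<^bsub>V\<^esub> v \<and>
        spec \<epsilon> (K_binom p) \<odot>\<^bsub>V\<^esub> v = scal \<epsilon> (qbinom_at \<epsilon> m (int p)) \<odot>\<^bsub>V\<^esub> v}"

definition highest_weight_module ::
    "nat \<Rightarrow> complex \<Rightarrow> int \<Rightarrow> (ures, 'v) module \<Rightarrow> bool" where
  "highest_weight_module p \<epsilon> l V \<longleftrightarrow>
     type1 p \<epsilon> V \<and>
     (\<exists>v \<in> weight_space p \<epsilon> V l. v \<noteq> \<zero>\<^bsub>V\<^esub> \<and>
        spec \<epsilon> (uq_gen GE) \<odot>\<^bsub>V\<^esub> v = \<zero>\<^bsub>V\<^esub> \<and> spec \<epsilon> (e_div p) \<odot>\<^bsub>V\<^esub> v = \<zero>\<^bsub>V\<^esub> \<and>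
        (\<forall>N. submodule N (U_res \<epsilon>) V \<longrightarrow> v \<in> N \<longrightarrow> N = carrier V))"

definition irreducible_hw ::
    "nat \<Rightarrow> complex \<Rightarrow> int \<Rightarrow> (ures, 'v) module \<Rightarrow> bool" where
  "irreducible_hw p \<epsilon> l V \<longleftrightarrow>
     irreducible_module (U_res \<epsilon>) V \<and> highest_weight_module p \<epsilon> l V"

section \<open>The restricted q-Fock spaces\<close>

type_synonym fock = "nat \<times> nat \<Rightarrow>\<^sub>0 complex"

definition fock_basis :: "int \<Rightarrow> int \<Rightarrow> fock" where
  "fock_basis i j =
     (if 0 \<le> i \<and> 0 \<le> j then Poly_Mapping.single (nat i, nat j) 1 else 0)"

definition fock_scale :: "complex \<Rightarrow> fock \<Rightarrow> fock" where
  "fock_scale c = Poly_Mapping.map ((*) c)"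

definition fock_module :: "complex \<Rightarrow> (ures, fock) module \<Rightarrow> bool" where
  "fock_module \<epsilon> M \<longleftrightarrow>
     left_module (U_res \<epsilon>) M \<and>
     carrier M = UNIV \<and> zero M = 0 \<and> add M = (+) \<and>
     (\<forall>c x. scal \<epsilon> c \<odot>\<^bsub>M\<^esub> x = fock_scale c x)"

text \<open>
  Since the powers of \<open>K\<close> and the divided powers generate the algebra, \<open>fock1\<close> and \<open>fock2\<close>
  determine the scalar multiplication on \<^const>\<open>U_res\<close> completely.
\<close>

definition fock1 :: "complex \<Rightarrow> (ures, fock) module \<Rightarrow> bool" where
  "fock1 \<epsilon> M \<longleftrightarrow>
     fock_module \<epsilon> M \<and>
     (\<forall>i\<ge>0. \<forall>j\<ge>0.
        spec \<epsilon> (uq_gen GK) \<odot>\<^bsub>M\<^esub> fock_basis i j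
          = fock_scale (\<epsilon> powi (i - j)) (fock_basis i j) \<and>
        spec \<epsilon> (uq_gen GKinv) \<odot>\<^bsub>M\<^esub> fock_basis i j
          = fock_scale (\<epsilon> powi (- (i - j))) (fock_basis i j) \<and>
        (\<forall>r\<ge>1.
           spec \<epsilon> (e_div r) \<odot>\<^bsub>M\<^esub> fock_basis i j
             = fock_scale (qbinom_at \<epsilon> (int r + i) (int r)) (fock_basis (i + int r) (j - int r)) \<and>
           spec \<epsilon> (f_div r) \<odot>\<^bsub>M\<^esub> fock_basis i j
             = fock_scale (qbinom_at \<epsilon> (int r + j) (int r)) (fock_basis (i - int r) (j + int r))))"

definition fock2 :: "complex \<Rightarrow> (ures, fock) module \<Rightarrow> bool" where
  "fock2 \<epsilon> M \<longleftrightarrow>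
     fock_module \<epsilon> M \<and>
     (\<forall>i\<ge>0. \<forall>j\<ge>0.
        spec \<epsilon> (uq_gen GK) \<odot>\<^bsub>M\<^esub> fock_basis i j
          = fock_scale (\<epsilon> powi (- (i + j + 1))) (fock_basis i j) \<and>
        spec \<epsilon> (uq_gen GKinv) \<odot>\<^bsub>M\<^esub> fock_basis i j
          = fock_scale (\<epsilon> powi (i + j + 1)) (fock_basis i j) \<and>
        (\<forall>r\<ge>1.
           spec \<epsilon> (e_div r) \<odot>\<^bsub>M\<^esub> fock_basis i j
             = fock_scale (qbinom_at \<epsilon> j (j - int r)) (fock_basis (i - int r) (j - int r)) \<and>
           spec \<epsilon> (f_div r) \<odot>\<^bsub>M\<^esub> fock_basis i j
             = fock_scale ((- 1) ^ r * qbinom_at \<epsilon> (int r + i) (int r))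
                 (fock_basis (i + int r) (j + int r))))"

definition primitive_root_of_unity :: "nat \<Rightarrow> complex \<Rightarrow> bool" where
  "primitive_root_of_unity p \<epsilon> \<longleftrightarrow> \<epsilon> ^ p = 1 \<and> (\<forall>k. 0 < k \<and> k < p \<longrightarrow> \<epsilon> ^ k \<noteq> 1)"

end

theory Submission
  imports Defs
begin

text \<open>
  An irreducible highest weight module is generated by a primitive vector \<open>v\<close>: a weight vector
  killed by \<open>e\<close> and \<open>e^(p)\<close>. Kac's commutation formula (\<open>e_div_f_idiv\<close>) turns \<open>e^(r) f^(s) v\<close> into
  a multiple of \<open>f^(s-r) v\<close>, so the vectors \<open>f^(s) v\<close> span a submodule, on which every generator
  acts with coefficients that depend only on the weight \<open>l\<close> of \<open>v\<close> (\<open>ladder_act\<close>). At a root of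
  unity this takes two preparations: the remaining \<open>e^(r)\<close> kill \<open>v\<close> too (\<open>e_div_prim\<close>), and \<open>[K; c;
  t]\<close> acts on \<open>v\<close> by the expected Gaussian binomial (\<open>K_gauss_weight\<close>). Both follow by cancelling
  the numbers \<open>[t]\<close>, for \<open>t\<close> not divisible by \<open>p\<close>, and \<open>[t; p] = t div p\<close>, for \<open>t \<ge> p\<close>
  (\<open>ev_qbinom_p\<close>), which do not vanish at \<open>\<epsilon>\<close>.

  The vector \<open>f^(s) v\<close> has the integral weight \<open>l - 2s\<close>. As \<open>K\<close> sees a weight modulo \<open>p\<close> and \<open>[K;
  0; p]\<close> sees its quotient by \<open>p\<close> (\<open>weight_eqI\<close>), these weights are separated, and a submodule that
  contains \<open>c v\<close> plus a combination of the \<open>f^(s) v\<close> with \<open>s \<ge> 1\<close> contains \<open>c v\<close>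
  (\<open>component_in_submodule\<close>). This has two consequences. Dividing the module generated by \<open>v\<close> by
  its largest submodule inside the span of the \<open>f^(s) v\<close> with \<open>s \<ge> 1\<close> gives an irreducible highest
  weight module of weight \<open>l\<close> (\<open>irreducible_subquotient\<close>). And for two irreducible modules with
  primitive vectors \<open>v\<close>, \<open>w\<close> of weight \<open>l\<close>, the linear relation matching \<open>f^(s) v\<close> with \<open>f^(s) w\<close>
  is stable under the algebra, and the vectors related to \<open>0\<close> form a submodule that misses \<open>v\<close>,
  hence is \<open>0\<close>: the relation is the graph of an isomorphism (\<open>irreducible_hw_iso\<close>).

  It remains to find primitive vectors of every weight in the Fock spaces: \<open>f(l, 0)\<close> for \<open>l \<ge> 0\<close>
  and \<open>g(0, -l-1)\<close> for \<open>l < 0\<close>. The operator \<open>[K; 0; p]\<close> is not among those whose action is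
  prescribed, but on a vector killed by all \<open>e^(r)\<close> it agrees with \<open>e^(p) f^(p)\<close>
  (\<open>primitive_vectorI\<close>).

  That the Fock spaces exist as modules is seen over \<open>C(q)\<close>: the generators act on functions on the
  set of basis indices, and the divided powers preserve the functions with values in \<open>C[q, 1/q]\<close>. A
  complex function is lifted to constants, acted upon, and evaluated at \<open>\<epsilon>\<close> (\<open>integral_action\<close>).
\<close>

section \<open>Laurent polynomials\<close>

lemma qvar_nonzero: "qvar \<noteq> 0"
  by (simp add: qvar_def Zero_fract_def eq_fract)

definition lconst :: "complex \<Rightarrow> cq" where
  "lconst c = laurent [:c:] 0"

lemma laurent_add:
  "laurent P m + laurent Q n = laurent (P * monom 1 n + Q * monom 1 m) (m + n)"
proof -
  have "Fract (P * monom 1 n + Q * monom 1 m) 1 = Fract P 1 * qvar ^ n + Fract Q 1 * qvar ^ m"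
    by (simp add: qvar_power)
  then show ?thesis
    using qvar_nonzero by (simp add: laurent_def field_simps power_add)
qed

lemma laurent_mult: "laurent P m * laurent Q n = laurent (P * Q) (m + n)"
  by (simp add: laurent_def power_add)

lemma laurent_in_ring [simp]: "laurent P n \<in> laurent_ring"
  by (auto simp: laurent_ring_def)

lemma laurent_ringE:
  assumes "x \<in> laurent_ring"
  obtains P n where "x = laurent P n"
  using assms by (auto simp: laurent_ring_def)

lemma lconst_add: "lconst (a + b) = lconst a + lconst b"
  and lconst_mult: "lconst (a * b) = lconst a * lconst b"
  and lconst_0 [simp]: "lconst 0 = 0" and lconst_1 [simp]: "lconst 1 = 1"
  by (simp_all add: lconst_def laurent_def Zero_fract_def[symmetric] one_pCons[symmetric]
      One_fract_def[symmetric] mult.commute)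

lemma lconst_in_ring [simp]: "lconst c \<in> laurent_ring"
  by (simp add: lconst_def)

lemma laurent_ring_add [intro]: "x \<in> laurent_ring \<Longrightarrow> y \<in> laurent_ring \<Longrightarrow> x + y \<in> laurent_ring"
  by (auto elim!: laurent_ringE simp: laurent_add)

lemma laurent_ring_mult [intro]: "x \<in> laurent_ring \<Longrightarrow> y \<in> laurent_ring \<Longrightarrow> x * y \<in> laurent_ring"
  by (auto elim!: laurent_ringE simp: laurent_mult)

lemma laurent_ring_0 [simp]: "0 \<in> laurent_ring" and laurent_ring_1 [simp]: "1 \<in> laurent_ring"
  using lconst_in_ring[of 0] lconst_in_ring[of 1] by (simp_all del: lconst_in_ring)

lemma lconst_minus_1: "lconst (- 1) = - 1"
  using lconst_add[of 1 "- 1"] by (simp add: eq_neg_iff_add_eq_0 add.commute)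

lemma laurent_ring_uminus [intro]: "x \<in> laurent_ring \<Longrightarrow> - x \<in> laurent_ring"
  using laurent_ring_mult[OF lconst_in_ring[of "- 1"], of x] by (simp add: lconst_minus_1)

lemma laurent_ring_diff [intro]: "x \<in> laurent_ring \<Longrightarrow> y \<in> laurent_ring \<Longrightarrow> x - y \<in> laurent_ring"
  using laurent_ring_add[of x "- y"] by auto

lemma laurent_ring_power [intro]: "x \<in> laurent_ring \<Longrightarrow> x ^ n \<in> laurent_ring"
  by (induction n) auto

lemma qvar_powi_laurent:
  "qvar powi n = (if n \<ge> 0 then laurent (monom 1 (nat n)) 0 else laurent 1 (nat (- n)))"
  by (auto simp: laurent_def power_int_def qvar_power One_fract_def[symmetric] inverse_eq_divide
      power_divide)

lemma qvar_powi_in_ring [simp]: "qvar powi n \<in> laurent_ring"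
  by (simp add: qvar_powi_laurent)

context
  fixes \<epsilon> :: complex
  assumes eps: "\<epsilon> \<noteq> 0"
begin

lemma laurent_eval_add:
  "x \<in> laurent_ring \<Longrightarrow> y \<in> laurent_ring \<Longrightarrow>
     laurent_eval \<epsilon> (x + y) = laurent_eval \<epsilon> x + laurent_eval \<epsilon> y"
  using eps
  by (auto elim!: laurent_ringE simp: laurent_add laurent_eval_laurent poly_monom field_simps
      power_add)

lemma laurent_eval_mult:
  "x \<in> laurent_ring \<Longrightarrow> y \<in> laurent_ring \<Longrightarrow>
     laurent_eval \<epsilon> (x * y) = laurent_eval \<epsilon> x * laurent_eval \<epsilon> y"
  using eps
  by (auto elim!: laurent_ringE simp: laurent_mult laurent_eval_laurent power_add)

lemma laurent_eval_const: "laurent_eval \<epsilon> (lconst c) = c"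
  using eps by (simp add: lconst_def laurent_eval_laurent)

lemma laurent_eval_0: "laurent_eval \<epsilon> 0 = 0" and laurent_eval_1: "laurent_eval \<epsilon> 1 = 1"
  using laurent_eval_const[of 0] laurent_eval_const[of 1] by simp_all

lemma laurent_eval_uminus: "x \<in> laurent_ring \<Longrightarrow> laurent_eval \<epsilon> (- x) = - laurent_eval \<epsilon> x"
  using laurent_eval_add[of x "- x"]
  by (auto simp: laurent_eval_0 eq_neg_iff_add_eq_0 add.commute)

lemma laurent_eval_diff:
  "x \<in> laurent_ring \<Longrightarrow> y \<in> laurent_ring \<Longrightarrow>
     laurent_eval \<epsilon> (x - y) = laurent_eval \<epsilon> x - laurent_eval \<epsilon> y"
  using laurent_eval_add[of x "- y"] by (auto simp: laurent_eval_uminus)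

lemma laurent_eval_power:
  "x \<in> laurent_ring \<Longrightarrow> laurent_eval \<epsilon> (x ^ n) = laurent_eval \<epsilon> x ^ n"
  by (induction n) (simp_all add: laurent_eval_1 laurent_eval_mult laurent_ring_power)

lemma laurent_eval_qvar_powi: "laurent_eval \<epsilon> (qvar powi n) = \<epsilon> powi n"
  using eps unfolding qvar_powi_laurent
  by (simp add: laurent_eval_laurent poly_monom power_int_def inverse_eq_divide power_divide)

end

section \<open>Gaussian binomial coefficients\<close>

abbreviation qdelta :: cq where "qdelta \<equiv> qvar - inverse qvar"

lemma qvar_power_neq_1: "n > 0 \<Longrightarrow> qvar ^ n \<noteq> 1"
  by (simp add: qvar_power One_fract_def eq_fract)
     (metis degree_1 degree_monom_eq less_numeral_extra(3) zero_neq_one)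

lemma qvar_powi_neq_1: "n \<noteq> 0 \<Longrightarrow> qvar powi n \<noteq> 1"
  using qvar_power_neq_1[of "nat n"] qvar_power_neq_1[of "nat (- n)"]
  by (auto simp: power_int_def power_inverse)

lemma qvar_powi_diff_nonzero: "n \<noteq> 0 \<Longrightarrow> qvar powi n - qvar powi (- n) \<noteq> 0"
proof
  assume n: "n \<noteq> 0" and "qvar powi n - qvar powi (- n) = 0"
  then have "qvar powi n * qvar powi n = qvar powi n * qvar powi (- n)"
    by simp
  moreover have "qvar powi (n + n) = qvar powi n * qvar powi n" "qvar powi n * qvar powi (- n) = 1"
    using qvar_nonzero power_int_add[of qvar n n]
    by (simp_all add: power_int_minus field_simps)
  ultimately have "qvar powi (n + n) = 1"
    by simp
  with n qvar_powi_neq_1[of "n + n"] show False by simp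
qed

lemma qdelta_nonzero: "qdelta \<noteq> 0"
  using qvar_powi_diff_nonzero[of 1] by (simp add: power_int_minus)

lemma qint_mult_qdelta:
  "qint n * (qvar powi 1 - qvar powi (- 1)) = qvar powi n - qvar powi (- n)"
  using qdelta_nonzero by (simp add: qint_def power_int_minus)

lemma qint_nonzero: "n \<noteq> 0 \<Longrightarrow> qint n \<noteq> 0"
  using qvar_powi_diff_nonzero qdelta_nonzero by (simp add: qint_def)

lemma qint_0 [simp]: "qint 0 = 0"
  by (simp add: qint_def)

lemma qint_1 [simp]: "qint 1 = 1"
  using qdelta_nonzero by (simp add: qint_def power_int_minus)

lemma qint_uminus: "qint (- n) = - qint n"
  by (simp add: qint_def field_simps diff_divide_distrib)

lemma qfact_nonzero: "qfact n \<noteq> 0"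
  by (auto simp: qfact_def qint_nonzero)

lemma qfact_0 [simp]: "qfact 0 = 1"
  by (simp add: qfact_def)

lemma qfact_Suc: "qfact (Suc n) = qint (int (Suc n)) * qfact n"
  by (simp add: qfact_def prod.cl_ivl_Suc mult.commute)

text \<open>
  The \<open>q\<close>-analogue of additivity. Pascal's rule, the three-term identity for \<open>[K; c]\<close> and the
  commutators in the Fock spaces all reduce to it.
\<close>

lemma qint_add: "qint (m + n) = qvar powi n * qint m + qvar powi (- m) * qint n"
proof -
  have "qvar powi (m + n) - qvar powi (- (m + n)) =
    qvar powi n * (qvar powi m - qvar powi (- m)) + qvar powi (- m) * (qvar powi n
        - qvar powi (- n))"
    using qvar_nonzero by (simp add: power_int_add power_int_minus field_simps power_int_diff)
  then show ?thesis
    by (simp add: qint_def add_divide_distrib)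
qed

lemma qbinom_0 [simp]: "qbinom n 0 = 1"
  by (simp add: qbinom_def)

lemma qbinom_Suc: "qint (int (Suc m)) * qbinom n (int (Suc m))
    = qbinom n (int m) * qint (n - int m)"
  using qint_nonzero[of "int (Suc m)"] qfact_nonzero[of m]
  by (simp add: qbinom_def qfact_Suc nat_add_distrib field_simps del: of_nat_Suc)

lemma qbinom_Suc_shift: "qint (int (Suc m)) * qbinom n (int (Suc m))
    = qint n * qbinom (n - 1) (int m)"
proof -
  have "(\<Prod>i<Suc m. qint (n - int i)) = qint n * (\<Prod>i<m. qint (n - 1 - int i))"
    by (subst prod.lessThan_Suc_shift) (simp add: algebra_simps)
  then show ?thesis
    using qint_nonzero[of "int (Suc m)"] qfact_nonzero[of m]
    by (simp add: qbinom_def qfact_Suc field_simps del: of_nat_Suc prod.lessThan_Suc)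
qed

text \<open>
  Read from right to left as well, the rule moves \<open>n\<close> in both directions, so that statements about
  all integers \<open>n\<close> follow from the case \<open>n = 0\<close>.
\<close>

lemma qbinom_pascal:
  "qbinom (n + 1) (int (Suc m)) =
     qvar powi (int (Suc m)) * qbinom n (int (Suc m)) + qvar powi (int m - n) * qbinom n (int m)"
proof -
  have "qint (int (Suc m)) * qbinom (n + 1) (int (Suc m))
      = qint ((n - int m) + int (Suc m)) * qbinom n (int m)"
    by (subst qbinom_Suc_shift) (simp add: algebra_simps)
  also have "\<dots> = qvar powi (int (Suc m)) * (qbinom n (int m) * qint (n - int m))
      + qvar powi (int m - n) * qbinom n (int m) * qint (int (Suc m))"
    by (subst qint_add) (simp add: algebra_simps)
  also have "\<dots> = qint (int (Suc m)) * (qvar powi (int (Suc m)) * qbinom n (int (Suc m))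
      + qvar powi (int m - n) * qbinom n (int m))"
    by (simp only: qbinom_Suc[symmetric]) (simp add: algebra_simps)
  finally show ?thesis
    using qint_nonzero[of "int (Suc m)"] by (simp del: of_nat_Suc)
qed

lemma qbinom_eq_0: "0 \<le> n \<Longrightarrow> n < int m \<Longrightarrow> qbinom n (int m) = 0"
  by (auto simp: qbinom_def prod_zero_iff intro!: bexI[of _ "nat n"])

lemma qbinom_in_ring [simp]: "qbinom n m \<in> laurent_ring"
proof (cases "m < 0")
  case False
  have "qbinom n (int k) \<in> laurent_ring" for k
  proof (induction k arbitrary: n)
    case (Suc k)
    show ?case
    proof (induction n rule: int_induct[where k = 0])
      case base
      show ?case by (simp add: qbinom_eq_0 del: of_nat_Suc)
    next
      case (step1 n)
      then show ?case
        using Suc unfolding qbinom_pascal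
        by (intro laurent_ring_add laurent_ring_mult qvar_powi_in_ring)
    next
      case (step2 n)
      have "qbinom (n - 1) (int (Suc k)) = qvar powi (- int (Suc k)) *
          (qbinom n (int (Suc k)) - qvar powi (int k - (n - 1)) * qbinom (n - 1) (int k))"
        using qbinom_pascal[of "n - 1" k] qvar_nonzero
        by (simp add: power_int_minus field_simps del: of_nat_Suc)
      then show ?case
        using step2 Suc
        by (simp only:) (intro laurent_ring_diff laurent_ring_mult qvar_powi_in_ring)
    qed
  qed simp
  from this[of "nat m"] False show ?thesis by simp
qed (simp add: qbinom_def)

lemma qint_eq_qbinom: "qint n = qbinom n 1"
  using qbinom_Suc[of 0 n] by simp

lemma qint_in_ring [simp]: "qint n \<in> laurent_ring"
  by (simp add: qint_eq_qbinom)

lemma qbinom_fact: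
  "qbinom (int (m + n)) (int m) = qfact (m + n) / (qfact m * qfact n)"
proof (induction m)
  case 0
  show ?case by (simp add: qfact_nonzero)
next
  case (Suc m)
  have "qint (int (Suc m)) * qbinom (int (Suc m + n)) (int (Suc m)) =
      qint (int (Suc m + n)) * qbinom (int (m + n)) (int m)"
    by (subst qbinom_Suc_shift) simp
  then show ?case
    using Suc qint_nonzero[of "int (Suc m)"] qfact_nonzero
    by (simp add: qfact_Suc field_simps del: of_nat_Suc)
qed

lemma qbinom_sym: "qbinom (int (m + n)) (int m) = qbinom (int (m + n)) (int n)"
  using qbinom_fact[of m n] qbinom_fact[of n m] by (simp add: add.commute mult.commute)

lemma qbinom_split:
  "qbinom x (int (m + n)) * qbinom (int (m + n)) (int m)
      = qbinom x (int m) * qbinom (x - int m) (int n)"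
proof -
  have "(\<Prod>i<m + n. qint (x - int i)) = (\<Prod>i<m. qint (x - int i)) * (\<Prod>i<n. qint (x - int m - int i))"
    by (induction n) (simp_all add: algebra_simps)
  then show ?thesis
    unfolding qbinom_fact using qfact_nonzero
    by (simp add: qbinom_def nat_add_distrib field_simps)
qed

section \<open>Values at a root of unity\<close>

locale odd_root =
  fixes p :: nat and \<epsilon> :: complex
  assumes p_gt_1: "1 < p" and p_odd: "odd p" and prim: "primitive_root_of_unity p \<epsilon>"
begin

lemma eps_power_p: "\<epsilon> ^ p = 1"
  using prim by (simp add: primitive_root_of_unity_def)

lemma eps_nonzero: "\<epsilon> \<noteq> 0"
  using eps_power_p p_gt_1 by (auto simp: power_0_left split: if_splits)

abbreviation ev :: "cq \<Rightarrow> complex" where "ev \<equiv> laurent_eval \<epsilon>"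

lemmas ev_simps = laurent_eval_add[OF eps_nonzero] laurent_eval_mult[OF eps_nonzero]
  laurent_eval_0[OF eps_nonzero] laurent_eval_1[OF eps_nonzero]
  laurent_eval_uminus[OF eps_nonzero] laurent_eval_diff[OF eps_nonzero]
  laurent_eval_qvar_powi[OF eps_nonzero] laurent_eval_const[OF eps_nonzero]
  laurent_eval_power[OF eps_nonzero]

lemma eps_powi_p_mult: "\<epsilon> powi (int p * k) = 1"
  by (simp add: power_int_mult eps_power_p)

lemma eps_powi_mod: "\<epsilon> powi n = \<epsilon> powi (n mod int p)"
proof -
  have "\<epsilon> powi n = \<epsilon> powi (int p * (n div int p) + n mod int p)"
    by simp
  also have "\<dots> = \<epsilon> powi (n mod int p)"
    using eps_nonzero by (subst power_int_add) (simp_all add: eps_powi_p_mult)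
  finally show ?thesis .
qed

lemma eps_powi_eq_1_iff: "\<epsilon> powi n = 1 \<longleftrightarrow> int p dvd n"
proof
  assume *: "\<epsilon> powi n = 1"
  show "int p dvd n"
  proof (rule ccontr)
    assume "\<not> int p dvd n"
    moreover have "0 \<le> n mod int p" "n mod int p < int p"
      using p_gt_1 by simp_all
    ultimately have "0 < nat (n mod int p)" "nat (n mod int p) < p"
      by (auto simp: dvd_eq_mod_eq_0)
    moreover have "\<epsilon> ^ nat (n mod int p) = 1"
      using * eps_powi_mod[of n] \<open>0 \<le> n mod int p\<close> by (simp add: power_int_def)
    ultimately show False
      using prim by (auto simp: primitive_root_of_unity_def)
  qed
qed (auto simp: eps_powi_p_mult)

lemma eps_powi_eq_iff: "\<epsilon> powi m = \<epsilon> powi n \<longleftrightarrow> int p dvd m - n"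
  using eps_nonzero by (simp add: eps_powi_eq_1_iff[symmetric] power_int_diff)

lemma ev_qint:
  "ev (qint n) * (\<epsilon> powi 1 - \<epsilon> powi (- 1)) = \<epsilon> powi n - \<epsilon> powi (- n)"
proof -
  have "ev (qint n * (qvar powi 1 - qvar powi (- 1))) = ev (qvar powi n - qvar powi (- n))"
    by (simp only: qint_mult_qdelta)
  then show ?thesis
    by (simp only: ev_simps laurent_ring_diff qvar_powi_in_ring qint_in_ring)
qed

text \<open>
  Oddness of \<open>p\<close> enters here: \<open>[n]\<close> vanishes at \<open>\<epsilon>\<close> when \<open>\<epsilon>\<close> to the power \<open>2n\<close> is \<open>1\<close>, and this
  must force \<open>p\<close> to divide \<open>n\<close>.
\<close>

lemma p_dvd_double_iff: "int p dvd n - (- n) \<longleftrightarrow> int p dvd n"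
  using p_odd coprime_dvd_mult_right_iff[of "int p" 2 n] by simp

lemma eps_diff_nonzero: "\<epsilon> powi 1 - \<epsilon> powi (- 1) \<noteq> 0"
  using eps_powi_eq_iff[of 1 "- 1"] p_dvd_double_iff[of 1] p_gt_1 by simp

lemma ev_qint_eq_0_iff: "ev (qint n) = 0 \<longleftrightarrow> int p dvd n"
proof -
  have "ev (qint n) = 0 \<longleftrightarrow> \<epsilon> powi n = \<epsilon> powi (- n)"
    using ev_qint[of n] eps_diff_nonzero by (metis mult_eq_0_iff right_minus_eq)
  then show ?thesis
    by (simp only: eps_powi_eq_iff p_dvd_double_iff)
qed

lemma ev_qint_cong: "ev (qint (n + int p * k)) = ev (qint n)"
proof -
  have "\<epsilon> powi (n + int p * k) = \<epsilon> powi n" "\<epsilon> powi (- (n + int p * k)) = \<epsilon> powi (- n)"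
    by (simp_all only: eps_powi_eq_iff) simp_all
  then have "ev (qint (n + int p * k)) * (\<epsilon> powi 1 - \<epsilon> powi (- 1)) =
      ev (qint n) * (\<epsilon> powi 1 - \<epsilon> powi (- 1))"
    by (simp only: ev_qint)
  with eps_diff_nonzero show ?thesis by simp
qed

lemma ev_qfact_nonzero: "n < p \<Longrightarrow> ev (qfact n) \<noteq> 0 \<and> qfact n \<in> laurent_ring"
proof (induction n)
  case (Suc n)
  then have "ev (qint (int (Suc n))) \<noteq> 0"
    unfolding ev_qint_eq_0_iff by (auto dest!: zdvd_imp_le)
  then show ?case
    using Suc by (auto simp: qfact_Suc ev_simps simp del: of_nat_Suc)
qed (simp add: ev_simps)

text \<open>
  Among \<open>p - 1\<close> consecutive integers there is a multiple of \<open>p\<close>, unless they are the residues \<open>-1,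
  \<dots>, -(p-1)\<close>; in that case numerator and denominator agree up to the sign \<open>(-1)^(p-1) = 1\<close>.
\<close>

lemma ev_qbinom_pred:
  "ev (qbinom n (int (p - 1))) = (if int p dvd n + 1 then 1 else 0)"
proof -
  have in_ring: "(\<Prod>i<m. qint (n - int i)) \<in> laurent_ring"
    and prod: "ev (\<Prod>i<m. qint (n - int i)) = (\<Prod>i<m. ev (qint (n - int i)))" for m
    by (induction m) (auto simp: ev_simps)
  have fact: "ev (qfact m) = (\<Prod>i<m. ev (qint (int i + 1)))" "qfact m \<in> laurent_ring" for m
    by (induction m) (auto simp: ev_simps qfact_Suc add.commute mult.commute)
  have "qbinom n (int (p - 1)) * qfact (p - 1) = (\<Prod>i<p - 1. qint (n - int i))"
    using qfact_nonzero by (simp add: qbinom_def del: of_nat_diff)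
  then have "ev (qbinom n (int (p - 1)) * qfact (p - 1)) = ev (\<Prod>i<p - 1. qint (n - int i))"
    by simp
  then have *: "ev (qbinom n (int (p - 1))) * ev (qfact (p - 1))
      = (\<Prod>i<p - 1. ev (qint (n - int i)))"
    by (subst (asm) ev_simps) (simp_all only: fact prod qbinom_in_ring)
  have nz: "ev (qfact (p - 1)) \<noteq> 0"
    using ev_qfact_nonzero[of "p - 1"] p_gt_1 by simp
  show ?thesis
  proof (cases "int p dvd n + 1")
    case True
    then obtain k where "n + 1 = int p * k"
      by (rule dvdE)
    then have "n = - 1 + int p * k"
      by simp
    then have "ev (qint (n - int i)) = - ev (qint (int i + 1))" for i
      using ev_qint_cong[of "- (int i + 1)" k] qint_in_ring[of "int i + 1"]
      by (simp only: qint_uminus ev_simps) (simp add: algebra_simps)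
    then have "(\<Prod>i<p - 1. ev (qint (n - int i))) = (\<Prod>i<p - 1. - 1 * ev (qint (int i + 1)))"
      by simp
    also have "\<dots> = (- 1) ^ (p - 1) * ev (qfact (p - 1))"
      by (subst prod.distrib) (simp add: fact)
    also have "\<dots> = ev (qfact (p - 1))"
      using p_odd by simp
    finally show ?thesis
      using * nz True by simp
  next
    case False
    \<comment> \<open>The factor \<open>[n - j]\<close> of the numerator vanishes.\<close>
    define j where "j = nat (n mod int p)"
    have mod: "0 \<le> n mod int p" "n mod int p < int p"
      using p_gt_1 by simp_all
    have "n mod int p \<noteq> int p - 1"
    proof
      assume "n mod int p = int p - 1"
      then have "(n + 1) mod int p = 0"
        by (metis add.commute diff_add_cancel mod_add_left_eq mod_self)
      with False show False by (simp add: dvd_eq_mod_eq_0)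
    qed
    then have "j < p - 1" and "int p dvd n - int j"
      using mod by (auto simp: j_def mod_0_imp_dvd[OF _ ] minus_mod_eq_mult_div)
    then have "(\<Prod>i<p - 1. ev (qint (n - int i))) = 0"
      by (auto simp: prod_zero_iff ev_qint_eq_0_iff)
    then have "ev (qbinom n (int (p - 1))) = 0"
      using * nz by (metis mult_eq_0_iff)
    then show ?thesis
      using False by (simp only: if_False)
  qed
qed

text \<open>
  By Pascal's rule the value grows by one exactly when \<open>n\<close> passes to a multiple of \<open>p\<close>.
\<close>

lemma ev_qbinom_p: "ev (qbinom n (int p)) = of_int (n div int p)"
proof -
  have p: "Suc (p - 1) = p"
    using p_gt_1 by simp
  have step: "ev (qbinom (n + 1) (int p)) = ev (qbinom n (int p)) + (if int p dvd n
      + 1 then 1 else 0)" for n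
  proof -
    have "ev (qbinom (n + 1) (int p)) = ev (qvar powi (int p) * qbinom n (int p) +
        qvar powi (int (p - 1) - n) * qbinom n (int (p - 1)))"
      using qbinom_pascal[of n "p - 1"] by (simp only: p)
    also have "\<dots> = ev (qbinom n (int p)) + \<epsilon> powi (int (p - 1) - n) * ev (qbinom n (int (p - 1)))"
      by (simp only: ev_simps laurent_ring_mult qvar_powi_in_ring qbinom_in_ring)
        (simp add: eps_power_p)
    finally have "ev (qbinom (n + 1) (int p)) = ev (qbinom n (int p)) +
        \<epsilon> powi (int (p - 1) - n) * ev (qbinom n (int (p - 1)))" .
    moreover have "\<epsilon> powi (int (p - 1) - n) = 1" if "int p dvd n + 1"
    proof -
      have "int (p - 1) - n = int p - (n + 1)" using p_gt_1 by simp
      with that show ?thesis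
        unfolding eps_powi_eq_1_iff by (metis dvd_diff dvd_refl)
    qed
    ultimately show ?thesis
      by (simp only: ev_qbinom_pred) auto
  qed
  have div: "(n + 1) div int p = n div int p + (if int p dvd n + 1 then 1 else 0)" for n
  proof -
    have "(n + 1) div int p = n div int p + (n mod int p + 1) div int p"
      using p_gt_1 by (subst div_add1_eq) simp
    moreover have "int p dvd n + 1 \<longleftrightarrow> int p dvd n mod int p + 1"
      by (simp add: dvd_eq_mod_eq_0 mod_add_left_eq)
    moreover have "0 \<le> n mod int p" "n mod int p < int p"
      using p_gt_1 by simp_all
    moreover from this have "int p dvd n mod int p + 1 \<longleftrightarrow> n mod int p + 1 = int p"
      by (auto dest: zdvd_imp_le)
    ultimately show ?thesis
      by (auto simp: div_pos_pos_trivial)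
  qed
  show ?thesis
  proof (induction n rule: int_induct[where k = 0])
    case base
    show ?case
      using p_gt_1 by (simp add: qbinom_eq_0 ev_simps)
  next
    case (step1 n)
    then show ?case using step[of n] div[of n] by simp
  next
    case (step2 n)
    then show ?case using step[of "n - 1"] div[of "n - 1"] by (auto split: if_splits)
  qed
qed

text \<open>
  The first condition determines \<open>m\<close> modulo \<open>p\<close>, the second the quotient of \<open>m\<close> by \<open>p\<close>.
\<close>

lemma weight_eqI:
  assumes "\<epsilon> powi m = \<epsilon> powi n" "ev (qbinom m (int p)) = ev (qbinom n (int p))"
  shows "m = n"
proof -
  have "m mod int p = n mod int p"
    using assms(1) by (simp add: eps_powi_eq_iff mod_eq_dvd_iff)
  moreover have "m div int p = n div int p"
    using assms(2) by (simp add: ev_qbinom_p)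
  ultimately show ?thesis
    by (metis mult_div_mod_eq)
qed

end

section \<open>Divided powers in the quantised enveloping algebra\<close>

definition uconst :: "cq \<Rightarrow> uq" where
  "uconst c = abs_uq (free_const c)"

abbreviation (input) "uE \<equiv> uq_gen GE"
abbreviation (input) "uF \<equiv> uq_gen GF"
abbreviation (input) "uK \<equiv> uq_gen GK"
abbreviation (input) "uKi \<equiv> uq_gen GKinv"

lemma uq_scale_uconst: "uq_scale c x = uconst c * x"
  by (simp add: uq_scale_def uconst_def)

lemma uconst_commute: "x * uconst c = uconst c * x"
  using uq_scale_mult_right[of c x 1] by (simp add: uq_scale_uconst)

lemma uconst_left_commute: "uconst a * (uconst b * x) = uconst b * (uconst a * x)"
  by (simp add: mult.assoc[symmetric] uconst_commute[of "uconst a"])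

lemma uconst_add: "uconst (a + b) = uconst a + uconst b"
  by (simp add: uconst_def free_const_def single_add plus_uq.abs_eq[symmetric])

lemma uconst_mult: "uconst (a * b) = uconst a * uconst b"
  by (simp add: uconst_def free_const_def mult_single times_uq.abs_eq)

lemma uconst_0 [simp]: "uconst 0 = 0" and uconst_1 [simp]: "uconst 1 = 1"
  by (simp_all add: uconst_def free_const_def zero_uq.abs_eq one_uq.abs_eq)

lemma uconst_uminus: "uconst (- a) = - uconst a"
  using uconst_add[of a "- a"] by (simp add: eq_neg_iff_add_eq_0 add.commute)

lemma uconst_diff: "uconst (a - b) = uconst a - uconst b"
  using uconst_add[of a "- b"] by (simp add: uconst_uminus)

lemma uconst_cancel:
  assumes "c \<noteq> 0" "uconst c * x = uconst c * y"
  shows "x = y"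
proof -
  have "uconst (inverse c) * (uconst c * x) = uconst (inverse c) * (uconst c * y)"
    by (simp only: assms(2))
  then show ?thesis
    using assms(1) by (simp add: mult.assoc[symmetric] uconst_mult[symmetric])
qed

text \<open>Together with associativity these move all coefficients to the front of a product.\<close>

lemma uconst_front:
  "uq_gen g * uconst c = uconst c * uq_gen g"
  "uq_gen g * (uconst c * x) = uconst c * (uq_gen g * x)"
  "e_div r * uconst c = uconst c * e_div r"
  "e_div r * (uconst c * x) = uconst c * (e_div r * x)"
  "f_div r * uconst c = uconst c * f_div r"
  "f_div r * (uconst c * x) = uconst c * (f_div r * x)"
  by (simp_all add: uconst_commute mult.assoc[symmetric])

lemma sl2_rels_0: "r \<in> sl2_rels \<Longrightarrow> abs_uq r = 0"
  using sl2_ideal.rel[of r 1 1] by (simp add: zero_uq.abs_eq uq.abs_eq_iff sl2_cong_def)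

lemma uK_uKi: "uK * uKi = 1" and uKi_uK: "uKi * uK = 1"
  and uK_uE_uKi: "uK * uE * uKi = uconst (qvar\<^sup>2) * uE"
  and uK_uF_uKi: "uK * uF * uKi = uconst (inverse (qvar\<^sup>2)) * uF"
  and uE_uF: "uE * uF - uF * uE = uconst (inverse qdelta) * (uK - uKi)"
proof -
  let ?E = "free_gen GE" and ?F = "free_gen GF" and ?K = "free_gen GK" and ?K' = "free_gen GKinv"
  have "abs_uq (?K * ?K' - 1) = 0" "abs_uq (?K' * ?K - 1) = 0"
    "abs_uq (?K * ?E * ?K' - free_const (qvar\<^sup>2) * ?E) = 0"
    "abs_uq (?K * ?F * ?K' - free_const (inverse (qvar\<^sup>2)) * ?F) = 0"
    "abs_uq (?E * ?F - ?F * ?E - free_const (inverse qdelta) * (?K - ?K')) = 0"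
    by (rule sl2_rels_0; simp add: sl2_rels_def Let_def)+
  then show "uK * uKi = 1" "uKi * uK = 1" "uK * uE * uKi = uconst (qvar\<^sup>2) * uE"
    "uK * uF * uKi = uconst (inverse (qvar\<^sup>2)) * uF"
    "uE * uF - uF * uE = uconst (inverse qdelta) * (uK - uKi)"
    by (simp_all add: uq_gen_def uconst_def minus_uq.abs_eq[symmetric] times_uq.abs_eq[symmetric]
        one_uq.abs_eq[symmetric])
qed

lemma uKi_commute:
  assumes "uK * x = uconst (qvar powi n) * (x * uK)"
  shows "uKi * x = uconst (qvar powi (- n)) * (x * uKi)"
proof -
  have "x * uKi = uKi * (uK * x) * uKi"
    by (simp add: mult.assoc[symmetric] uKi_uK)
  also have "\<dots> = uconst (qvar powi n) * (uKi * x)"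
    by (simp add: assms uK_uKi uconst_front mult.assoc)
  finally show ?thesis
    using qvar_nonzero
    by (simp add: mult.assoc[symmetric] uconst_mult[symmetric] power_int_minus)
qed

lemma conj_to_commute:
  assumes "uK * x * uKi = uconst (qvar powi n) * x"
  shows "uK * x = uconst (qvar powi n) * (x * uK)"
proof -
  have "uK * x = (uK * x * uKi) * uK"
    by (simp add: mult.assoc uKi_uK)
  then show ?thesis
    by (simp only: assms) (simp only: mult.assoc)
qed

lemma uK_uE: "uK * uE = uconst (qvar powi 2) * (uE * uK)"
  and uK_uF: "uK * uF = uconst (qvar powi (- 2)) * (uF * uK)"
  using conj_to_commute[of uE 2] conj_to_commute[of uF "- 2"] uK_uE_uKi uK_uF_uKi
  by (simp_all add: power_int_minus)

text \<open>These are the elements written \<open>[K; c]\<close> and \<open>[K; c; t]\<close>.\<close>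

definition K_int :: "int \<Rightarrow> uq" where
  "K_int c = uconst (inverse qdelta) * (uconst (qvar powi c) * uK - uconst (qvar powi (- c)) * uKi)"

primrec K_gauss :: "int \<Rightarrow> nat \<Rightarrow> uq" where
  "K_gauss c 0 = 1"
| "K_gauss c (Suc t) = uconst (inverse (qint (int (Suc t)))) * (K_gauss c t * K_int (c - int t))"

lemma K_int_front:
  "K_int a * uconst c = uconst c * K_int a"
  "K_int a * (uconst c * x) = uconst c * (K_int a * x)"
  "K_gauss a t * uconst c = uconst c * K_gauss a t"
  "K_gauss a t * (uconst c * x) = uconst c * (K_gauss a t * x)"
  by (simp_all add: uconst_commute mult.assoc[symmetric])

text \<open>
  A weight vector \<open>x\<close> for conjugation by \<open>K\<close> shifts the argument \<open>c\<close>; this covers the generators,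
  the divided powers and the polynomials in \<open>K\<close> at once.
\<close>

lemma K_int_shift:
  assumes "uK * x = uconst (qvar powi n) * (x * uK)"
  shows "K_int c * x = x * K_int (c + n)"
proof -
  have "qvar powi (c + n) = qvar powi c * qvar powi n"
       "qvar powi (- (c + n)) = qvar powi (- c) * qvar powi (- n)"
    using qvar_nonzero power_int_add[of qvar c n] power_int_add[of qvar "- c" "- n"] by simp_all
  moreover have "x * uconst a = uconst a * x" "x * (uconst a * y) = uconst a * (x * y)" for a y
    by (simp_all add: uconst_commute mult.assoc[symmetric])
  ultimately show ?thesis
    by (simp only: K_int_def right_diff_distrib left_diff_distrib mult.assoc assms
        uKi_commute[OF assms] uconst_mult)
qed

lemma K_gauss_shift:
  assumes "uK * x = uconst (qvar powi n) * (x * uK)"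
  shows "K_gauss c t * x = x * K_gauss (c + n) t"
proof (induction t)
  case (Suc t)
  have IH: "K_gauss c t * (x * y) = x * (K_gauss (c + n) t * y)" for y
    by (simp add: mult.assoc[symmetric] Suc)
  have idx: "c - int t + n = c + n - int t"
    by simp
  have "x * (uconst a * y) = uconst a * (x * y)" for a y
    by (simp add: uconst_commute mult.assoc[symmetric])
  then show ?case
    by (simp only: K_gauss.simps mult.assoc K_int_shift[OF assms] IH idx)
qed simp

lemma K_gauss_K_int_commute: "K_gauss c t * K_int d = K_int d * K_gauss c t"
proof -
  have "uK * K_int d = uconst (qvar powi 0) * (K_int d * uK)"
    using K_int_shift[of uK 0 d] by simp
  from K_gauss_shift[OF this] show ?thesis by simp
qed

text \<open>The quantum form of \<open>n (x - m) + m (x + n) = (n + m) x\<close>.\<close>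

lemma K_int_three_term:
  "uconst (qint n) * K_int (x - m) + uconst (qint m) * K_int (x + n)
      = uconst (qint (n + m)) * K_int x"
proof -
  have 1: "qint n * qvar powi (x - m) + qint m * qvar powi (x + n) = qint (n + m) * qvar powi x"
    using qvar_nonzero power_int_add[of qvar x "- m"] power_int_add[of qvar x n] qint_add[of m n]
    by (simp add: add.commute[of n m] algebra_simps)
  have 2: "qint n * qvar powi (- (x - m)) + qint m * qvar powi (- (x + n))
      = qint (n + m) * qvar powi (- x)"
    using qvar_nonzero power_int_add[of qvar "- x" m] power_int_add[of qvar "- x"
        "- n"] qint_add[of n m]
    by (simp add: algebra_simps)
  have "uconst (qint n) * K_int (x - m) + uconst (qint m) * K_int (x + n) =
    uconst (inverse qdelta) *
      (uconst (qint n * qvar powi (x - m) + qint m * qvar powi (x + n)) * uK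
       - uconst (qint n * qvar powi (- (x - m)) + qint m * qvar powi (- (x + n))) * uKi)"
    by (simp add: K_int_def uconst_add uconst_mult uconst_left_commute algebra_simps)
  also have "\<dots> = uconst (qint (n + m)) * K_int x"
    unfolding 1 2
    by (simp add: K_int_def uconst_mult uconst_left_commute algebra_simps)
  finally show ?thesis .
qed

lemma uE_uF_commute: "uE * uF = uF * uE + K_int 0"
  using uE_uF by (simp add: K_int_def algebra_simps)

lemma e_div_0 [simp]: "e_div 0 = 1" and f_div_0 [simp]: "f_div 0 = 1"
  by (simp_all add: e_div_def f_div_def uq_scale_uconst)

lemma e_div_1: "e_div 1 = uE" and f_div_1: "f_div 1 = uF"
  by (simp_all add: e_div_def f_div_def uq_scale_uconst qfact_def)

lemma qint_qfact: "qint (int (Suc r)) * inverse (qfact (Suc r)) = inverse (qfact r)"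
  using qint_nonzero[of "int (Suc r)"] by (simp add: qfact_Suc field_simps del: of_nat_Suc)

lemma e_div_Suc: "uE * e_div r = uconst (qint (int (Suc r))) * e_div (Suc r)"
    "e_div r * uE = uconst (qint (int (Suc r))) * e_div (Suc r)"
proof -
  show *: "uE * e_div r = uconst (qint (int (Suc r))) * e_div (Suc r)"
    by (simp add: e_div_def uq_scale_uconst uconst_front mult.assoc[symmetric]
        uconst_mult[symmetric] qint_qfact del: of_nat_Suc)
  have "e_div r * uE = uE * e_div r"
    by (simp add: e_div_def uq_scale_uconst uconst_front mult.assoc power_commutes)
  with * show "e_div r * uE = uconst (qint (int (Suc r))) * e_div (Suc r)"
    by simp
qed

lemma f_div_Suc: "uF * f_div r = uconst (qint (int (Suc r))) * f_div (Suc r)"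
    "f_div r * uF = uconst (qint (int (Suc r))) * f_div (Suc r)"
proof -
  show *: "uF * f_div r = uconst (qint (int (Suc r))) * f_div (Suc r)"
    by (simp add: f_div_def uq_scale_uconst uconst_front mult.assoc[symmetric]
        uconst_mult[symmetric] qint_qfact del: of_nat_Suc)
  have "f_div r * uF = uF * f_div r"
    by (simp add: f_div_def uq_scale_uconst uconst_front mult.assoc power_commutes)
  with * show "f_div r * uF = uconst (qint (int (Suc r))) * f_div (Suc r)"
    by simp
qed

lemma e_div_mult: "e_div r * e_div s = uconst (qbinom (int (r + s)) (int r)) * e_div (r + s)"
  and f_div_mult: "f_div r * f_div s = uconst (qbinom (int (r + s)) (int r)) * f_div (r + s)"
proof -
  have "uconst (inverse (qfact r)) * x ^ r * (uconst (inverse (qfact s)) * x ^ s) =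
      uconst (qbinom (int (r + s)) (int r)) * (uconst (inverse (qfact (r + s))) * x ^ (r
          + s))" for x
  proof -
    have "x ^ r * (uconst (inverse (qfact s)) * x ^ s)
        = uconst (inverse (qfact s)) * (x ^ r * x ^ s)"
      by (simp only: mult.assoc[symmetric] uconst_commute)
    moreover have "inverse (qfact r) * inverse (qfact s) =
        qbinom (int (r + s)) (int r) * inverse (qfact (r + s))"
      unfolding qbinom_fact using qfact_nonzero by (simp add: field_simps)
    ultimately show ?thesis
      by (simp only: mult.assoc power_add) (simp only: mult.assoc[symmetric] uconst_mult[symmetric])
  qed
  then show "e_div r * e_div s = uconst (qbinom (int (r + s)) (int r)) * e_div (r + s)"
    "f_div r * f_div s = uconst (qbinom (int (r + s)) (int r)) * f_div (r + s)"
    by (simp_all only: e_div_def f_div_def uq_scale_uconst)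
qed

text \<open>Indexing by integers absorbs the boundary cases of the commutation rules.\<close>

definition f_idiv :: "int \<Rightarrow> uq" where
  "f_idiv n = (if n < 0 then 0 else f_div (nat n))"

lemma f_idiv_of_nat [simp]: "f_idiv (int n) = f_div n"
  by (simp add: f_idiv_def)

lemma f_idiv_front:
  "f_idiv n * uconst c = uconst c * f_idiv n"
  "f_idiv n * (uconst c * x) = uconst c * (f_idiv n * x)"
  by (simp_all add: uconst_commute mult.assoc[symmetric])

lemma f_idiv_uF: "f_idiv n * uF = uconst (qint (n + 1)) * f_idiv (n + 1)"
proof (cases "n < 0")
  case True
  then show ?thesis by (cases "n = - 1") (simp_all add: f_idiv_def)
next
  case False
  then show ?thesis
    using f_div_Suc(2)[of "nat n"] by (simp add: f_idiv_def nat_add_distrib add.commute)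
qed

lemma uE_f_idiv: "uE * f_idiv n = f_idiv n * uE + f_idiv (n - 1) * K_int (1 - n)"
proof (cases "n < 0")
  case False
  have "uE * f_div m = f_div m * uE + f_idiv (int m - 1) * K_int (1 - int m)" for m
  proof (induction m)
    case (Suc m)
    let ?c = "uconst (qint (int (Suc m)))"
    have "?c * (uE * f_div (Suc m)) = uE * f_div m * uF"
      by (simp add: mult.assoc f_div_Suc uconst_front del: of_nat_Suc)
    also have "\<dots> = f_div m * (uE * uF) + f_idiv (int m - 1) * (K_int (1 - int m) * uF)"
      by (simp add: Suc distrib_right mult.assoc)
    also have "\<dots> = f_div m * uF * uE + f_div m * K_int 0 + f_idiv (int m - 1) * uF * K_int (- 1
        - int m)"
      by (simp add: uE_uF_commute K_int_shift[OF uK_uF] distrib_left mult.assoc)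
    also have "K_int (- 1 - int m) = K_int (- int m - 1)"
      by (rule arg_cong) simp
    also have "f_div m * uF * uE + f_div m * K_int 0 + f_idiv (int m - 1) * uF * K_int (- int m
        - 1) =
        ?c * (f_div (Suc m) * uE) + f_div m * (uconst (qint (int m)) * K_int (- int m - 1)
            + uconst (qint 1) * K_int (- int m + int m))"
    proof -
      have "f_idiv (int m - 1) * uF = uconst (qint (int m)) * f_div m"
        by (simp add: f_idiv_uF)
      then show ?thesis
        by (simp only: f_div_Suc mult.assoc distrib_left uconst_front) (simp add: add_ac)
    qed
    also have "uconst (qint (int m)) * K_int (- int m - 1) + uconst (qint 1) * K_int (- int m
        + int m) =
        ?c * K_int (- int m)"
      by (subst K_int_three_term) (simp only: of_nat_Suc add.commute)
    also have "f_div m * (?c * K_int (- int m))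
        = ?c * (f_idiv (int (Suc m) - 1) * K_int (1 - int (Suc m)))"
      by (simp only: uconst_front) simp
    also have "?c * (f_div (Suc m) * uE) + \<dots> =
        ?c * (f_div (Suc m) * uE + f_idiv (int (Suc m) - 1) * K_int (1 - int (Suc m)))"
      by (simp only: distrib_left)
    finally have "uE * f_div (Suc m) = f_div (Suc m) * uE + f_idiv (int (Suc m) - 1) * K_int (1
        - int (Suc m))"
      by (rule uconst_cancel[rotated]) (simp add: qint_nonzero)
    then show ?case .
  qed (simp add: f_idiv_def)
  from this[of "nat n"] False show ?thesis by (simp add: f_idiv_def[of n])
qed (simp add: f_idiv_def)

lemma K_gauss_pred: "uconst (qint (int (Suc t))) * K_gauss c (Suc t)
    = K_gauss c t * K_int (c - int t)"
  using qint_nonzero[of "int (Suc t)"]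
  by (simp add: mult.assoc[symmetric] uconst_mult[symmetric] del: of_nat_Suc)

text \<open>
  The recursion splits off the last factor of \<open>[K; c; t]\<close>; this splits off the first one.
\<close>

lemma K_gauss_pred_shift: "uconst (qint (int (Suc t))) * K_gauss (c + 1) (Suc t)
    = K_int (c + 1) * K_gauss c t"
proof (induction t)
  case 0
  show ?case by simp
next
  case (Suc t)
  let ?c = "\<lambda>t. uconst (qint (int (Suc t)))"
  have idx: "c + 1 - int (Suc t) = c - int t"
    by simp
  have "?c t * (?c (Suc t) * K_gauss (c + 1) (Suc (Suc t)))
      = ?c t * K_gauss (c + 1) (Suc t) * K_int (c - int t)"
    by (subst K_gauss_pred) (simp only: mult.assoc idx)
  also have "\<dots> = K_int (c + 1) * (K_gauss c t * K_int (c - int t))"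
    by (simp only: Suc mult.assoc)
  also have "\<dots> = ?c t * (K_int (c + 1) * K_gauss c (Suc t))"
    by (simp only: K_gauss_pred[symmetric] K_int_front)
  finally show ?case
    by (rule uconst_cancel[rotated]) (simp add: qint_nonzero)
qed

text \<open>
  Kac's formula. In the inductive step the terms with equal powers of \<open>E\<close> and \<open>F\<close> are collected by
  the three-term identity.
\<close>

lemma e_div_f_idiv:
  "e_div r * f_idiv s =
     (\<Sum>t\<le>r. f_idiv (s - int t) * K_gauss (2 * int t - int r - s) t * e_div (r - t))"
proof (induction r)
  case 0
  show ?case by simp
next
  case (Suc r)
  let ?c = "uconst (qint (int (Suc r)))"
  let ?K = "\<lambda>t. K_gauss (2 * int t - int r - s - 2) t"
  let ?F = "\<lambda>t. f_idiv (s - int t)" and ?E = "\<lambda>t. e_div (Suc r - t)"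
  let ?S = "\<lambda>t. f_idiv (s - int t) * K_gauss (2 * int t - int (Suc r) - s) t * e_div (Suc r - t)"
  have *: "uE * (f_idiv (s - int t) * K_gauss (2 * int t - int r - s) t * e_div (r - t)) =
      uconst (qint (int (Suc r - t))) * (?F t * ?K t * ?E t)
      + ?F (Suc t) * (K_int (int (Suc t) - s) * K_gauss (2 * int (Suc t) - int r - s
          - 2) t) * ?E (Suc t)"
    if "t \<le> r" for t
  proof -
    have "uE * (f_idiv (s - int t) * K_gauss (2 * int t - int r - s) t * e_div (r - t)) =
       (uE * f_idiv (s - int t)) * K_gauss (2 * int t - int r - s) t * e_div (r - t)"
      by (simp add: mult.assoc)
    also have "\<dots> = ?F t * (uE * K_gauss (2 * int t - int r - s) t) * e_div (r - t)
       + ?F (Suc t) * (K_int (int (Suc t) - s) * K_gauss (2 * int (Suc t) - int r - s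
           - 2) t) * ?E (Suc t)"
      by (simp add: uE_f_idiv distrib_right mult.assoc algebra_simps)
    also have "uE * K_gauss (2 * int t - int r - s) t = ?K t * uE"
      by (simp add: K_gauss_shift[OF uK_uE])
    also have "?F t * (?K t * uE) * e_div (r - t) = ?F t * ?K t * (uE * e_div (r - t))"
      by (simp add: mult.assoc)
    also have "\<dots> = uconst (qint (int (Suc r - t))) * (?F t * ?K t * ?E t)"
      using that by (simp add: e_div_Suc(1) Suc_diff_le mult.assoc f_idiv_front K_int_front)
    finally show ?thesis .
  qed
  have "?c * (e_div (Suc r) * f_idiv s) = uE * (e_div r * f_idiv s)"
    by (simp only: mult.assoc[symmetric] e_div_Suc)
  also have "\<dots> = (\<Sum>t\<le>r. uE * (f_idiv (s - int t) * K_gauss (2 * int t - int r - s) t * e_div (r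
      - t)))"
    by (simp only: Suc sum_distrib_left)
  also have "\<dots> = (\<Sum>t\<le>r. uconst (qint (int (Suc r - t))) * (?F t * ?K t * ?E t)
      + ?F (Suc t) * (K_int (int (Suc t) - s) * K_gauss (2 * int (Suc t) - int r - s
          - 2) t) * ?E (Suc t))"
    by (rule sum.cong) (simp_all only: * atMost_iff)
  also have "\<dots> = (\<Sum>t\<le>r. uconst (qint (int (Suc r - t))) * (?F t * ?K t * ?E t))
     + (\<Sum>t\<le>r. ?F (Suc t) * (K_int (int (Suc t) - s) * K_gauss (2 * int (Suc t) - int r - s
         - 2) t) * ?E (Suc t))"
    by (rule sum.distrib)
  also have "(\<Sum>t\<le>r. uconst (qint (int (Suc r - t))) * (?F t * ?K t * ?E t)) =
      (\<Sum>t\<le>Suc r. uconst (qint (int (Suc r - t))) * (?F t * ?K t * ?E t))"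
    by simp
  also have "\<dots> = uconst (qint (int (Suc r))) * (?F 0 * ?K 0 * ?E 0) +
      (\<Sum>t\<le>r. uconst (qint (int (r - t))) * (?F (Suc t) * ?K (Suc t) * ?E (Suc t)))"
    by (subst sum.atMost_Suc_shift) simp
  also have "\<dots> + (\<Sum>t\<le>r. ?F (Suc t) * (K_int (int (Suc t) - s) * K_gauss (2 * int (Suc t) - int r - s
      - 2) t) * ?E (Suc t))
     = ?c * ?S 0 + (\<Sum>t\<le>r. ?c * ?S (Suc t))"
  proof -
    have "uconst (qint (int (r - t))) * (?F (Suc t) * ?K (Suc t) * ?E (Suc t)) +
        ?F (Suc t) * (K_int (int (Suc t) - s) * K_gauss (2 * int (Suc t) - int r - s
            - 2) t) * ?E (Suc t)
        = ?c * ?S (Suc t)" if "t \<le> r" for t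
    proof -
      let ?a = "2 * int (Suc t) - int r - s - 2" and ?d = "uconst (qint (int (Suc t)))"
      let ?u = "uconst (qint (int (r - t)))"
      have idx: "?a - int t = ?a + 1 - int (Suc t)" "int (Suc t) - s = ?a + 1 + int (r - t)"
        "int (r - t) + int (Suc t) = int (Suc r)" "2 * int (Suc t) - int (Suc r) - s = ?a + 1"
        using that by (simp_all add: of_nat_diff)
      have "?d * (?u * K_gauss ?a (Suc t) + K_int (int (Suc t) - s) * K_gauss ?a t)
        = ?u * (?d * K_gauss ?a (Suc t)) + ?d * (K_int (int (Suc t) - s) * K_gauss ?a t)"
        by (simp only: distrib_left) (simp only: uconst_left_commute)
      also have "\<dots> = (?u * K_int (?a + 1 - int (Suc t)) + ?d * K_int (?a + 1 + int (r
          - t))) * K_gauss ?a t"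
        by (simp only: K_gauss_pred K_gauss_K_int_commute idx(1,2) distrib_right mult.assoc)
      also have "\<dots> = ?c * (K_int (?a + 1) * K_gauss ?a t)"
        by (simp only: K_int_three_term idx(3) mult.assoc)
      also have "\<dots> = ?d * (?c * K_gauss (?a + 1) (Suc t))"
        by (simp only: K_gauss_pred_shift[symmetric] uconst_left_commute)
      finally have eq: "?u * K_gauss ?a (Suc t) + K_int (int (Suc t) - s) * K_gauss ?a t
         = ?c * K_gauss (?a + 1) (Suc t)"
        by (rule uconst_cancel[rotated]) (simp add: qint_nonzero)
      have "?u * (?F (Suc t) * ?K (Suc t) * ?E (Suc t)) +
          ?F (Suc t) * (K_int (int (Suc t) - s) * K_gauss ?a t) * ?E (Suc t)
        = ?F (Suc t) * (?u * K_gauss ?a (Suc t) + K_int (int (Suc t)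
            - s) * K_gauss ?a t) * ?E (Suc t)"
        by (simp only: distrib_left distrib_right mult.assoc f_idiv_front)
      also have "\<dots> = ?c * ?S (Suc t)"
        unfolding eq by (simp only: mult.assoc f_idiv_front idx(4))
      finally show ?thesis .
    qed
    then have "(\<Sum>t\<le>r. uconst (qint (int (r - t))) * (?F (Suc t) * ?K (Suc t) * ?E (Suc t)))
      + (\<Sum>t\<le>r. ?F (Suc t) * (K_int (int (Suc t) - s) * K_gauss (2 * int (Suc t) - int r - s
          - 2) t) * ?E (Suc t))
      = (\<Sum>t\<le>r. ?c * ?S (Suc t))"
      unfolding sum.distrib[symmetric] by (intro sum.cong refl) (simp only: atMost_iff)
    then show ?thesis
      by (simp add: add.assoc)
  qed
  also have "\<dots> = ?c * (\<Sum>t\<le>Suc r. ?S t)"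
    by (subst sum.atMost_Suc_shift) (simp only: distrib_left sum_distrib_left)
  finally show ?case
    by (rule uconst_cancel[rotated]) (simp add: qint_nonzero)
qed

lemma uK_f_div: "uK * f_div s = uconst (qvar powi (- 2 * int s)) * (f_div s * uK)"
proof (induction s)
  case (Suc s)
  let ?c = "uconst (qint (int (Suc s)))"
  have q: "qvar powi (- 2 * int s) * qvar powi (- 2) = qvar powi (- 2 * int (Suc s))"
  proof -
    have "- 2 * int (Suc s) = - 2 * int s + (- 2)" by simp
    then show ?thesis
      using power_int_add[of qvar "- 2 * int s" "- 2"] qvar_nonzero by (simp only:) simp
  qed
  have "?c * (uK * f_div (Suc s)) = uK * f_div s * uF"
    by (simp only: uconst_front(2)[symmetric] f_div_Suc(2)[symmetric] mult.assoc)
  also have "\<dots> = uconst (qvar powi (- 2 * int s)) * (uconst (qvar powi (- 2)) * (f_div s * uF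
      * uK))"
    by (simp only: Suc mult.assoc uK_uF uconst_front)
  also have "\<dots> = uconst (qvar powi (- 2 * int (Suc s))) * (f_div s * uF * uK)"
    by (simp only: mult.assoc[symmetric] uconst_mult[symmetric] q)
  also have "\<dots> = ?c * (uconst (qvar powi (- 2 * int (Suc s))) * (f_div (Suc s) * uK))"
    by (simp only: f_div_Suc(2) mult.assoc uconst_left_commute)
  finally show ?case
    by (rule uconst_cancel[rotated]) (simp add: qint_nonzero)
qed simp

lemma K_gauss_f_div: "K_gauss c t * f_div s = f_div s * K_gauss (c - 2 * int s) t"
  using K_gauss_shift[OF uK_f_div] by simp

lemma K_gauss_pascal:
  "K_gauss (c + 1) (Suc t) =
     uconst (qvar powi (int (Suc t))) * K_gauss c (Suc t)
     + uconst (qvar powi (int t - c)) * (uKi * K_gauss c t)"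
proof -
  let ?c = "uconst (qint (int (Suc t)))" and ?n = "int (Suc t)"
  let ?q = "\<lambda>n. qvar powi n" and ?d = "inverse qdelta"
  have q: "?q (c + 1) = ?q ?n * ?q (c - int t)"
    "?d * ?q (- (c + 1)) = ?d * (?q ?n * ?q (- (c - int t))) - qint ?n * ?q (int t - c)"
  proof -
    have "c + 1 = ?n + (c - int t)" by simp
    then show "?q (c + 1) = ?q ?n * ?q (c - int t)"
      using power_int_add[of qvar ?n "c - int t"] qvar_nonzero by (simp only:) simp
    have "- (c + 1) = - ?n + (int t - c)" by simp
    then have "?q (- (c + 1)) = ?q (- ?n) * ?q (int t - c)"
      using power_int_add[of qvar "- ?n" "int t - c"] qvar_nonzero by (simp only:) simp
    then show "?d * ?q (- (c + 1)) = ?d * (?q ?n * ?q (- (c - int t))) - qint ?n * ?q (int t - c)"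
      by (simp only: qint_def divide_inverse minus_diff_eq) (simp only: algebra_simps)
  qed
  have "K_int (c + 1) = uconst (?d * ?q (c + 1)) * uK - uconst (?d * ?q (- (c + 1))) * uKi"
    by (simp only: K_int_def right_diff_distrib uconst_mult mult.assoc)
  also have "\<dots> = uconst (?q ?n) * K_int (c - int t) + ?c * (uconst (?q (int t - c)) * uKi)"
    unfolding q
    by (simp only: K_int_def right_diff_distrib left_diff_distrib uconst_mult uconst_diff
        mult.assoc)
      (simp add: uconst_left_commute)
  finally have *: "K_int (c + 1) = uconst (?q ?n) * K_int (c - int t) + ?c * (uconst (?q (int t
      - c)) * uKi)" .
  have "?c * K_gauss (c + 1) (Suc t) = K_int (c + 1) * K_gauss c t"
    by (rule K_gauss_pred_shift)
  also have "\<dots> = uconst (?q ?n) * (K_gauss c t * K_int (c - int t)) + ?c * (uconst (?q (int t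
      - c)) * (uKi * K_gauss c t))"
    by (simp only: * distrib_right mult.assoc K_gauss_K_int_commute)
  also have "\<dots> = ?c * (uconst (?q ?n) * K_gauss c (Suc t) + uconst (?q (int t
      - c)) * (uKi * K_gauss c t))"
    by (simp only: K_gauss_pred[symmetric] distrib_left) (simp only: uconst_left_commute)
  finally show ?thesis
    by (rule uconst_cancel[rotated]) (simp add: qint_nonzero)
qed

lemma K_gauss_split:
  "uconst (qbinom (int (m + n)) (int m)) * K_gauss c (m + n) = K_gauss c m * K_gauss (c - int m) n"
proof (induction n)
  case 0
  show ?case using qbinom_sym[of m 0] by simp
next
  case (Suc n)
  let ?b = "\<lambda>n. uconst (qbinom (int (m + n)) (int m))"
  have b: "uconst (qint (int (Suc n))) * ?b (Suc n) = ?b n * uconst (qint (int (Suc (m + n))))"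
  proof -
    have "qint (int (Suc n)) * qbinom (int (m + Suc n)) (int m)
        = qbinom (int (m + n)) (int m) * qint (int (Suc (m + n)))"
      unfolding qbinom_fact using qfact_nonzero qint_nonzero[of "int (Suc n)"]
      by (simp add: qfact_Suc field_simps del: of_nat_Suc)
    then show ?thesis by (simp only: uconst_mult[symmetric])
  qed
  have idx: "c - int m - int n = c - int (m + n)" by simp
  have "uconst (qint (int (Suc n))) * (?b (Suc n) * K_gauss c (m + Suc n)) =
      ?b n * (uconst (qint (int (Suc (m + n)))) * K_gauss c (Suc (m + n)))"
    by (simp only: mult.assoc[symmetric] b) (simp only: add_Suc_right)
  also have "\<dots> = K_gauss c m * (K_gauss (c - int m) n * K_int (c - int m - int n))"
    by (simp only: K_gauss_pred mult.assoc[symmetric] Suc idx)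
  also have "\<dots> = uconst (qint (int (Suc n))) * (K_gauss c m * K_gauss (c - int m) (Suc n))"
    by (simp only: K_gauss_pred[symmetric] K_int_front)
  finally show ?case
    by (rule uconst_cancel[rotated]) (simp add: qint_nonzero)
qed

lemma K_binom_eq_K_gauss: "K_binom t = K_gauss 0 t"
proof (induction t)
  case 0
  show ?case by (simp add: K_binom_def)
next
  case (Suc t)
  have q: "inverse (qvar powi int (Suc t) - qvar powi (- int (Suc t))) =
      inverse (qint (int (Suc t))) * inverse qdelta"
    using qdelta_nonzero by (simp add: qint_def field_simps del: of_nat_Suc)
  have "K_binom (Suc t) = K_binom t *
     (uconst (inverse (qint (int (Suc t))) * inverse qdelta) *
       (uconst (qvar powi (- int t)) * uK - uconst (qvar powi int t) * uKi))"
  proof -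
    have "[1..<Suc t + 1] = [1..<t + 1] @ [Suc t]" "1 - int (Suc t) = - int t" "int (Suc t) - 1
        = int t"
      by simp_all
    then show ?thesis
      by (simp only: K_binom_def uq_scale_uconst map_append prod_list.append list.map
          prod_list.Cons prod_list.Nil mult_1_right q)
  qed
  also have "\<dots> = K_gauss 0 (Suc t)"
    by (simp only: Suc K_gauss.simps K_int_def uconst_mult mult.assoc K_int_front) simp
  finally show ?case .
qed

lemma U_int_scale: "s \<in> laurent_ring \<Longrightarrow> x \<in> U_int \<Longrightarrow> uconst s * x \<in> U_int"
  using U_int.scale by (simp add: uq_scale_uconst)

lemma U_int_uconst: "s \<in> laurent_ring \<Longrightarrow> uconst s \<in> U_int"
  using U_int_scale[OF _ U_int.one] by simp

lemma U_int_0: "0 \<in> U_int"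
  using U_int_uconst[of 0] by simp

lemma U_int_uminus: "x \<in> U_int \<Longrightarrow> - x \<in> U_int"
  using U_int_scale[of "- 1" x] laurent_ring_uminus[OF laurent_ring_1] by (simp add: uconst_uminus)

lemma U_int_diff: "x \<in> U_int \<Longrightarrow> y \<in> U_int \<Longrightarrow> x - y \<in> U_int"
  using U_int.add[OF _ U_int_uminus, of x y] by simp

lemma U_int_sum: "(\<And>i. i \<in> I \<Longrightarrow> g i \<in> U_int) \<Longrightarrow> sum g I \<in> U_int"
  by (induction I rule: infinite_finite_induct) (auto intro: U_int_0 U_int.add)

lemma e_div_U_int: "e_div r \<in> U_int" and f_div_U_int: "f_div r \<in> U_int"
  by (cases "r = 0"; simp add: U_int.one U_int.e_div U_int.f_div)+

lemma f_idiv_U_int: "f_idiv n \<in> U_int"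
  by (simp add: f_idiv_def U_int_0 f_div_U_int)

text \<open>
  In Kac's formula for \<open>e^(t) f^(t)\<close> the term \<open>[K; 0; t]\<close> stands alone and every other term
  contains some \<open>[K; c; i]\<close> with \<open>i < t\<close>. Pascal's rule then carries the result from \<open>c = 0\<close> to all
  \<open>c\<close>.
\<close>

lemma K_gauss_U_int: "K_gauss c t \<in> U_int"
proof (induction t arbitrary: c rule: less_induct)
  case (less t)
  have base: "K_gauss 0 t \<in> U_int"
  proof (cases t)
    case 0
    then show ?thesis by (simp add: U_int.one)
  next
    case (Suc k)
    let ?g = "\<lambda>i. f_idiv (int t - int i) * K_gauss (2 * int i - int t - int t) i * e_div (t - i)"
    have "e_div t * f_div t = (\<Sum>i\<le>t. ?g i)"
      using e_div_f_idiv[of t "int t"] by simp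
    also have "\<dots> = (\<Sum>i\<le>k. ?g i) + K_gauss 0 t"
      unfolding Suc by (subst sum.atMost_Suc) (simp add: f_idiv_def del: K_gauss.simps)
    finally have "K_gauss 0 t = e_div t * f_div t - (\<Sum>i\<le>k. ?g i)"
      by simp
    moreover have "(\<Sum>i\<le>k. ?g i) \<in> U_int"
      using less Suc by (intro U_int_sum U_int.mult f_idiv_U_int e_div_U_int) auto
    then have "e_div t * f_div t - (\<Sum>i\<le>k. ?g i) \<in> U_int"
      by (rule U_int_diff[OF U_int.mult[OF e_div_U_int f_div_U_int]])
    ultimately show ?thesis
      by (simp only:)
  qed
  show ?case
  proof (cases t)
    case 0
    then show ?thesis by (simp add: U_int.one)
  next
    case (Suc k)
    show ?thesis
    proof (induction c rule: int_induct[where k = 0])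
      case base
      show ?case by (rule \<open>K_gauss 0 t \<in> U_int\<close>)
    next
      case (step1 c)
      then show ?case
        using less Suc unfolding Suc K_gauss_pascal
        by (intro U_int.add U_int_scale U_int.mult U_int.Kinv qvar_powi_in_ring) auto
    next
      case (step2 c)
      let ?q = "qvar powi int (Suc k)"
      have "?q \<noteq> 0" using qvar_nonzero by simp
      have "uconst (inverse ?q) * (uconst ?q * K_gauss (c - 1) (Suc k)) =
         uconst (inverse ?q) * (K_gauss c (Suc k) - uconst (qvar powi (int k - (c
             - 1))) * (uKi * K_gauss (c - 1) k))"
        using K_gauss_pascal[of "c - 1" k] by (simp del: K_gauss.simps of_nat_Suc)
      moreover have "uconst (inverse ?q) * (uconst ?q * x) = x" for x
        using \<open>?q \<noteq> 0\<close> by (simp only: mult.assoc[symmetric] uconst_mult[symmetric]) simp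
      moreover have "inverse ?q = qvar powi (- int (Suc k))"
        by (simp only: power_int_minus)
      ultimately have "K_gauss (c - 1) t = uconst (qvar powi (- int (Suc k))) *
        (K_gauss c t - uconst (qvar powi (int k - (c - 1))) * (uKi * K_gauss (c - 1) k))"
        unfolding Suc by metis
      moreover have "K_gauss (c - 1) k \<in> U_int"
        using less Suc by auto
      ultimately show ?case
        using step2(2) by (simp only:)
          (intro U_int_diff U_int_scale U_int.mult U_int.Kinv qvar_powi_in_ring)
    qed
  qed
qed

section \<open>The specialised algebra and its modules\<close>

lemma pretensor_minus:
  assumes "s \<in> carrier pretensor_ring" "t \<in> carrier pretensor_ring"
  shows "s \<ominus>\<^bsub>pretensor_ring\<^esub> t = s - t"
proof -
  interpret ring pretensor_ring by (rule ring_pretensor_ring)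
  have "\<ominus>\<^bsub>pretensor_ring\<^esub> t = - t"
    by (rule minus_equality) (use assms in \<open>auto simp: pretensor_ring_simps
        pretensor_carrier_uminus\<close>)
  then show ?thesis
    by (simp add: a_minus_def pretensor_ring_simps)
qed

definition tensor_class :: "complex \<Rightarrow> pretensor \<Rightarrow> ures" where
  "tensor_class \<epsilon> t = tensor_null \<epsilon> +>\<^bsub>pretensor_ring\<^esub> t"

lemma tensor_class_hom: "tensor_class \<epsilon> \<in> ring_hom pretensor_ring (U_res \<epsilon>)"
  using ideal.rcos_ring_hom[OF ideal_tensor_null[of \<epsilon>]]
  by (simp add: U_res_def tensor_class_def[abs_def])

lemma tensor_class_eqI:
  assumes "s \<in> carrier pretensor_ring" "t \<in> carrier pretensor_ring" "s - t \<in> tensor_null \<epsilon>"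
  shows "tensor_class \<epsilon> s = tensor_class \<epsilon> t"
  using assms
  unfolding tensor_class_def
  by (intro ring.quotient_eq_iff_same_a_r_cos[OF ring_pretensor_ring ideal_tensor_null, THEN iffD1])
    (simp_all add: pretensor_minus)

lemma tensor_eq_class: "tensor \<epsilon> x c = tensor_class \<epsilon> (pt x c)"
  by (simp add: tensor_def tensor_class_def)

lemma tensor_class_add:
  "s \<in> carrier pretensor_ring \<Longrightarrow> t \<in> carrier pretensor_ring \<Longrightarrow>
     tensor_class \<epsilon> (s + t) = tensor_class \<epsilon> s \<oplus>\<^bsub>U_res \<epsilon>\<^esub> tensor_class \<epsilon> t"
  using ring_hom_add[OF tensor_class_hom[of \<epsilon>]] by (simp add: pretensor_ring_simps)

lemma tensor_class_surj:
  assumes "a \<in> carrier (U_res \<epsilon>)"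
  obtains t where "t \<in> carrier pretensor_ring" "a = tensor_class \<epsilon> t"
  using assms
  by (auto simp: U_res_def FactRing_def A_RCOSETS_def' tensor_class_def)

lemma tensor_closed [simp]: "x \<in> U_int \<Longrightarrow> tensor \<epsilon> x c \<in> carrier (U_res \<epsilon>)"
  by (simp add: tensor_eq_class ring_hom_closed[OF tensor_class_hom] pt_carrier)

lemma tensor_mult:
  "x \<in> U_int \<Longrightarrow> y \<in> U_int \<Longrightarrow>
     tensor \<epsilon> x c \<otimes>\<^bsub>U_res \<epsilon>\<^esub> tensor \<epsilon> y d = tensor \<epsilon> (x * y) (c * d)"
  using ring_hom_mult[OF tensor_class_hom[of \<epsilon>] pt_carrier[of x c] pt_carrier[of y d]]
  by (simp add: tensor_eq_class pretensor_ring_simps pt_mult)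

lemma tensor_one: "tensor \<epsilon> 1 1 = \<one>\<^bsub>U_res \<epsilon>\<^esub>"
  using ring_hom_one[OF tensor_class_hom[of \<epsilon>]]
  by (simp add: tensor_eq_class pt_one pretensor_ring_simps)

lemma tensor_rel:
  assumes "r \<in> tensor_rels \<epsilon>" "r = s - t" "s \<in> carrier pretensor_ring" "t \<in> carrier pretensor_ring"
  shows "tensor_class \<epsilon> s = tensor_class \<epsilon> t"
  using assms tensor_null.add[OF tensor_null.zero, of r \<epsilon>] by (intro tensor_class_eqI) auto

lemma tensor_add_left:
  assumes "x \<in> U_int" "y \<in> U_int"
  shows "tensor \<epsilon> (x + y) c = tensor \<epsilon> x c \<oplus>\<^bsub>U_res \<epsilon>\<^esub> tensor \<epsilon> y c"
proof -
  have "tensor_class \<epsilon> (pt (x + y) c) = tensor_class \<epsilon> (pt x c + pt y c)"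
    using assms
    by (intro tensor_rel[OF tensor_rels.add_left[of x y c \<epsilon>]])
      (auto intro!: pt_carrier pretensor_carrier_add U_int.add)
  then show ?thesis
    using assms by (simp add: tensor_eq_class tensor_class_add pt_carrier)
qed

lemma tensor_add_right:
  assumes "x \<in> U_int"
  shows "tensor \<epsilon> x (c + d) = tensor \<epsilon> x c \<oplus>\<^bsub>U_res \<epsilon>\<^esub> tensor \<epsilon> x d"
proof -
  have "tensor_class \<epsilon> (pt x (c + d)) = tensor_class \<epsilon> (pt x c + pt x d)"
    using assms
    by (intro tensor_rel[OF tensor_rels.add_right[of x c d \<epsilon>]])
      (auto intro!: pt_carrier pretensor_carrier_add)
  then show ?thesis
    using assms by (simp add: tensor_eq_class tensor_class_add pt_carrier)
qed

lemma tensor_uconst: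
  assumes "x \<in> U_int" "s \<in> laurent_ring"
  shows "tensor \<epsilon> (uconst s * x) c = tensor \<epsilon> x (laurent_eval \<epsilon> s * c)"
  unfolding tensor_eq_class
  using assms tensor_rels.balanced[of x s c \<epsilon>]
  by (intro tensor_rel[OF _ refl]) (auto intro!: pt_carrier U_int_scale simp: uq_scale_uconst)

lemma tensor_zero_right:
  assumes "x \<in> U_int"
  shows "tensor \<epsilon> x 0 = \<zero>\<^bsub>U_res \<epsilon>\<^esub>"
proof -
  interpret ring "U_res \<epsilon>" by (rule ring_U_res)
  show ?thesis
    using tensor_add_right[OF assms, of \<epsilon> 0 0] assms add.l_cancel_one' by simp
qed

text \<open>
  The integer multiplicity of a pair is absorbed into its complex entry, so sums of pure tensors
  already exhaust the tensor product.
\<close>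

lemma tensor_class_single:
  assumes "x \<in> U_int"
  shows "tensor_class \<epsilon> (Poly_Mapping.single (TPair x c) k) = tensor \<epsilon> x (of_int k * c)"
proof -
  interpret ring "U_res \<epsilon>" by (rule ring_U_res)
  have in_carrier: "Poly_Mapping.single (TPair x c) k \<in> carrier pretensor_ring" for k
    using assms by (auto simp: pretensor_ring_def)
  have step: "tensor_class \<epsilon> (Poly_Mapping.single (TPair x c) (k + 1)) =
      tensor_class \<epsilon> (Poly_Mapping.single (TPair x c) k) \<oplus>\<^bsub>U_res \<epsilon>\<^esub> tensor \<epsilon> x c" for k
    using tensor_class_add[OF in_carrier[of k] pt_carrier[OF assms, of c]]
    by (simp add: single_add pt_def tensor_eq_class)
  have step': "tensor \<epsilon> x (of_int (k + 1) * c)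
      = tensor \<epsilon> x (of_int k * c) \<oplus>\<^bsub>U_res \<epsilon>\<^esub> tensor \<epsilon> x c" for k
    using tensor_add_right[OF assms, of \<epsilon> "of_int k * c" c] by (simp add: distrib_right)
  show ?thesis
  proof (induction k rule: int_induct[where k = 0])
    case base
    have "tensor_class \<epsilon> 0 = \<zero>\<^bsub>U_res \<epsilon>\<^esub>"
      using tensor_class_add[of 0 0 \<epsilon>] ring_hom_closed[OF tensor_class_hom, of 0 \<epsilon>]
          add.l_cancel_one'
      by (simp add: pretensor_carrier_zero)
    then show ?case
      using assms by (simp add: tensor_zero_right)
  next
    case (step1 k)
    then show ?case by (simp only: step step')
  next
    case (step2 k)
    have "tensor_class \<epsilon> (Poly_Mapping.single (TPair x c) (k - 1)) \<oplus>\<^bsub>U_res \<epsilon>\<^esub> tensor \<epsilon> x c =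
       tensor \<epsilon> x (of_int (k - 1) * c) \<oplus>\<^bsub>U_res \<epsilon>\<^esub> tensor \<epsilon> x c"
      using step2 step[of "k - 1"] step'[of "k - 1"] by simp
    then show ?case
      using assms ring_hom_closed[OF tensor_class_hom in_carrier]
          by (subst (asm) add.right_cancel) auto
  qed
qed

lemma pretensor_induct [consumes 1, case_names zero add]:
  assumes "t \<in> carrier pretensor_ring" and "P 0"
    and add: "\<And>x c k s. x \<in> U_int \<Longrightarrow> s \<in> carrier pretensor_ring \<Longrightarrow> P s \<Longrightarrow>
        P (Poly_Mapping.single (TPair x c) k + s)"
  shows "P t"
proof -
  have "(\<Sum>w\<in>S. Poly_Mapping.single w (Poly_Mapping.lookup t w)) \<in> carrier pretensor_ring
      \<and> P (\<Sum>w\<in>S. Poly_Mapping.single w (Poly_Mapping.lookup t w))"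
    if "finite S" "S \<subseteq> Poly_Mapping.keys t" for S
    using that
  proof (induction S rule: finite_induct)
    case empty
    show ?case using assms(2) by (simp add: pretensor_carrier_zero)
  next
    case (insert w S)
    then obtain x c where xc: "x \<in> U_int" "w = TPair x c"
      using assms(1) by (auto simp: pretensor_ring_def)
    have "Poly_Mapping.single w (Poly_Mapping.lookup t w) \<in> carrier pretensor_ring"
      using xc by (auto simp: pretensor_ring_def)
    then show ?case
      using insert xc add by (simp add: pretensor_carrier_add)
  qed
  from this[of "Poly_Mapping.keys t"] show ?thesis
    by (simp add: poly_mapping_sum_single)
qed

lemma single_carrier: "x \<in> U_int \<Longrightarrow> Poly_Mapping.single (TPair x c) k \<in> carrier pretensor_ring"
  by (auto simp: pretensor_ring_def)

definition U_gens :: "uq set" where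
  "U_gens = {uq_gen GK, uq_gen GKinv} \<union> {e_div r | r. 1 \<le> r} \<union> {f_div r | r. 1 \<le> r}"

lemma U_gens_U_int: "x \<in> U_gens \<Longrightarrow> x \<in> U_int"
  by (auto simp: U_gens_def intro: U_int.intros)

text \<open>
  With all complex scalars at hand, closure under differences and under coefficients from \<open>C[q,
  1/q]\<close> comes for free from closure under products.
\<close>

lemma U_res_induct [consumes 1, case_names gen scal add mult]:
  assumes a: "a \<in> carrier (U_res \<epsilon>)"
    and gen: "\<And>x. x \<in> U_gens \<Longrightarrow> P (spec \<epsilon> x)"
    and scal: "\<And>c. P (scal \<epsilon> c)"
    and add: "\<And>a b. a \<in> carrier (U_res \<epsilon>) \<Longrightarrow> b \<in> carrier (U_res \<epsilon>) \<Longrightarrow> P a \<Longrightarrow> P b \<Longrightarrow>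
        P (a \<oplus>\<^bsub>U_res \<epsilon>\<^esub> b)"
    and mult: "\<And>a b. a \<in> carrier (U_res \<epsilon>) \<Longrightarrow> b \<in> carrier (U_res \<epsilon>) \<Longrightarrow> P a \<Longrightarrow> P b \<Longrightarrow>
        P (a \<otimes>\<^bsub>U_res \<epsilon>\<^esub> b)"
  shows "P a"
proof -
  interpret ring "U_res \<epsilon>" by (rule ring_U_res)
  have spec: "P (spec \<epsilon> x)" if "x \<in> U_int" for x
    using that
  proof induction
    case one
    show ?case by (rule scal)
  next
    case (add x y)
    then show ?case using assms(4) by (simp add: tensor_add_left)
  next
    case (mult x y)
    then show ?case using assms(5)[of "spec \<epsilon> x" "spec \<epsilon> y"] by (simp add: tensor_mult)
  next
    case (scale s x)
    have "spec \<epsilon> (uq_scale s x) = scal \<epsilon> (laurent_eval \<epsilon> s) \<otimes>\<^bsub>U_res \<epsilon>\<^esub> spec \<epsilon> x"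
      using scale by (simp add: uq_scale_uconst tensor_uconst tensor_mult U_int.one)
    then show ?case
      using scale assms(5) scal U_int.one by simp
  qed (auto intro!: gen simp: U_gens_def)
  have tensor: "P (tensor \<epsilon> x c)" if "x \<in> U_int" for x c
    using that mult[of "scal \<epsilon> c" "spec \<epsilon> x"] spec scal by (simp add: tensor_mult U_int.one)
  obtain t where t: "t \<in> carrier pretensor_ring" "a = tensor_class \<epsilon> t"
    using a by (rule tensor_class_surj)
  have "P (tensor_class \<epsilon> t)"
    using t(1)
  proof (induction t rule: pretensor_induct)
    case zero
    have "tensor_class \<epsilon> 0 = tensor \<epsilon> 1 0"
      using tensor_class_single[OF U_int.one, of \<epsilon> 1 0] by simp
    then show ?case
      using scal by simp
  next
    case (add x c k s)
    have "P (tensor_class \<epsilon> (Poly_Mapping.single (TPair x c) k))"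
      unfolding tensor_class_single[OF add(1)] by (rule tensor[OF add(1)])
    then show ?case
      using add assms(4) single_carrier ring_hom_closed[OF tensor_class_hom]
      by (simp add: tensor_class_add)
  qed
  then show ?thesis by (simp add: t(2))
qed

section \<open>Left modules and their quotients\<close>

lemma left_moduleI:
  assumes "ring R" "abelian_group M"
    and "\<And>a x. a \<in> carrier R \<Longrightarrow> x \<in> carrier M \<Longrightarrow> a \<odot>\<^bsub>M\<^esub> x \<in> carrier M"
    and "\<And>a b x. a \<in> carrier R \<Longrightarrow> b \<in> carrier R \<Longrightarrow> x \<in> carrier M \<Longrightarrow>
        (a \<oplus>\<^bsub>R\<^esub> b) \<odot>\<^bsub>M\<^esub> x = a \<odot>\<^bsub>M\<^esub> x \<oplus>\<^bsub>M\<^esub> b \<odot>\<^bsub>M\<^esub> x"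
    and "\<And>a x y. a \<in> carrier R \<Longrightarrow> x \<in> carrier M \<Longrightarrow> y \<in> carrier M \<Longrightarrow>
        a \<odot>\<^bsub>M\<^esub> (x \<oplus>\<^bsub>M\<^esub> y) = a \<odot>\<^bsub>M\<^esub> x \<oplus>\<^bsub>M\<^esub> a \<odot>\<^bsub>M\<^esub> y"
    and "\<And>a b x. a \<in> carrier R \<Longrightarrow> b \<in> carrier R \<Longrightarrow> x \<in> carrier M \<Longrightarrow>
        (a \<otimes>\<^bsub>R\<^esub> b) \<odot>\<^bsub>M\<^esub> x = a \<odot>\<^bsub>M\<^esub> (b \<odot>\<^bsub>M\<^esub> x)"
    and "\<And>x. x \<in> carrier M \<Longrightarrow> \<one>\<^bsub>R\<^esub> \<odot>\<^bsub>M\<^esub> x = x"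
  shows "left_module R M"
  using assms by (intro left_module.intro left_module_axioms.intro)

context left_module
begin

lemma smult_l_null: "x \<in> carrier M \<Longrightarrow> \<zero> \<odot>\<^bsub>M\<^esub> x = \<zero>\<^bsub>M\<^esub>"
  using smult_l_distr[of \<zero> \<zero> x] smult_closed[of \<zero> x] M.add.l_cancel_one' by simp

lemma smult_r_null: "a \<in> carrier R \<Longrightarrow> a \<odot>\<^bsub>M\<^esub> \<zero>\<^bsub>M\<^esub> = \<zero>\<^bsub>M\<^esub>"
  using smult_r_distr[of a "\<zero>\<^bsub>M\<^esub>" "\<zero>\<^bsub>M\<^esub>"] smult_closed[of a "\<zero>\<^bsub>M\<^esub>"] M.add.l_cancel_one' by simp

lemma smult_minus_one: "x \<in> carrier M \<Longrightarrow> (\<ominus> \<one>) \<odot>\<^bsub>M\<^esub> x = \<ominus>\<^bsub>M\<^esub> x"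
proof -
  assume x: "x \<in> carrier M"
  have "(\<ominus> \<one>) \<odot>\<^bsub>M\<^esub> x \<oplus>\<^bsub>M\<^esub> x = (\<ominus> \<one> \<oplus> \<one>) \<odot>\<^bsub>M\<^esub> x"
    using x by (simp add: smult_l_distr smult_one)
  also have "\<dots> = \<zero>\<^bsub>M\<^esub>"
    using x by (simp add: R.l_neg smult_l_null)
  finally show ?thesis
    using x by (intro M.minus_equality[symmetric]) (auto intro: smult_closed)
qed

lemma submodule_closedI:
  assumes "N \<subseteq> carrier M" "\<zero>\<^bsub>M\<^esub> \<in> N" "\<And>x y. x \<in> N \<Longrightarrow> y \<in> N \<Longrightarrow> x \<oplus>\<^bsub>M\<^esub> y \<in> N"
    "\<And>a x. a \<in> carrier R \<Longrightarrow> x \<in> N \<Longrightarrow> a \<odot>\<^bsub>M\<^esub> x \<in> N"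
  shows "submodule N R M"
proof (intro submodule.intro submodule_axioms.intro)
  have "\<ominus>\<^bsub>M\<^esub> x \<in> N" if "x \<in> N" for x
    using assms(4)[of "\<ominus> \<one>" x] assms(1) that smult_minus_one[of x] by auto
  then show "subgroup N (add_monoid M)"
    using assms by (intro M.add.subgroupI) (auto simp: a_inv_def)
qed (use assms in auto)

lemma submodule_closed:
  assumes "submodule N R M"
  shows "N \<subseteq> carrier M" "\<zero>\<^bsub>M\<^esub> \<in> N" "\<And>x y. x \<in> N \<Longrightarrow> y \<in> N \<Longrightarrow> x \<oplus>\<^bsub>M\<^esub> y \<in> N"
    "\<And>a x. a \<in> carrier R \<Longrightarrow> x \<in> N \<Longrightarrow> a \<odot>\<^bsub>M\<^esub> x \<in> N"
    "\<And>x. x \<in> N \<Longrightarrow> \<ominus>\<^bsub>M\<^esub> x \<in> N"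
proof -
  interpret N: subgroup N "add_monoid M"
    using assms by (rule submodule.axioms)
  show "N \<subseteq> carrier M" "\<zero>\<^bsub>M\<^esub> \<in> N" "\<And>x y. x \<in> N \<Longrightarrow> y \<in> N \<Longrightarrow> x \<oplus>\<^bsub>M\<^esub> y \<in> N"
    using N.subset N.one_closed N.m_closed by auto
  show "\<And>x. x \<in> N \<Longrightarrow> \<ominus>\<^bsub>M\<^esub> x \<in> N"
    using N.m_inv_closed by (simp add: a_inv_def)
  show "\<And>a x. a \<in> carrier R \<Longrightarrow> x \<in> N \<Longrightarrow> a \<odot>\<^bsub>M\<^esub> x \<in> N"
    using submodule.smult_closed[OF assms] by simp
qed

lemma submodule_left_module:
  assumes "submodule N R M"
  shows "left_module R (M\<lparr>carrier := N\<rparr>)"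
proof (rule left_moduleI)
  note N = submodule_closed[OF assms]
  show "abelian_group (M\<lparr>carrier := N\<rparr>)"
  proof (rule abelian_groupI)
    fix x assume "x \<in> carrier (M\<lparr>carrier := N\<rparr>)"
    then show "\<exists>y\<in>carrier (M\<lparr>carrier := N\<rparr>). y \<oplus>\<^bsub>M\<lparr>carrier := N\<rparr>\<^esub> x = \<zero>\<^bsub>M\<lparr>carrier := N\<rparr>\<^esub>"
      using N by (auto intro!: bexI[of _ "\<ominus>\<^bsub>M\<^esub> x"] M.l_neg)
  qed (use N in \<open>auto simp: subset_iff intro: M.a_assoc M.a_comm\<close>)
qed (use submodule_closed[OF assms] in
      \<open>auto simp: subset_iff smult_l_distr smult_r_distr smult_assoc smult_one R.ring_axioms\<close>)

end

text \<open>The canonical projection \<open>x \<mapsto> N +> x\<close> is all that is needed of a quotient module.\<close>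

lemma quot_module_facts:
  fixes R (structure) and M :: "('r, 'm) module"
  assumes "submodule N R M" and "left_module R M"
  defines "Q \<equiv> quot_module M N" and "\<pi> \<equiv> (\<lambda>x. N +>\<^bsub>M\<^esub> x)"
  shows "carrier Q = \<pi> ` carrier M"
    and "\<And>x y. x \<in> carrier M \<Longrightarrow> y \<in> carrier M \<Longrightarrow> \<pi> (x \<oplus>\<^bsub>M\<^esub> y) = \<pi> x \<oplus>\<^bsub>Q\<^esub> \<pi> y"
    and "\<And>a x. a \<in> carrier R \<Longrightarrow> x \<in> carrier M \<Longrightarrow> \<pi> (a \<odot>\<^bsub>M\<^esub> x) = a \<odot>\<^bsub>Q\<^esub> \<pi> x"
    and "\<And>x. x \<in> carrier M \<Longrightarrow> \<pi> x = \<zero>\<^bsub>Q\<^esub> \<longleftrightarrow> x \<in> N"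
    and "left_module R Q"
proof -
  interpret left_module R M by fact
  note N = submodule_closed[OF assms(1)]
  interpret N: abelian_subgroup N M
    using submodule.axioms(1)[OF assms(1)] M.a_comm_group
    by (intro abelian_subgroupI3) (auto intro: additive_subgroup.intro M.abelian_group_axioms)
  show carrier: "carrier Q = \<pi> ` carrier M"
    by (auto simp: Q_def \<pi>_def quot_module_def A_RCOSETS_def')
  show add: "\<pi> (x \<oplus>\<^bsub>M\<^esub> y) = \<pi> x \<oplus>\<^bsub>Q\<^esub> \<pi> y" if "x \<in> carrier M" "y \<in> carrier M" for x y
    using that N.a_rcos_sum by (simp add: Q_def \<pi>_def quot_module_def)
  have self: "x \<in> \<pi> x" if "x \<in> carrier M" for x
    unfolding \<pi>_def by (rule N.a_rcos_self[OF that])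
  have absorb: "\<pi> (n \<oplus>\<^bsub>M\<^esub> x) = \<pi> x" if "n \<in> N" "x \<in> carrier M" for n x
  proof -
    have "n \<oplus>\<^bsub>M\<^esub> x \<in> \<pi> x"
      using that by (auto simp: \<pi>_def a_r_coset_def')
    then show ?thesis
      using N.a_repr_independence'[of "n \<oplus>\<^bsub>M\<^esub> x" x] that by (simp add: \<pi>_def)
  qed
  show smult: "\<pi> (a \<odot>\<^bsub>M\<^esub> x) = a \<odot>\<^bsub>Q\<^esub> \<pi> x" if "a \<in> carrier R" "x \<in> carrier M" for a x
  proof -
    have const: "\<pi> (a \<odot>\<^bsub>M\<^esub> z) = \<pi> (a \<odot>\<^bsub>M\<^esub> x)" if z: "z \<in> \<pi> x" for z
    proof -
      note that = \<open>a \<in> carrier R\<close> \<open>x \<in> carrier M\<close>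
      obtain n where n: "n \<in> N" "z = n \<oplus>\<^bsub>M\<^esub> x"
        using z by (auto simp: \<pi>_def a_r_coset_def')
      have "a \<odot>\<^bsub>M\<^esub> z = a \<odot>\<^bsub>M\<^esub> n \<oplus>\<^bsub>M\<^esub> a \<odot>\<^bsub>M\<^esub> x"
        unfolding n(2) using that n(1) N(1) by (intro smult_r_distr) auto
      then show ?thesis
        using absorb[OF N(4)[OF that(1) n(1)] smult_closed[OF that]] by (simp only:)
    qed
    have "a \<odot>\<^bsub>Q\<^esub> \<pi> x = (\<Union>z\<in>\<pi> x. \<pi> (a \<odot>\<^bsub>M\<^esub> z))"
      by (simp add: Q_def quot_module_def \<pi>_def)
    also have "\<dots> = (\<Union>z\<in>\<pi> x. \<pi> (a \<odot>\<^bsub>M\<^esub> x))"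
      by (rule SUP_cong) (simp_all only: const)
    also have "\<dots> = \<pi> (a \<odot>\<^bsub>M\<^esub> x)"
      using self[OF that(2)] by blast
    finally show ?thesis ..
  qed
  show zero: "\<pi> x = \<zero>\<^bsub>Q\<^esub> \<longleftrightarrow> x \<in> N" if "x \<in> carrier M" for x
  proof
    assume "\<pi> x = \<zero>\<^bsub>Q\<^esub>"
    with self[OF that] show "x \<in> N"
      by (simp add: Q_def quot_module_def)
  next
    assume "x \<in> N"
    then show "\<pi> x = \<zero>\<^bsub>Q\<^esub>"
      using M.a_coset_join2[OF that submodule.axioms(1)[OF assms(1)]]
      by (simp add: Q_def quot_module_def \<pi>_def)
  qed
  have pi0: "\<zero>\<^bsub>Q\<^esub> = \<pi> \<zero>\<^bsub>M\<^esub>"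
    using zero[of "\<zero>\<^bsub>M\<^esub>"] N by simp
  have add': "\<pi> x \<oplus>\<^bsub>Q\<^esub> \<pi> y = \<pi> (x \<oplus>\<^bsub>M\<^esub> y)" if "x \<in> carrier M" "y \<in> carrier M" for x y
    by (rule add[symmetric, OF that])
  have smult': "a \<odot>\<^bsub>Q\<^esub> \<pi> x = \<pi> (a \<odot>\<^bsub>M\<^esub> x)" if "a \<in> carrier R" "x \<in> carrier M" for a x
    by (rule smult[symmetric, OF that])
  show "left_module R Q"
  proof (rule left_moduleI)
    show "abelian_group Q"
    proof (rule abelian_groupI)
      fix X Y assume "X \<in> carrier Q" "Y \<in> carrier Q"
      then obtain x y where xy: "x \<in> carrier M" "X = \<pi> x" "y \<in> carrier M" "Y = \<pi> y"
        unfolding carrier by blast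
      then show "X \<oplus>\<^bsub>Q\<^esub> Y \<in> carrier Q"
        unfolding carrier by (simp only: add' M.a_closed imageI)
      show "X \<oplus>\<^bsub>Q\<^esub> Y = Y \<oplus>\<^bsub>Q\<^esub> X"
        using xy by (simp only: add' M.a_comm)
      fix Z assume "Z \<in> carrier Q"
      then obtain z where z: "z \<in> carrier M" "Z = \<pi> z"
        unfolding carrier by blast
      show "X \<oplus>\<^bsub>Q\<^esub> Y \<oplus>\<^bsub>Q\<^esub> Z = X \<oplus>\<^bsub>Q\<^esub> (Y \<oplus>\<^bsub>Q\<^esub> Z)"
        using xy z by (simp only: add' M.a_closed M.a_assoc)
    next
      show "\<zero>\<^bsub>Q\<^esub> \<in> carrier Q"
        unfolding carrier pi0 by blast
      fix X assume "X \<in> carrier Q"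
      then obtain x where x: "x \<in> carrier M" "X = \<pi> x"
        unfolding carrier by blast
      then show "\<zero>\<^bsub>Q\<^esub> \<oplus>\<^bsub>Q\<^esub> X = X"
        by (simp only: pi0 add' M.zero_closed M.l_zero)
      have "\<pi> (\<ominus>\<^bsub>M\<^esub> x) \<in> carrier Q" "\<pi> (\<ominus>\<^bsub>M\<^esub> x) \<oplus>\<^bsub>Q\<^esub> X = \<zero>\<^bsub>Q\<^esub>"
        using x unfolding carrier by (simp_all only: pi0 add' M.a_inv_closed M.l_neg imageI)
      then show "\<exists>Y\<in>carrier Q. Y \<oplus>\<^bsub>Q\<^esub> X = \<zero>\<^bsub>Q\<^esub>"
        by blast
    qed
  next
    fix b c X Y assume bc: "b \<in> carrier R" "c \<in> carrier R" and "X \<in> carrier Q" "Y \<in> carrier Q"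
    then obtain x y where xy: "x \<in> carrier M" "X = \<pi> x" "y \<in> carrier M" "Y = \<pi> y"
      unfolding carrier by blast
    then show "b \<odot>\<^bsub>Q\<^esub> (X \<oplus>\<^bsub>Q\<^esub> Y) = b \<odot>\<^bsub>Q\<^esub> X \<oplus>\<^bsub>Q\<^esub> b \<odot>\<^bsub>Q\<^esub> Y"
      using bc by (simp only: add' smult' M.a_closed smult_closed smult_r_distr)
  next
    fix b c X assume bc: "b \<in> carrier R" "c \<in> carrier R" and "X \<in> carrier Q"
    then obtain x where x: "x \<in> carrier M" "X = \<pi> x"
      unfolding carrier by blast
    show "b \<odot>\<^bsub>Q\<^esub> X \<in> carrier Q"
      unfolding carrier using x bc by (simp only: smult' smult_closed imageI)
    show "(b \<oplus> c) \<odot>\<^bsub>Q\<^esub> X = b \<odot>\<^bsub>Q\<^esub> X \<oplus>\<^bsub>Q\<^esub> c \<odot>\<^bsub>Q\<^esub> X"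
      using bc x by (simp only: add' smult' smult_closed smult_l_distr R.a_closed)
    show "(b \<otimes> c) \<odot>\<^bsub>Q\<^esub> X = b \<odot>\<^bsub>Q\<^esub> (c \<odot>\<^bsub>Q\<^esub> X)"
      using bc x by (simp only: smult' smult_closed smult_assoc R.m_closed)
  next
    fix X assume "X \<in> carrier Q"
    then obtain x where x: "x \<in> carrier M" "X = \<pi> x"
      unfolding carrier by blast
    then show "\<one> \<odot>\<^bsub>Q\<^esub> X = X"
      by (simp only: smult' R.one_closed smult_one)
  qed (rule R.ring_axioms)
qed

section \<open>Primitive vectors\<close>

abbreviation act :: "complex \<Rightarrow> (ures, 'v) module \<Rightarrow> uq \<Rightarrow> 'v \<Rightarrow> 'v" where
  "act \<epsilon> V x v \<equiv> tensor \<epsilon> x 1 \<odot>\<^bsub>V\<^esub> v"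

abbreviation cscale :: "complex \<Rightarrow> (ures, 'v) module \<Rightarrow> complex \<Rightarrow> 'v \<Rightarrow> 'v" where
  "cscale \<epsilon> V c v \<equiv> tensor \<epsilon> 1 c \<odot>\<^bsub>V\<^esub> v"

definition primitive_vector :: "nat \<Rightarrow> complex \<Rightarrow> (ures, 'v) module \<Rightarrow> int \<Rightarrow> 'v \<Rightarrow> bool" where
  "primitive_vector p \<epsilon> V l v \<longleftrightarrow>
     v \<in> weight_space p \<epsilon> V l \<and> act \<epsilon> V (uq_gen GE) v = \<zero>\<^bsub>V\<^esub> \<and> act \<epsilon> V (e_div p) v = \<zero>\<^bsub>V\<^esub>"

text \<open>
  The structure constants of the Verma module of highest weight \<open>l\<close>. They do not mention a module,
  and so can be compared across modules over different types.
\<close>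

inductive ladder :: "complex \<Rightarrow> int \<Rightarrow> uq \<Rightarrow> nat \<Rightarrow> complex \<Rightarrow> nat \<Rightarrow> bool" for \<epsilon> l where
  K: "ladder \<epsilon> l (uq_gen GK) s (\<epsilon> powi (l - 2 * int s)) s"
| Kinv: "ladder \<epsilon> l (uq_gen GKinv) s (\<epsilon> powi (- (l - 2 * int s))) s"
| e_div: "r \<le> s \<Longrightarrow> ladder \<epsilon> l (e_div r) s (qbinom_at \<epsilon> (l + int r - int s) (int r)) (s - r)"
| e_div_0: "s < r \<Longrightarrow> ladder \<epsilon> l (e_div r) s 0 0"
| f_div: "ladder \<epsilon> l (f_div r) s (qbinom_at \<epsilon> (int (r + s)) (int r)) (r + s)"

lemma ladder_exists:
  assumes "x \<in> U_gens"
  obtains c t where "ladder \<epsilon> l x s c t"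
proof -
  have "\<exists>c t. ladder \<epsilon> l (e_div r) s c t" for r
    by (meson ladder.intros not_le)
  then show ?thesis
    using assms that by (auto simp: U_gens_def intro: ladder.intros)
qed

text \<open>
  An inductive description of the span lets proofs proceed term by term, without coefficient
  functions and finite sums.
\<close>

inductive_set wspan :: "complex \<Rightarrow> (ures, 'v) module \<Rightarrow> 'v \<Rightarrow> nat set \<Rightarrow> 'v set" for \<epsilon> V v I where
  zero: "\<zero>\<^bsub>V\<^esub> \<in> wspan \<epsilon> V v I"
| add: "y \<in> wspan \<epsilon> V v I \<Longrightarrow> s \<in> I \<Longrightarrow>
    y \<oplus>\<^bsub>V\<^esub> cscale \<epsilon> V c (act \<epsilon> V (f_div s) v) \<in> wspan \<epsilon> V v I"

lemma wspan_mono: "y \<in> wspan \<epsilon> V v I \<Longrightarrow> I \<subseteq> J \<Longrightarrow> y \<in> wspan \<epsilon> V v J"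
  by (induction rule: wspan.induct) (auto intro: wspan.intros)

locale res_module = odd_root p \<epsilon> + left_module "U_res \<epsilon>" V
  for p \<epsilon> and V :: "(ures, 'v) module"
begin

abbreviation act_V (infixr "\<rhd>" 75) where "x \<rhd> v \<equiv> act \<epsilon> V x v"
abbreviation scale_V (infixr "\<cdot>" 75) where "c \<cdot> v \<equiv> cscale \<epsilon> V c v"
abbreviation plus_V (infixl "\<oplus>\<^sub>V" 65) where "v \<oplus>\<^sub>V w \<equiv> v \<oplus>\<^bsub>V\<^esub> w"
abbreviation C where "C \<equiv> carrier V"

lemma act_closed [simp]: "x \<in> U_int \<Longrightarrow> v \<in> C \<Longrightarrow> x \<rhd> v \<in> C"
  by (simp add: smult_closed)

lemma scale_closed [simp]: "v \<in> C \<Longrightarrow> c \<cdot> v \<in> C"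
  by (simp add: smult_closed U_int.one)

lemma act_mult: "x \<in> U_int \<Longrightarrow> y \<in> U_int \<Longrightarrow> v \<in> C \<Longrightarrow> (x * y) \<rhd> v = x \<rhd> y \<rhd> v"
  using smult_assoc[of "spec \<epsilon> x" "spec \<epsilon> y" v] by (simp add: tensor_mult)

lemma act_add: "x \<in> U_int \<Longrightarrow> y \<in> U_int \<Longrightarrow> v \<in> C \<Longrightarrow> (x + y) \<rhd> v = x \<rhd> v \<oplus>\<^sub>V y \<rhd> v"
  by (simp add: tensor_add_left smult_l_distr)

lemma act_add_right: "x \<in> U_int \<Longrightarrow> v \<in> C \<Longrightarrow> w \<in> C \<Longrightarrow> x \<rhd> (v \<oplus>\<^sub>V w) = x \<rhd> v \<oplus>\<^sub>V x \<rhd> w"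
  by (simp add: smult_r_distr)

lemma act_one: "v \<in> C \<Longrightarrow> 1 \<rhd> v = v"
  by (simp add: tensor_one smult_one)

lemma act_uconst:
  "s \<in> laurent_ring \<Longrightarrow> x \<in> U_int \<Longrightarrow> v \<in> C \<Longrightarrow> (uconst s * x) \<rhd> v = ev s \<cdot> x \<rhd> v"
  using smult_assoc[of "scal \<epsilon> (ev s)" "spec \<epsilon> x" v]
  by (simp add: tensor_uconst tensor_mult U_int.one)

lemma act_scale: "x \<in> U_int \<Longrightarrow> v \<in> C \<Longrightarrow> x \<rhd> c \<cdot> v = c \<cdot> x \<rhd> v"
  using smult_assoc[of "scal \<epsilon> c" "spec \<epsilon> x" v] smult_assoc[of "spec \<epsilon> x" "scal \<epsilon> c" v]
  by (simp add: tensor_mult U_int.one)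

lemma scale_scale: "v \<in> C \<Longrightarrow> c \<cdot> d \<cdot> v = (c * d) \<cdot> v"
  using smult_assoc[of "scal \<epsilon> c" "scal \<epsilon> d" v] by (simp add: tensor_mult U_int.one)

lemma scale_add_left: "v \<in> C \<Longrightarrow> (c + d) \<cdot> v = c \<cdot> v \<oplus>\<^sub>V d \<cdot> v"
  by (simp add: tensor_add_right smult_l_distr U_int.one)

lemma scale_add_right: "v \<in> C \<Longrightarrow> w \<in> C \<Longrightarrow> c \<cdot> (v \<oplus>\<^sub>V w) = c \<cdot> v \<oplus>\<^sub>V c \<cdot> w"
  by (simp add: smult_r_distr U_int.one)

lemma scale_0 [simp]: "v \<in> C \<Longrightarrow> 0 \<cdot> v = \<zero>\<^bsub>V\<^esub>"
  by (simp add: tensor_zero_right U_int.one smult_l_null)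

lemma scale_zero [simp]: "c \<cdot> \<zero>\<^bsub>V\<^esub> = \<zero>\<^bsub>V\<^esub>"
  by (simp add: smult_r_null U_int.one)

lemma act_zero [simp]: "x \<in> U_int \<Longrightarrow> x \<rhd> \<zero>\<^bsub>V\<^esub> = \<zero>\<^bsub>V\<^esub>"
  by (simp add: smult_r_null)

lemma scale_cancel:
  assumes "c \<cdot> v = c \<cdot> w" "c \<noteq> 0" "v \<in> C" "w \<in> C"
  shows "v = w"
proof -
  have "inverse c \<cdot> c \<cdot> v = inverse c \<cdot> c \<cdot> w"
    by (simp only: assms)
  then show ?thesis
    using assms(2-4) by (simp add: scale_scale act_one)
qed

lemma minus_one_scale: "v \<in> C \<Longrightarrow> v \<oplus>\<^sub>V (- 1) \<cdot> v = \<zero>\<^bsub>V\<^esub>"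
  using scale_add_left[of v 1 "- 1"] by (simp add: act_one)

lemmas U_int_gens = U_int.K U_int.Kinv e_div_U_int f_div_U_int K_gauss_U_int U_int.one

lemma uE_U_int: "uE \<in> U_int"
  using e_div_U_int[of 1] by (simp only: e_div_1)

lemma K_int_U_int: "K_int c \<in> U_int"
  using K_gauss_U_int[of c 1] by simp

lemma weight_spaceD:
  assumes "v \<in> weight_space p \<epsilon> V m"
  shows "v \<in> C" "uK \<rhd> v = \<epsilon> powi m \<cdot> v" "K_gauss 0 p \<rhd> v = ev (qbinom m (int p)) \<cdot> v"
  using assms by (auto simp: weight_space_def K_binom_eq_K_gauss)

lemma uKi_weight:
  assumes "v \<in> C" "uK \<rhd> v = \<epsilon> powi m \<cdot> v"
  shows "uKi \<rhd> v = \<epsilon> powi (- m) \<cdot> v"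
proof -
  have "v = uKi \<rhd> uK \<rhd> v"
    using assms(1) act_mult[of uKi uK v] by (simp add: uKi_uK act_one U_int_gens)
  also have "\<dots> = \<epsilon> powi m \<cdot> uKi \<rhd> v"
    using assms by (simp add: act_scale U_int_gens)
  finally have "\<epsilon> powi (- m) \<cdot> v = \<epsilon> powi (- m) \<cdot> \<epsilon> powi m \<cdot> uKi \<rhd> v"
    by (rule arg_cong)
  also have "\<dots> = uKi \<rhd> v"
    using assms(1) eps_nonzero by (simp add: scale_scale power_int_minus act_one U_int_gens)
  finally show ?thesis ..
qed

lemma K_int_weight:
  assumes v: "v \<in> C" "uK \<rhd> v = \<epsilon> powi m \<cdot> v"
  shows "K_int c \<rhd> v = ev (qint (m + c)) \<cdot> v"
proof -
  let ?d = "qvar powi 1 - qvar powi (- 1)"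
  have d: "?d = qdelta" by (simp add: power_int_minus)
  have evd: "ev ?d = \<epsilon> powi 1 - \<epsilon> powi (- 1)"
    by (simp only: ev_simps qvar_powi_in_ring)
  have K: "uconst ?d * K_int c = uconst (qvar powi c) * uK + uconst (- (qvar powi (- c))) * uKi"
    unfolding d K_int_def using qdelta_nonzero
    by (simp only: mult.assoc[symmetric] uconst_mult[symmetric] uconst_uminus) simp
  have "ev ?d \<cdot> K_int c \<rhd> v = (uconst ?d * K_int c) \<rhd> v"
    by (rule act_uconst[symmetric, OF laurent_ring_diff[OF qvar_powi_in_ring qvar_powi_in_ring]
          K_int_U_int v(1)])
  also have "\<dots> = ev (qvar powi c) \<cdot> uK \<rhd> v \<oplus>\<^sub>V ev (- (qvar powi (- c))) \<cdot> uKi \<rhd> v"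
    unfolding K using v(1)
    by (simp only: act_add U_int_scale act_uconst U_int_gens qvar_powi_in_ring laurent_ring_uminus)
  also have "\<dots> = (\<epsilon> powi c * \<epsilon> powi m + (- (\<epsilon> powi (- c))) * \<epsilon> powi (- m)) \<cdot> v"
    by (simp only: v uKi_weight[OF v] scale_scale scale_add_left ev_simps qvar_powi_in_ring)
  also have "\<epsilon> powi c * \<epsilon> powi m + (- (\<epsilon> powi (- c))) * \<epsilon> powi (- m)
      = \<epsilon> powi (m + c) - \<epsilon> powi (- (m + c))"
    using eps_nonzero power_int_add[of \<epsilon> m c] power_int_add[of \<epsilon> "- m" "- c"] by simp
  also have "\<dots> = ev ?d * ev (qint (m + c))"
    unfolding evd using ev_qint[of "m + c"] by (simp only: mult.commute)
  finally have "ev ?d \<cdot> K_int c \<rhd> v = ev ?d \<cdot> ev (qint (m + c)) \<cdot> v"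
    using v by (simp only: scale_scale)
  then show ?thesis
    by (rule scale_cancel) (use v eps_diff_nonzero evd K_int_U_int in auto)
qed

text \<open>
  The hypothesis is the case \<open>c = 0\<close>, \<open>t = p\<close>. For \<open>t < p\<close> the recursion can be divided by \<open>[t]\<close>;
  for \<open>t = p\<close> Pascal's rule moves \<open>c\<close>; for \<open>t > p\<close> the factor \<open>[K; c; p]\<close> is split off, at the cost
  of the number \<open>[t; p] = t div p\<close>, which is not zero.
\<close>

lemma K_gauss_weight:
  assumes v: "v \<in> weight_space p \<epsilon> V m"
  shows "K_gauss c t \<rhd> v = ev (qbinom (m + c) (int t)) \<cdot> v"
proof (induction t arbitrary: c rule: less_induct)
  case (less t)
  note [simp] = weight_spaceD(1)[OF v] K_gauss_U_int K_int_U_int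
  note K = K_int_weight[OF weight_spaceD(1,2)[OF v]]
  consider "t = 0" | "0 < t" "t < p" | "t = p" | "p < t" by linarith
  then show ?case
  proof cases
    case 1
    then show ?thesis by (simp add: act_one ev_simps)
  next
    case 2
    then obtain k where k: "t = Suc k" by (cases t) auto
    have "ev (qint (int t)) \<cdot> K_gauss c t \<rhd> v = (uconst (qint (int t)) * K_gauss c t) \<rhd> v"
      by (rule act_uconst[symmetric]) simp_all
    also have "\<dots> = K_gauss c k \<rhd> K_int (c - int k) \<rhd> v"
      unfolding k K_gauss_pred by (rule act_mult) simp_all
    also have "\<dots> = (ev (qint (m + c - int k)) * ev (qbinom (m + c) (int k))) \<cdot> v"
      using less[of k c] k by (simp add: K act_scale scale_scale add_diff_eq)
    also have "\<dots> = ev (qint (int t) * qbinom (m + c) (int t)) \<cdot> v"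
      unfolding k qbinom_Suc by (simp add: ev_simps mult.commute)
    also have "\<dots> = ev (qint (int t)) \<cdot> ev (qbinom (m + c) (int t)) \<cdot> v"
      by (simp add: ev_simps scale_scale)
    finally show ?thesis
      by (rule scale_cancel)
        (use 2 in \<open>auto simp: ev_qint_eq_0_iff dest: zdvd_imp_le\<close>)
  next
    case 3
    then obtain k where k: "p = Suc k" "t = Suc k" using p_gt_1 by (cases p) auto
    have Ki: "uKi \<rhd> v = \<epsilon> powi (- m) \<cdot> v"
      using uKi_weight weight_spaceD[OF v] by blast
    have IH: "K_gauss c k \<rhd> v = ev (qbinom (m + c) (int k)) \<cdot> v" for c
      using less[of k c] k by simp
    have q1: "ev (qvar powi int t) = 1"
      using 3 eps_powi_eq_1_iff[of "int p"] by (simp only: ev_simps) simp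
    let ?b = "\<lambda>c. \<epsilon> powi (int k - (m + c)) * ev (qbinom (m + c) (int k))"
    have step: "K_gauss (c + 1) t \<rhd> v = K_gauss c t \<rhd> v \<oplus>\<^sub>V ?b c \<cdot> v" for c
    proof -
      have "K_gauss (c + 1) t \<rhd> v = ev (qvar powi int t) \<cdot> K_gauss c t \<rhd> v \<oplus>\<^sub>V ev (qvar powi (int k
          - c)) \<cdot> uKi \<rhd> K_gauss c k \<rhd> v"
        unfolding k K_gauss_pascal
        by (subst act_add) (simp_all only: act_uconst act_mult U_int_scale U_int.mult U_int_gens
            qvar_powi_in_ring weight_spaceD(1)[OF v])
      also have "ev (qvar powi (int k - c)) \<cdot> uKi \<rhd> K_gauss c k \<rhd> v =
        (\<epsilon> powi (int k - c) * (ev (qbinom (m + c) (int k)) * \<epsilon> powi (- m))) \<cdot> v"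
        by (simp add: IH Ki act_scale U_int_gens scale_scale ev_simps)
      also have "\<epsilon> powi (int k - c) * (ev (qbinom (m + c) (int k)) * \<epsilon> powi (- m)) = ?b c"
        using eps_nonzero power_int_add[of \<epsilon> "int k - c" "- m"] by (simp add: algebra_simps)
      finally show ?thesis by (simp only: q1) (simp add: act_one)
    qed
    have scalar: "ev (qbinom (m + (c + 1)) (int t)) = ev (qbinom (m + c) (int t)) + ?b c" for c
    proof -
      have "qbinom (m + (c + 1)) (int t) = qvar powi int t * qbinom (m + c) (int t)
          + qvar powi (int k - (m + c)) * qbinom (m + c) (int k)"
        using qbinom_pascal[of "m + c" k] by (simp only: k add.assoc)
      then have "ev (qbinom (m + (c + 1)) (int t))
          = ev (qvar powi int t) * ev (qbinom (m + c) (int t)) + ?b c"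
        by (simp only: ev_simps laurent_ring_mult qvar_powi_in_ring qbinom_in_ring)
      then show ?thesis by (simp only: q1 mult_1)
    qed
    show ?thesis
    proof (induction c rule: int_induct[where k = 0])
      case base
      show ?case using weight_spaceD(3)[OF v] 3 by simp
    next
      case (step1 c)
      show ?case
        unfolding step scalar step1(2) by (rule scale_add_left[symmetric]) simp
    next
      case (step2 c)
      have "K_gauss (c - 1) t \<rhd> v \<oplus>\<^sub>V ?b (c - 1) \<cdot> v = K_gauss c t \<rhd> v"
        using step[of "c - 1"] by simp
      also have "\<dots> = ev (qbinom (m + (c - 1)) (int t)) \<cdot> v \<oplus>\<^sub>V ?b (c - 1) \<cdot> v"
        using step2(2) scalar[of "c - 1"] scale_add_left by simp
      finally show ?case
        by (subst (asm) M.add.right_cancel) simp_all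
    qed
  next
    case 4
    define n where "n = t - p"
    have t: "t = p + n" using 4 by (simp add: n_def)
    have "ev (qbinom (int t) (int p)) \<cdot> K_gauss c t \<rhd> v
        = (uconst (qbinom (int t) (int p)) * K_gauss c t) \<rhd> v"
      by (rule act_uconst[symmetric]) simp_all
    also have "\<dots> = K_gauss c p \<rhd> K_gauss (c - int p) n \<rhd> v"
      unfolding t K_gauss_split by (rule act_mult) simp_all
    also have "\<dots> = (ev (qbinom (m + c - int p) (int n)) * ev (qbinom (m + c) (int p))) \<cdot> v"
      using less[of p c] less[of n "c - int p"] 4 p_gt_1 t
          by (simp add: act_scale scale_scale add_diff_eq)
    also have "\<dots> = ev (qbinom (m + c) (int t) * qbinom (int t) (int p)) \<cdot> v"
      unfolding t qbinom_split by (simp add: ev_simps mult.commute)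
    also have "\<dots> = ev (qbinom (int t) (int p)) \<cdot> ev (qbinom (m + c) (int t)) \<cdot> v"
      by (simp add: ev_simps scale_scale mult.commute)
    finally show ?thesis
      by (rule scale_cancel)
        (use 4 p_gt_1 in \<open>auto simp: ev_qbinom_p zdiv_eq_0_iff\<close>)
  qed
qed

lemma sum_act_zero:
  assumes "v \<in> C" "finite S" "\<And>i. i \<in> S \<Longrightarrow> g i \<in> U_int \<and> g i \<rhd> v = \<zero>\<^bsub>V\<^esub>"
  shows "sum g S \<rhd> v = \<zero>\<^bsub>V\<^esub>"
  using assms(2,3)
proof (induction S rule: finite_induct)
  case empty
  show ?case
    using act_uconst[of 0 1 v] assms(1) by (simp add: U_int.one ev_simps)
qed (use assms(1) in \<open>auto simp: act_add U_int_sum\<close>)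

text \<open>
  On a vector killed by all \<open>e^(r)\<close>, Kac's formula identifies \<open>[K;0;p]\<close> with \<open>e^(p) f^(p)\<close>.
\<close>

lemma primitive_vectorI:
  assumes v: "v \<in> C" "uK \<rhd> v = \<epsilon> powi l \<cdot> v" "\<And>r. 1 \<le> r \<Longrightarrow> e_div r \<rhd> v = \<zero>\<^bsub>V\<^esub>"
    and ef: "e_div p \<rhd> f_div p \<rhd> v = ev (qbinom l (int p)) \<cdot> v"
  shows "primitive_vector p \<epsilon> V l v"
proof -
  let ?g = "\<lambda>t. f_idiv (int p - int t) * K_gauss (2 * int t - int p - int p) t * e_div (p - t)"
  have g: "?g t \<in> U_int" for t
    by (intro U_int.mult f_idiv_U_int U_int_gens)
  have "?g t \<rhd> v = \<zero>\<^bsub>V\<^esub>" if "t < p" for t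
    using that v by (subst act_mult) (auto simp: f_idiv_U_int U_int_gens U_int.mult)
  then have rest: "sum ?g {..<p} \<rhd> v = \<zero>\<^bsub>V\<^esub>"
    using g v(1) by (intro sum_act_zero) auto
  have gp: "?g p = K_gauss 0 p"
    by (simp add: f_idiv_def)
  have "e_div p \<rhd> f_div p \<rhd> v = (sum ?g {..<p} + ?g p) \<rhd> v"
    using e_div_f_idiv[of p "int p"] v(1)
    by (simp add: act_mult[symmetric] U_int_gens lessThan_Suc_atMost[symmetric])
  also have "\<dots> = sum ?g {..<p} \<rhd> v \<oplus>\<^sub>V ?g p \<rhd> v"
    by (intro act_add U_int_sum g v(1))
  also have "\<dots> = K_gauss 0 p \<rhd> v"
    unfolding rest gp by (rule M.l_zero[OF act_closed[OF K_gauss_U_int v(1)]])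
  finally have "K_binom p \<rhd> v = ev (qbinom l (int p)) \<cdot> v"
    using ef by (simp add: K_binom_eq_K_gauss)
  moreover have "uE \<rhd> v = \<zero>\<^bsub>V\<^esub>"
    using v(3)[of 1] by (simp only: e_div_1 order_refl)
  ultimately show ?thesis
    using v(1,2) v(3)[of p] p_gt_1 by (simp add: primitive_vector_def weight_space_def)
qed

end

locale primitive = res_module p \<epsilon> V for p \<epsilon> and V :: "(ures, 'v) module" +
  fixes l :: int and v :: 'v
  assumes prim: "primitive_vector p \<epsilon> V l v"
begin

lemma prim_weight: "v \<in> weight_space p \<epsilon> V l" and prim_carrier [simp]: "v \<in> C"
  using prim by (auto simp: primitive_vector_def weight_space_def)

text \<open>
  Up to an invertible number, \<open>e^(r)\<close> is \<open>e^(r-1) e\<close> if \<open>p\<close> does not divide \<open>r\<close>, and \<open>e^(r-p)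
  e^(p)\<close> otherwise.
\<close>

lemma e_div_prim:
  assumes "1 \<le> r"
  shows "e_div r \<rhd> v = \<zero>\<^bsub>V\<^esub>"
proof (cases "int p dvd int r")
  case False
  obtain k where k: "r = Suc k" using assms by (cases r) auto
  have "ev (qint (int r)) \<cdot> e_div r \<rhd> v = e_div k \<rhd> uE \<rhd> v"
    unfolding k by (simp only: act_uconst[symmetric] act_mult[symmetric] e_div_Suc(2)[symmetric]
        qint_in_ring U_int_gens uE_U_int prim_carrier)
  also have "\<dots> = ev (qint (int r)) \<cdot> \<zero>\<^bsub>V\<^esub>"
    using prim by (simp add: primitive_vector_def U_int_gens)
  finally show ?thesis
    by (rule scale_cancel) (use False in \<open>auto simp: ev_qint_eq_0_iff U_int_gens\<close>)
next
  case True
  then have "p \<le> r" using assms by (auto dest: dvd_imp_le)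
  define n where "n = r - p"
  have r: "r = n + p" using \<open>p \<le> r\<close> by (simp add: n_def)
  have "ev (qbinom (int r) (int n)) = of_int (int r div int p)"
    unfolding r by (subst qbinom_sym) (rule ev_qbinom_p)
  then have nonzero: "ev (qbinom (int r) (int n)) \<noteq> 0"
    using p_gt_1 \<open>p \<le> r\<close> by (simp add: zdiv_eq_0_iff)
  have "ev (qbinom (int r) (int n)) \<cdot> e_div r \<rhd> v = e_div n \<rhd> e_div p \<rhd> v"
    unfolding r by (simp only: act_uconst[symmetric] act_mult[symmetric] e_div_mult[symmetric]
        qbinom_in_ring U_int_gens prim_carrier)
  also have "\<dots> = ev (qbinom (int r) (int n)) \<cdot> \<zero>\<^bsub>V\<^esub>"
    using prim by (simp add: primitive_vector_def U_int_gens)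
  finally show ?thesis
    by (rule scale_cancel) (simp_all add: nonzero U_int_gens)
qed

abbreviation u where "u s \<equiv> f_div s \<rhd> v"

lemma u_weight: "u s \<in> weight_space p \<epsilon> V (l - 2 * int s)"
proof -
  have "uK \<rhd> u s = (uK * f_div s) \<rhd> v"
    by (simp add: act_mult U_int_gens)
  also have "\<dots> = ev (qvar powi (- 2 * int s)) \<cdot> f_div s \<rhd> uK \<rhd> v"
    unfolding uK_f_div
    by (simp only: act_uconst act_mult qvar_powi_in_ring U_int_gens U_int.mult prim_carrier)
  also have "\<dots> = (\<epsilon> powi (- 2 * int s) * \<epsilon> powi l) \<cdot> u s"
    by (simp only: weight_spaceD[OF prim_weight] ev_simps act_scale scale_scale U_int_gens
        act_closed)
  also have "\<epsilon> powi (- 2 * int s) * \<epsilon> powi l = \<epsilon> powi (l - 2 * int s)"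
    using eps_nonzero power_int_add[of \<epsilon> "- 2 * int s" l] by simp
  finally have K: "uK \<rhd> u s = \<epsilon> powi (l - 2 * int s) \<cdot> u s" .
  have "K_binom p \<rhd> u s = (f_div s * K_gauss (0 - 2 * int s) p) \<rhd> v"
    unfolding K_binom_eq_K_gauss K_gauss_f_div[symmetric] by (simp add: act_mult U_int_gens)
  then have "K_binom p \<rhd> u s = ev (qbinom (l - 2 * int s) (int p)) \<cdot> u s"
    by (simp add: act_mult act_scale K_gauss_weight[OF prim_weight] U_int_gens)
  with K show ?thesis
    by (simp add: weight_space_def U_int_gens)
qed

text \<open>
  In Kac's formula only the term without a factor \<open>e^(r-t)\<close>, that is \<open>t = r\<close>, survives on \<open>v\<close>.
\<close>

lemma e_div_u:
  "e_div r \<rhd> u s = (if r \<le> s then ev (qbinom (l + int r - int s) (int r)) \<cdot> u (s - r) else \<zero>\<^bsub>V\<^esub>)"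
proof -
  let ?g = "\<lambda>t. f_idiv (int s - int t) * K_gauss (2 * int t - int r - int s) t * e_div (r - t)"
  have g: "?g t \<in> U_int" for t
    by (intro U_int.mult f_idiv_U_int U_int_gens)
  have "?g t \<rhd> v = \<zero>\<^bsub>V\<^esub>" if "t < r" for t
    using that by (subst act_mult) (auto simp: e_div_prim f_idiv_U_int U_int_gens U_int.mult)
  then have rest: "sum ?g {..<r} \<rhd> v = \<zero>\<^bsub>V\<^esub>"
    using g by (intro sum_act_zero) auto
  have "e_div r \<rhd> u s = (sum ?g {..<r} + ?g r) \<rhd> v"
    using e_div_f_idiv[of r "int s"]
    by (simp add: act_mult[symmetric] U_int_gens lessThan_Suc_atMost[symmetric])
  also have "\<dots> = sum ?g {..<r} \<rhd> v \<oplus>\<^sub>V ?g r \<rhd> v"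
    by (intro act_add U_int_sum g) simp
  also have "\<dots> = ?g r \<rhd> v"
    unfolding rest by (rule M.l_zero[OF act_closed[OF g prim_carrier]])
  also have "\<dots> = f_idiv (int s - int r) \<rhd> K_gauss (int r - int s) r \<rhd> v"
    by (simp add: act_mult f_idiv_U_int U_int_gens)
  also have "\<dots> = ev (qbinom (l + (int r - int s)) (int r)) \<cdot> f_idiv (int s - int r) \<rhd> v"
    by (simp add: K_gauss_weight[OF prim_weight] act_scale f_idiv_U_int)
  finally have *: "e_div r \<rhd> u s = ev (qbinom (l + (int r - int s)) (int r)) \<cdot> f_idiv (int s
      - int r) \<rhd> v" .
  show ?thesis
  proof (cases "r \<le> s")
    case True
    then have "f_idiv (int s - int r) = f_div (s - r)"
      by (simp add: f_idiv_def nat_diff_distrib)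
    then show ?thesis using * True by (simp add: add_diff_eq)
  next
    case False
    then have "f_idiv (int s - int r) \<rhd> v = \<zero>\<^bsub>V\<^esub>"
      using sum_act_zero[of v "{}"] by (simp add: f_idiv_def)
    then show ?thesis using * False by simp
  qed
qed

lemma f_div_u: "f_div r \<rhd> u s = ev (qbinom (int (r + s)) (int r)) \<cdot> u (r + s)"
  by (simp only: act_uconst[symmetric] act_mult[symmetric] f_div_mult qbinom_in_ring U_int_gens
      prim_carrier)

lemma ladder_act: "ladder \<epsilon> l x s c t \<Longrightarrow> x \<rhd> u s = c \<cdot> u t"
proof (induction rule: ladder.induct)
  case (K s)
  show ?case using weight_spaceD[OF u_weight] by simp
next
  case (Kinv s)
  show ?case using uKi_weight weight_spaceD[OF u_weight] by blast
qed (simp_all add: e_div_u f_div_u U_int_gens del: of_nat_add)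

end

section \<open>Submodules generated by a primitive vector\<close>

context res_module
begin

lemma submodule_zero: "submodule {\<zero>\<^bsub>V\<^esub>} (U_res \<epsilon>) V"
  by (rule submodule_closedI) (auto simp: smult_r_null)

lemma scale_submodule: "submodule T (U_res \<epsilon>) V \<Longrightarrow> y \<in> T \<Longrightarrow> c \<cdot> y \<in> T"
  using submodule_closed(4) by (simp add: U_int.one)

lemma act_submodule: "submodule T (U_res \<epsilon>) V \<Longrightarrow> x \<in> U_int \<Longrightarrow> y \<in> T \<Longrightarrow> x \<rhd> y \<in> T"
  using submodule_closed(4) by simp

lemma power_act:
  assumes "x \<in> U_int" "y \<in> C" "x \<rhd> y = c \<cdot> y"
  shows "x ^ n \<in> U_int \<and> x ^ n \<rhd> y = c ^ n \<cdot> y"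
proof (induction n)
  case 0
  show ?case using assms by (simp add: U_int.one)
next
  case (Suc n)
  then show ?case
    using assms by (simp add: U_int.mult act_mult act_scale scale_scale mult.commute)
qed

end

context primitive
begin

abbreviation W where "W I \<equiv> wspan \<epsilon> V v I"

lemma u_closed [simp]: "u s \<in> C"
  by (simp add: U_int_gens)

lemma u_0: "u 0 = v"
  by (simp add: act_one)

lemma wspan_closed: "y \<in> W I \<Longrightarrow> y \<in> C"
  by (induction rule: wspan.induct) simp_all

lemma u_in_wspan:
  assumes "s \<in> I"
  shows "c \<cdot> u s \<in> W I"
proof -
  have "\<zero>\<^bsub>V\<^esub> \<oplus>\<^sub>V c \<cdot> u s \<in> W I"
    by (rule wspan.add[OF wspan.zero assms])
  then show ?thesis by simp
qed

lemma wspan_plus: "z \<in> W I \<Longrightarrow> y \<in> W I \<Longrightarrow> y \<oplus>\<^sub>V z \<in> W I"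
proof (induction rule: wspan.induct)
  case zero
  then show ?case by (simp add: wspan_closed)
next
  case (add z s c)
  then have "y \<oplus>\<^sub>V (z \<oplus>\<^sub>V c \<cdot> u s) = (y \<oplus>\<^sub>V z) \<oplus>\<^sub>V c \<cdot> u s"
    by (intro M.a_assoc[symmetric]) (simp_all add: wspan_closed)
  then show ?case
    using add wspan.add by simp
qed

lemma wspan_scale: "y \<in> W I \<Longrightarrow> c \<cdot> y \<in> W I"
proof (induction rule: wspan.induct)
  case zero
  then show ?case by (simp add: wspan.zero)
next
  case (add y s d)
  then have "c \<cdot> (y \<oplus>\<^sub>V d \<cdot> u s) = c \<cdot> y \<oplus>\<^sub>V (c * d) \<cdot> u s"
    by (simp add: wspan_closed scale_add_right scale_scale)
  then show ?case
    using add wspan.add by simp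
qed

lemma wspan_gen:
  assumes "x \<in> U_gens" "y \<in> W UNIV"
  shows "x \<rhd> y \<in> W UNIV"
  using assms(2)
proof induction
  case zero
  then show ?case using assms(1) by (simp add: U_gens_U_int wspan.zero)
next
  case (add y s d)
  obtain c t where "ladder \<epsilon> l x s c t"
    using assms(1) by (rule ladder_exists)
  then have "x \<rhd> u s = c \<cdot> u t"
    by (rule ladder_act)
  then have eq: "x \<rhd> (y \<oplus>\<^sub>V d \<cdot> u s) = x \<rhd> y \<oplus>\<^sub>V (d * c) \<cdot> u t"
    using assms(1) add by (simp add: wspan_closed act_add_right act_scale scale_scale U_gens_U_int)
  show ?case
    unfolding eq by (rule wspan.add[OF add.IH UNIV_I])
qed

lemma wspan_smult:
  assumes "b \<in> carrier (U_res \<epsilon>)" "y \<in> W UNIV"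
  shows "b \<odot>\<^bsub>V\<^esub> y \<in> W UNIV"
  using assms
proof (induction arbitrary: y rule: U_res_induct)
  case (gen x)
  then show ?case by (rule wspan_gen)
next
  case (scal c)
  then show ?case by (rule wspan_scale)
next
  case (add b c)
  then show ?case by (simp add: smult_l_distr wspan_closed wspan_plus)
next
  case (mult b c)
  then show ?case by (simp add: smult_assoc wspan_closed)
qed

lemma submodule_wspan: "submodule (W UNIV) (U_res \<epsilon>) V"
  by (rule submodule_closedI) (auto intro: wspan_closed wspan.zero wspan_plus wspan_smult)

lemma v_in_wspan: "v \<in> W UNIV"
  using u_in_wspan[of 0 UNIV 1] by (simp add: act_one)

lemma wspan_subset_submodule:
  assumes T: "submodule T (U_res \<epsilon>) V" "v \<in> T"
  shows "W I \<subseteq> T"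
proof
  fix y assume "y \<in> W I"
  then show "y \<in> T"
  proof induction
    case zero
    show ?case using submodule_closed(2)[OF T(1)] .
  next
    case (add y s c)
    then show ?case
      by (intro submodule_closed(3)[OF T(1)] scale_submodule[OF T(1)] act_submodule[OF T(1)] T(2)
          U_int_gens)
  qed
qed

lemma wspan_bounded:
  assumes "y \<in> W {1..}"
  obtains n where "y \<in> W {1..n}"
proof -
  have "\<exists>n. y \<in> W {1..n}"
    using assms
  proof induction
    case zero
    show ?case by (intro exI wspan.zero)
  next
    case (add y s c)
    then obtain n where "y \<in> W {1..n}" by blast
    then have "y \<in> W {1..max n s}"
      by (rule wspan_mono) auto
    then have "y \<oplus>\<^sub>V c \<cdot> u s \<in> W {1..max n s}"
      using add(2) by (intro wspan.add) auto
    then show ?case by blast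
  qed
  then show ?thesis using that by blast
qed

lemma wspan_split:
  assumes "y \<in> W UNIV"
  obtains c z where "z \<in> W {1..}" "y = c \<cdot> v \<oplus>\<^sub>V z"
proof -
  have "\<exists>c z. z \<in> W {1..} \<and> y = c \<cdot> v \<oplus>\<^sub>V z"
    using assms
  proof induction
    case zero
    show ?case
      by (intro exI[of _ 0] exI[of _ "\<zero>\<^bsub>V\<^esub>"] conjI wspan.zero) simp
  next
    case (add y s d)
    then obtain c z where z: "z \<in> W {1..}" "y = c \<cdot> v \<oplus>\<^sub>V z" by blast
    have [simp]: "z \<in> C" using z(1) by (rule wspan_closed)
    show ?case
    proof (cases "s = 0")
      case True
      have "y \<oplus>\<^sub>V d \<cdot> u s = (c + d) \<cdot> v \<oplus>\<^sub>V z"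
        unfolding z(2) True u_0 by (simp add: scale_add_left M.a_ac)
      then show ?thesis using z(1) by blast
    next
      case False
      have "y \<oplus>\<^sub>V d \<cdot> u s = c \<cdot> v \<oplus>\<^sub>V (z \<oplus>\<^sub>V d \<cdot> u s)"
        unfolding z(2) by (simp add: M.a_assoc)
      moreover have "z \<oplus>\<^sub>V d \<cdot> u s \<in> W {1..}"
        using z(1) False by (intro wspan.add) auto
      ultimately show ?thesis by blast
    qed
  qed
  then show ?thesis using that by blast
qed

text \<open>Subtracting an eigenvalue of a diagonal operator kills the corresponding terms.\<close>

lemma wspan_shift:
  assumes "y \<in> W I" "x \<in> U_int" "\<And>s. s \<in> I \<Longrightarrow> x \<rhd> u s = h s \<cdot> u s"
  shows "x \<rhd> y \<oplus>\<^sub>V (- k) \<cdot> y \<in> W {s \<in> I. h s \<noteq> k}"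
  using assms(1)
proof induction
  case zero
  then show ?case using assms(2) by (simp add: wspan.zero)
next
  case (add y s c)
  have [simp]: "y \<in> C" using add(1) by (rule wspan_closed)
  have "x \<rhd> (y \<oplus>\<^sub>V c \<cdot> u s) \<oplus>\<^sub>V (- k) \<cdot> (y \<oplus>\<^sub>V c \<cdot> u s) =
    (x \<rhd> y \<oplus>\<^sub>V (c * h s) \<cdot> u s) \<oplus>\<^sub>V ((- k) \<cdot> y \<oplus>\<^sub>V (- k * c) \<cdot> u s)"
    using assms(2) add(2) by (simp only: act_add_right act_scale scale_scale scale_add_right
        assms(3) \<open>y \<in> C\<close> u_closed scale_closed)
  also have "\<dots> = (x \<rhd> y \<oplus>\<^sub>V (- k) \<cdot> y) \<oplus>\<^sub>V ((c * h s) \<cdot> u s \<oplus>\<^sub>V (- k * c) \<cdot> u s)"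
    using assms(2) by (simp add: M.a_ac)
  also have "(c * h s) \<cdot> u s \<oplus>\<^sub>V (- k * c) \<cdot> u s = (c * (h s - k)) \<cdot> u s"
    by (subst scale_add_left[symmetric]) (simp_all add: algebra_simps)
  finally have eq: "x \<rhd> (y \<oplus>\<^sub>V c \<cdot> u s) \<oplus>\<^sub>V (- k) \<cdot> (y \<oplus>\<^sub>V c \<cdot> u s) =
    (x \<rhd> y \<oplus>\<^sub>V (- k) \<cdot> y) \<oplus>\<^sub>V (c * (h s - k)) \<cdot> u s" .
  show ?case
  proof (cases "h s = k")
    case True
    then show ?thesis
      unfolding eq using add assms(2) by simp
  next
    case False
    then show ?thesis
      unfolding eq using add by (intro wspan.add) auto
  qed
qed

text \<open>
  The terms of \<open>z\<close> are removed one after the other: as the weights of \<open>v\<close> and \<open>f^(n) v\<close> differ, one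
  of \<open>K\<close> and \<open>[K; 0; p]\<close> has different eigenvalues on them, and subtracting the second eigenvalue
  kills \<open>f^(n) v\<close> while it multiplies \<open>v\<close> by a nonzero number.
\<close>

lemma component_in_submodule:
  assumes T: "submodule T (U_res \<epsilon>) V" and z: "z \<in> W {1..}" and "c \<cdot> v \<oplus>\<^sub>V z \<in> T"
  shows "c \<cdot> v \<in> T"
proof -
  obtain n where "z \<in> W {1..n}"
    using z by (rule wspan_bounded)
  then show ?thesis
    using assms(3)
  proof (induction n arbitrary: z c)
    case 0
    then have "z = \<zero>\<^bsub>V\<^esub>" by (cases rule: wspan.cases) auto
    then show ?case using 0 by simp
  next
    case (Suc n)
    have [simp]: "z \<in> C" using Suc.prems(1) by (rule wspan_closed)
    have "\<epsilon> powi l \<noteq> \<epsilon> powi (l - 2 * int (Suc n)) \<or>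
        ev (qbinom l (int p)) \<noteq> ev (qbinom (l - 2 * int (Suc n)) (int p))"
      using weight_eqI[of l "l - 2 * int (Suc n)"] by auto
    then obtain x h where x: "x \<in> U_int" "\<And>s. x \<rhd> u s = h (l - 2 * int s) \<cdot> u s"
      and h: "h l \<noteq> h (l - 2 * int (Suc n))"
      using that[of uK "\<lambda>m. \<epsilon> powi m"] that[of "K_gauss 0 p" "\<lambda>m. ev (qbinom m (int p))"]
        weight_spaceD[OF u_weight] U_int_gens by metis
    define k where "k = h (l - 2 * int (Suc n))"
    let ?z = "x \<rhd> z \<oplus>\<^sub>V (- k) \<cdot> z"
    have "?z \<in> W {s \<in> {1..Suc n}. h (l - 2 * int s) \<noteq> k}"
      using Suc.prems(1) x by (intro wspan_shift) auto
    then have z': "?z \<in> W {1..n}"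
      by (rule wspan_mono) (auto simp: k_def le_Suc_eq)
    have xv: "x \<rhd> v = h l \<cdot> v"
      using x(2)[of 0] by (simp add: act_one)
    have "x \<rhd> (c \<cdot> v \<oplus>\<^sub>V z) \<oplus>\<^sub>V (- k) \<cdot> (c \<cdot> v \<oplus>\<^sub>V z) =
        ((c * h l) \<cdot> v \<oplus>\<^sub>V x \<rhd> z) \<oplus>\<^sub>V ((- k * c) \<cdot> v \<oplus>\<^sub>V (- k) \<cdot> z)"
      using x(1) by (simp only: act_add_right act_scale scale_scale scale_add_right xv prim_carrier
          scale_closed \<open>z \<in> C\<close>)
    also have "\<dots> = ((c * h l) \<cdot> v \<oplus>\<^sub>V (- k * c) \<cdot> v) \<oplus>\<^sub>V ?z"
      using x(1) by (simp add: M.a_ac)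
    also have "(c * h l) \<cdot> v \<oplus>\<^sub>V (- k * c) \<cdot> v = (c * (h l - k)) \<cdot> v"
      by (subst scale_add_left[symmetric]) (simp_all add: algebra_simps)
    finally have "(c * (h l - k)) \<cdot> v \<oplus>\<^sub>V ?z \<in> T"
      using act_submodule[OF T x(1) Suc.prems(2)] scale_submodule[OF T Suc.prems(2), of "- k"]
        submodule_closed(3)[OF T] by metis
    then have "(c * (h l - k)) \<cdot> v \<in> T"
      by (rule Suc.IH[OF z'])
    then have "inverse (h l - k) \<cdot> (c * (h l - k)) \<cdot> v \<in> T"
      by (rule scale_submodule[OF T])
    moreover have "inverse (h l - k) * (c * (h l - k)) = c"
      using h by (simp add: k_def)
    ultimately show ?case
      by (simp only: scale_scale prim_carrier)
  qed
qed

lemma coefficient_zero: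
  assumes "v \<noteq> \<zero>\<^bsub>V\<^esub>" "z \<in> W {1..}" "c \<cdot> v \<oplus>\<^sub>V z = \<zero>\<^bsub>V\<^esub>"
  shows "c = 0"
proof (rule ccontr)
  assume "c \<noteq> 0"
  have "c \<cdot> v = c \<cdot> \<zero>\<^bsub>V\<^esub>"
    using component_in_submodule[OF submodule_zero assms(2)] assms(3) by simp
  then show False
    using scale_cancel[of c v "\<zero>\<^bsub>V\<^esub>"] \<open>c \<noteq> 0\<close> assms(1) by simp
qed

lemma v_notin_wspan:
  assumes "v \<noteq> \<zero>\<^bsub>V\<^esub>"
  shows "v \<notin> W {1..}"
proof
  assume "v \<in> W {1..}"
  then have "(- 1) \<cdot> v \<oplus>\<^sub>V v = \<zero>\<^bsub>V\<^esub>"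
    using minus_one_scale[of v] by (simp add: M.a_comm)
  then show False
    using coefficient_zero[OF assms \<open>v \<in> W {1..}\<close>] by fastforce
qed

text \<open>
  Indexing the summands by their eigenvalues merges the terms \<open>f^(s) v\<close> that \<open>K\<close> cannot
  distinguish; distinct nonzero summands are then distinct vectors, as the sum over a set in the
  definition of diagonalizability requires.
\<close>

lemma eigen_sum:
  assumes "y \<in> W UNIV"
  shows "\<exists>A x. finite A \<and> (\<forall>c\<in>A. x c \<in> C \<and> uK \<rhd> x c = c \<cdot> x c) \<and> y = finsum V x A"
  using assms
proof induction
  case zero
  show ?case by (intro exI[of _ "{}"]) simp
next
  case (add y s c)
  then obtain A x where A: "finite A" "\<forall>c\<in>A. x c \<in> C \<and> uK \<rhd> x c = c \<cdot> x c" "y = finsum V x A"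
    by blast
  define d where "d = \<epsilon> powi (l - 2 * int s)"
  define w where "w = c \<cdot> u s"
  have w: "w \<in> C" "uK \<rhd> w = d \<cdot> w"
    using weight_spaceD(2)[OF u_weight[of s]]
    by (simp_all add: w_def d_def act_scale scale_scale U_int_gens mult.commute)
  define B where "B = A - {d}"
  have B: "finite B" "d \<notin> B" "x \<in> B \<rightarrow> C"
    using A by (auto simp: B_def)
  \<comment> \<open>The part of \<open>y\<close> with eigenvalue \<open>d\<close>, possibly zero.\<close>
  obtain x0 where x0: "x0 \<in> C" "uK \<rhd> x0 = d \<cdot> x0" "y = x0 \<oplus>\<^sub>V finsum V x B"
  proof (cases "d \<in> A")
    case True
    then have "A = insert d B" by (auto simp: B_def)
    then show ?thesis
      using that[of "x d"] A B True by (auto simp: M.finsum_insert)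
  next
    case False
    then have "A = B" by (auto simp: B_def)
    then show ?thesis
      using that[of "\<zero>\<^bsub>V\<^esub>"] A B by (auto simp: U_int_gens)
  qed
  let ?x = "x(d := x0 \<oplus>\<^sub>V w)"
  have fB: "finsum V ?x B = finsum V x B"
    using B by (intro M.finsum_cong') auto
  have "finsum V ?x (insert d B) = (x0 \<oplus>\<^sub>V w) \<oplus>\<^sub>V finsum V x B"
    using B x0 w fB by (subst M.finsum_insert) auto
  also have "\<dots> = y \<oplus>\<^sub>V w"
    using x0 w B M.finsum_closed[of x B] by (simp add: M.a_ac)
  finally have "y \<oplus>\<^sub>V w = finsum V ?x (insert d B)" ..
  moreover have "uK \<rhd> (x0 \<oplus>\<^sub>V w) = d \<cdot> (x0 \<oplus>\<^sub>V w)"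
    using x0 w by (simp add: act_add_right scale_add_right U_int_gens)
  then have "\<forall>c\<in>insert d B. ?x c \<in> C \<and> uK \<rhd> ?x c = c \<cdot> ?x c"
    using A(2) x0 w B by (auto simp: B_def)
  ultimately have "\<exists>A x. finite A \<and> (\<forall>c\<in>A. x c \<in> C \<and> uK \<rhd> x c = c \<cdot> x c) \<and> y \<oplus>\<^sub>V w = finsum V x A"
    using B(1) by (intro exI[of _ "insert d B"] exI[of _ ?x]) simp
  then show ?case
    by (simp only: w_def)
qed

lemma K_diagonalizable_generated:
  assumes "C = W UNIV"
  shows "K_diagonalizable \<epsilon> V"
  unfolding K_diagonalizable_def
proof
  fix y assume "y \<in> C"
  then obtain A x where A: "finite A" "\<forall>c\<in>A. x c \<in> C \<and> uK \<rhd> x c = c \<cdot> x c" "y = finsum V x A"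
    using eigen_sum assms by metis
  define B where "B = {c \<in> A. x c \<noteq> \<zero>\<^bsub>V\<^esub>}"
  have "inj_on x B"
  proof (rule inj_onI)
    fix c d assume cd: "c \<in> B" "d \<in> B" "x c = x d"
    then have x: "x c \<in> C" "x c \<noteq> \<zero>\<^bsub>V\<^esub>" and "c \<in> A" "d \<in> A"
      using A(2) by (auto simp: B_def)
    then have x3: "c \<cdot> x c = d \<cdot> x c"
      using A(2) cd(3) by metis
    have "(c - d) \<cdot> x c = c \<cdot> x c \<oplus>\<^sub>V (- d) \<cdot> x c"
      using x(1) scale_add_left[of "x c" c "- d"] by simp
    also have "\<dots> = (d + - d) \<cdot> x c"
      unfolding x3 using x(1) by (rule scale_add_left[symmetric])
    finally have "(c - d) \<cdot> x c = (c - d) \<cdot> \<zero>\<^bsub>V\<^esub>"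
      using x(1) by simp
    then show "c = d"
      using scale_cancel[of "c - d" "x c" "\<zero>\<^bsub>V\<^esub>"] x by auto
  qed
  have "y = finsum V x B"
    unfolding A(3) using A by (intro M.add.finprod_mono_neutral_cong_right) (auto simp: B_def)
  also have "\<dots> = finsum V (\<lambda>z. z) (x ` B)"
    using \<open>inj_on x B\<close> A by (subst M.finsum_reindex) (auto simp: B_def)
  finally have "y = finsum V (\<lambda>z. z) (x ` B)" .
  moreover have "x ` B \<subseteq> K_eigenvectors \<epsilon> V" "finite (x ` B)"
    using A by (auto simp: B_def K_eigenvectors_def)
  ultimately show "\<exists>S. finite S \<and> S \<subseteq> K_eigenvectors \<epsilon> V \<and> y = finsum V (\<lambda>z. z) S"
    by blast
qed

lemma type1_generated:
  assumes "C = W UNIV"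
  shows "type1 p \<epsilon> V"
proof -
  have eq: "x ^ p \<rhd> y = y"
    if x: "x \<in> U_int" "\<And>s. \<exists>m. x \<rhd> u s = \<epsilon> powi m \<cdot> u s" and "y \<in> C" for x y
  proof -
    have xp: "x ^ p \<in> U_int"
      using power_act[of x "\<zero>\<^bsub>V\<^esub>" 0 p] x(1) by simp
    have "y \<in> W UNIV" using \<open>y \<in> C\<close> assms by simp
    then show ?thesis
    proof induction
      case zero
      then show ?case using xp by simp
    next
      case (add y s c)
      obtain m where "x \<rhd> u s = \<epsilon> powi m \<cdot> u s" using x(2) by blast
      then have "x ^ p \<rhd> u s = (\<epsilon> powi m) ^ p \<cdot> u s"
        using power_act[of x "u s" "\<epsilon> powi m" p] x(1) by simp
      moreover have "(\<epsilon> powi m) ^ p = 1"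
        using eps_powi_p_mult[of m] by (simp add: power_int_power' power_int_power mult.commute)
      ultimately show ?case
        using add xp by (simp add: act_add_right act_scale act_one wspan_closed)
    qed
  qed
  have "\<exists>m. uK \<rhd> u s = \<epsilon> powi m \<cdot> u s" "\<exists>m. uKi \<rhd> u s = \<epsilon> powi m \<cdot> u s" for s
    using weight_spaceD[OF u_weight[of s]] uKi_weight by blast+
  then show ?thesis
    using eq[of uK] eq[of uKi] K_diagonalizable_generated[OF assms] left_module_axioms
    by (simp add: type1_def U_int_gens)
qed

end


section \<open>Uniqueness of the irreducible module\<close>

text \<open>
  A priori only a linear relation, since dependencies among the \<open>f^(s) v\<close> need not hold among the
  \<open>f^(s) w\<close>; for irreducible modules it is the graph of an isomorphism.
\<close>

inductive_set string_graph ::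
    "complex \<Rightarrow> (ures, 'v) module \<Rightarrow> (ures, 'w) module \<Rightarrow> 'v \<Rightarrow> 'w \<Rightarrow> ('v \<times> 'w) set"
  for \<epsilon> V W v w where
  zero: "(\<zero>\<^bsub>V\<^esub>, \<zero>\<^bsub>W\<^esub>) \<in> string_graph \<epsilon> V W v w"
| add: "(y, z) \<in> string_graph \<epsilon> V W v w \<Longrightarrow>
    (y \<oplus>\<^bsub>V\<^esub> cscale \<epsilon> V c (act \<epsilon> V (f_div s) v), z \<oplus>\<^bsub>W\<^esub> cscale \<epsilon> W c (act \<epsilon> W (f_div s) w))
      \<in> string_graph \<epsilon> V W v w"

lemma string_graph_sym:
  "(y, z) \<in> string_graph \<epsilon> V W v w \<Longrightarrow> (z, y) \<in> string_graph \<epsilon> W V w v"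
  by (induction rule: string_graph.induct) (auto intro: string_graph.intros)

locale primitive_pair = V: primitive p \<epsilon> V l v + W: primitive p \<epsilon> W l w
  for p \<epsilon> and V :: "(ures, 'v) module" and W :: "(ures, 'w) module" and l v w
begin

abbreviation G where "G \<equiv> string_graph \<epsilon> V W v w"
abbreviation "scV \<equiv> cscale \<epsilon> V"
abbreviation "actV \<equiv> act \<epsilon> V"
abbreviation "vs s \<equiv> actV (f_div s) v"
abbreviation "scW \<equiv> cscale \<epsilon> W"
abbreviation "actW \<equiv> act \<epsilon> W"
abbreviation "ws s \<equiv> actW (f_div s) w"

lemma graph_wspan: "(y, z) \<in> G \<Longrightarrow> y \<in> V.W UNIV \<and> z \<in> W.W UNIV"
  by (induction rule: string_graph.induct) (auto intro: wspan.intros)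

lemma graph_closed: "(y, z) \<in> G \<Longrightarrow> y \<in> carrier V" "(y, z) \<in> G \<Longrightarrow> z \<in> carrier W"
  using graph_wspan V.wspan_closed W.wspan_closed by blast+

lemma graph_plus:
  assumes "(y', z') \<in> G" "(y, z) \<in> G"
  shows "(y \<oplus>\<^bsub>V\<^esub> y', z \<oplus>\<^bsub>W\<^esub> z') \<in> G"
  using assms(1)
proof induction
  case zero
  show ?case using assms(2) graph_closed[OF assms(2)] by simp
next
  case (add y' z' c s)
  have "(y \<oplus>\<^bsub>V\<^esub> y' \<oplus>\<^bsub>V\<^esub> scV c (vs s), z \<oplus>\<^bsub>W\<^esub> z' \<oplus>\<^bsub>W\<^esub> scW c (ws s)) \<in> G"
    by (rule string_graph.add[OF add.IH])
  then show ?case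
    using graph_closed[OF add.hyps] graph_closed[OF assms(2)] by (simp add: V.M.a_assoc W.M.a_assoc)
qed

lemma graph_scale: "(y, z) \<in> G \<Longrightarrow> (scV c y, scW c z) \<in> G"
proof (induction rule: string_graph.induct)
  case zero
  show ?case by (simp add: string_graph.zero)
next
  case (add y z d s)
  have "(scV c y \<oplus>\<^bsub>V\<^esub> scV (c * d) (vs s),
      scW c z \<oplus>\<^bsub>W\<^esub> scW (c * d) (ws s)) \<in> G"
    by (rule string_graph.add[OF add.IH])
  then show ?case
    using graph_closed[OF add.hyps]
    by (simp add: V.scale_add_right W.scale_add_right V.scale_scale W.scale_scale)
qed

lemma graph_gen:
  assumes "x \<in> U_gens" "(y, z) \<in> G"
  shows "(actV x y, actW x z) \<in> G"
  using assms(2)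
proof induction
  case zero
  show ?case using assms(1) by (simp add: U_gens_U_int string_graph.zero)
next
  case (add y z d s)
  obtain c t where "ladder \<epsilon> l x s c t"
    using assms(1) by (rule ladder_exists)
  then have xu: "actV x (vs s) = scV c (vs t)"
    "actW x (ws s) = scW c (ws t)"
    using V.ladder_act W.ladder_act by blast+
  have "(actV x y \<oplus>\<^bsub>V\<^esub> scV (d * c) (vs t),
      actW x z \<oplus>\<^bsub>W\<^esub> scW (d * c) (ws t)) \<in> G"
    by (rule string_graph.add[OF add.IH])
  then show ?case
    using assms(1) graph_closed[OF add.hyps]
    by (simp add: V.act_add_right W.act_add_right V.act_scale W.act_scale xu
        V.scale_scale W.scale_scale U_gens_U_int)
qed

lemma graph_smult:
  assumes "b \<in> carrier (U_res \<epsilon>)" "(y, z) \<in> G"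
  shows "(b \<odot>\<^bsub>V\<^esub> y, b \<odot>\<^bsub>W\<^esub> z) \<in> G"
  using assms
proof (induction arbitrary: y z rule: U_res_induct)
  case (gen x)
  then show ?case by (rule graph_gen)
next
  case (scal c)
  then show ?case by (rule graph_scale)
next
  case (add b c)
  then have "(b \<odot>\<^bsub>V\<^esub> y \<oplus>\<^bsub>V\<^esub> c \<odot>\<^bsub>V\<^esub> y, b \<odot>\<^bsub>W\<^esub> z \<oplus>\<^bsub>W\<^esub> c \<odot>\<^bsub>W\<^esub> z) \<in> G"
    by (intro graph_plus) simp_all
  then show ?case
    using add graph_closed[OF add.prems] by (simp add: V.smult_l_distr W.smult_l_distr)
next
  case (mult b c)
  then have "(b \<odot>\<^bsub>V\<^esub> (c \<odot>\<^bsub>V\<^esub> y), b \<odot>\<^bsub>W\<^esub> (c \<odot>\<^bsub>W\<^esub> z)) \<in> G"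
    by simp
  then show ?case
    using mult graph_closed[OF mult.prems] by (simp add: V.smult_assoc W.smult_assoc)
qed

lemma graph_total:
  assumes "y \<in> V.W UNIV"
  obtains z where "(y, z) \<in> G"
proof -
  have "\<exists>z. (y, z) \<in> G"
    using assms by induction (blast intro: string_graph.intros)+
  then show ?thesis using that by blast
qed

lemma graph_split:
  assumes "(y, z) \<in> G"
  obtains c y' z' where "y' \<in> V.W {1..}" "z' \<in> W.W {1..}"
    "y = scV c v \<oplus>\<^bsub>V\<^esub> y'" "z = scW c w \<oplus>\<^bsub>W\<^esub> z'"
proof -
  have "\<exists>c y' z'. y' \<in> V.W {1..} \<and> z' \<in> W.W {1..} \<and>
    y = scV c v \<oplus>\<^bsub>V\<^esub> y' \<and> z = scW c w \<oplus>\<^bsub>W\<^esub> z'"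
    using assms
  proof induction
    case zero
    show ?case
      by (intro exI[of _ 0] exI[of _ "\<zero>\<^bsub>V\<^esub>"] exI[of _ "\<zero>\<^bsub>W\<^esub>"] conjI wspan.zero) simp_all
  next
    case (add y z d s)
    then obtain c y' z' where *: "y' \<in> V.W {1..}" "z' \<in> W.W {1..}"
      "y = scV c v \<oplus>\<^bsub>V\<^esub> y'" "z = scW c w \<oplus>\<^bsub>W\<^esub> z'"
      by blast
    have [simp]: "y' \<in> carrier V" "z' \<in> carrier W"
      using * V.wspan_closed W.wspan_closed by blast+
    show ?case
    proof (cases "s = 0")
      case True
      have "y \<oplus>\<^bsub>V\<^esub> scV d (vs s) = scV (c + d) v \<oplus>\<^bsub>V\<^esub> y'"
        "z \<oplus>\<^bsub>W\<^esub> scW d (ws s) = scW (c + d) w \<oplus>\<^bsub>W\<^esub> z'"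
        unfolding * True V.u_0 W.u_0
        by (simp_all add: V.scale_add_left V.M.a_ac W.scale_add_left W.M.a_ac)
      then show ?thesis using *(1,2) by blast
    next
      case False
      have "y \<oplus>\<^bsub>V\<^esub> scV d (vs s) =
          scV c v \<oplus>\<^bsub>V\<^esub> (y' \<oplus>\<^bsub>V\<^esub> scV d (vs s))"
        "z \<oplus>\<^bsub>W\<^esub> scW d (ws s) =
          scW c w \<oplus>\<^bsub>W\<^esub> (z' \<oplus>\<^bsub>W\<^esub> scW d (ws s))"
        unfolding *(3,4) by (simp_all add: V.M.a_assoc W.M.a_assoc)
      moreover have "y' \<oplus>\<^bsub>V\<^esub> scV d (vs s) \<in> V.W {1..}"
        "z' \<oplus>\<^bsub>W\<^esub> scW d (ws s) \<in> W.W {1..}"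
        using *(1,2) False by (auto intro!: wspan.add)
      ultimately show ?thesis by blast
    qed
  qed
  then show ?thesis using that by blast
qed

text \<open>
  The vectors related to \<open>0\<close> form a submodule; it cannot contain \<open>v\<close>, since the coefficient of \<open>v\<close>
  and that of \<open>w\<close> in related vectors agree.
\<close>

lemma graph_inj:
  assumes irr: "irreducible_module (U_res \<epsilon>) V" and nz: "v \<noteq> \<zero>\<^bsub>V\<^esub>" "w \<noteq> \<zero>\<^bsub>W\<^esub>"
    and "(y, \<zero>\<^bsub>W\<^esub>) \<in> G"
  shows "y = \<zero>\<^bsub>V\<^esub>"
proof -
  let ?A = "{y. (y, \<zero>\<^bsub>W\<^esub>) \<in> G}"
  have "submodule ?A (U_res \<epsilon>) V"
  proof (rule V.submodule_closedI)
    show "?A \<subseteq> carrier V"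
      using graph_closed(1) by blast
    show "\<zero>\<^bsub>V\<^esub> \<in> ?A"
      by (simp add: string_graph.zero)
    show "y \<oplus>\<^bsub>V\<^esub> y' \<in> ?A" if "y \<in> ?A" "y' \<in> ?A" for y y'
      using that graph_plus[of y' "\<zero>\<^bsub>W\<^esub>" y "\<zero>\<^bsub>W\<^esub>"] by simp
    show "b \<odot>\<^bsub>V\<^esub> y \<in> ?A" if "b \<in> carrier (U_res \<epsilon>)" "y \<in> ?A" for b y
      using that graph_smult[of b y "\<zero>\<^bsub>W\<^esub>"] by (simp add: W.smult_r_null)
  qed
  then consider "?A = {\<zero>\<^bsub>V\<^esub>}" | "?A = carrier V"
    using irr by (auto simp: irreducible_module_def)
  then show ?thesis
  proof cases
    case 1
    then show ?thesis using assms(4) by blast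
  next
    case 2
    then have "(v, \<zero>\<^bsub>W\<^esub>) \<in> G"
      using V.prim_carrier by blast
    then obtain c y' z' where *: "y' \<in> V.W {1..}" "z' \<in> W.W {1..}"
      "v = scV c v \<oplus>\<^bsub>V\<^esub> y'" "\<zero>\<^bsub>W\<^esub> = scW c w \<oplus>\<^bsub>W\<^esub> z'"
      by (rule graph_split)
    have "c = 0"
      using W.coefficient_zero[OF nz(2) *(2)] *(4) by simp
    then have "v = y'"
      using *(1,3) V.wspan_closed by simp
    then show ?thesis
      using V.v_notin_wspan[OF nz(1)] *(1) by simp
  qed
qed

end

lemma primitive_pair_iso:
  fixes V :: "(ures, 'v) module" and W :: "(ures, 'w) module"
  assumes "primitive p \<epsilon> V l v" "irreducible_module (U_res \<epsilon>) V" "v \<noteq> \<zero>\<^bsub>V\<^esub>"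
    and "primitive p \<epsilon> W l w" "irreducible_module (U_res \<epsilon>) W" "w \<noteq> \<zero>\<^bsub>W\<^esub>"
  shows "module_iso (U_res \<epsilon>) V W"
proof -
  interpret VW: primitive_pair p \<epsilon> V W l v w
    by (rule primitive_pair.intro) fact+
  interpret WV: primitive_pair p \<epsilon> W V l w v
    by (rule primitive_pair.intro) fact+
  have spanV: "wspan \<epsilon> V v UNIV = carrier V"
    using assms(2,3) VW.V.submodule_wspan VW.V.v_in_wspan by (auto simp: irreducible_module_def)
  have spanW: "wspan \<epsilon> W w UNIV = carrier W"
    using assms(5,6) VW.W.submodule_wspan VW.W.v_in_wspan by (auto simp: irreducible_module_def)
  have inj: "y = y'" if "(y, z) \<in> VW.G" "(y', z) \<in> VW.G" for y y' z
  proof -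
    note closed = VW.graph_closed[OF that(1)] VW.graph_closed[OF that(2)]
    have "(y \<oplus>\<^bsub>V\<^esub> cscale \<epsilon> V (- 1) y', z \<oplus>\<^bsub>W\<^esub> cscale \<epsilon> W (- 1) z) \<in> VW.G"
      using that by (intro VW.graph_plus VW.graph_scale)
    then have "y \<oplus>\<^bsub>V\<^esub> cscale \<epsilon> V (- 1) y' = \<zero>\<^bsub>V\<^esub>"
      using closed VW.graph_inj[OF assms(2,3,6)] by (simp add: VW.W.minus_one_scale)
    then have "y \<oplus>\<^bsub>V\<^esub> cscale \<epsilon> V (- 1) y' = y' \<oplus>\<^bsub>V\<^esub> cscale \<epsilon> V (- 1) y'"
      using closed by (simp add: VW.V.minus_one_scale)
    then show ?thesis
      using closed by (subst (asm) VW.V.M.add.right_cancel) simp_all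
  qed
  have inj': "z = z'" if "(y, z) \<in> VW.G" "(y, z') \<in> VW.G" for y z z'
  proof -
    note closed = VW.graph_closed[OF that(1)] VW.graph_closed[OF that(2)]
    have "(y \<oplus>\<^bsub>V\<^esub> cscale \<epsilon> V (- 1) y, z \<oplus>\<^bsub>W\<^esub> cscale \<epsilon> W (- 1) z') \<in> VW.G"
      using that by (intro VW.graph_plus VW.graph_scale)
    then have "(z \<oplus>\<^bsub>W\<^esub> cscale \<epsilon> W (- 1) z', \<zero>\<^bsub>V\<^esub>) \<in> WV.G"
      using closed string_graph_sym by (simp add: VW.V.minus_one_scale)
    then have "z \<oplus>\<^bsub>W\<^esub> cscale \<epsilon> W (- 1) z' = \<zero>\<^bsub>W\<^esub>"
      by (rule WV.graph_inj[OF assms(5,6,3)])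
    then have "z \<oplus>\<^bsub>W\<^esub> cscale \<epsilon> W (- 1) z' = z' \<oplus>\<^bsub>W\<^esub> cscale \<epsilon> W (- 1) z'"
      using closed by (simp add: VW.W.minus_one_scale)
    then show ?thesis
      using closed by (subst (asm) VW.W.M.add.right_cancel) simp_all
  qed
  define \<phi> where "\<phi> y = (THE z. (y, z) \<in> VW.G)" for y
  have phi_eq: "\<phi> y = z" if "(y, z) \<in> VW.G" for y z
    unfolding \<phi>_def using that inj' by blast
  have phi: "(y, \<phi> y) \<in> VW.G" if "y \<in> carrier V" for y
    using VW.graph_total[of y] phi_eq that by (metis spanV)
  show ?thesis
    unfolding module_iso_def
  proof (intro exI conjI ballI)
    show "bij_betw \<phi> (carrier V) (carrier W)"
    proof (rule bij_betwI')
      fix y y' assume "y \<in> carrier V" "y' \<in> carrier V"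
      then show "(\<phi> y = \<phi> y') = (y = y')"
        using phi[of y] phi[of y'] inj[of y "\<phi> y" y'] by auto
    next
      fix y assume "y \<in> carrier V"
      then show "\<phi> y \<in> carrier W"
        using phi VW.graph_closed(2) by blast
    next
      fix z assume "z \<in> carrier W"
      then obtain y where "(z, y) \<in> WV.G"
        using WV.graph_total[of z] spanW by blast
      then have "(y, z) \<in> VW.G"
        by (rule string_graph_sym)
      then show "\<exists>y\<in>carrier V. z = \<phi> y"
        using phi_eq VW.graph_closed(1) by blast
    qed
    show "\<phi> (y \<oplus>\<^bsub>V\<^esub> y') = \<phi> y \<oplus>\<^bsub>W\<^esub> \<phi> y'" if "y \<in> carrier V" "y' \<in> carrier V" for y y'
      using that phi by (intro phi_eq VW.graph_plus)
    show "\<phi> (b \<odot>\<^bsub>V\<^esub> y) = b \<odot>\<^bsub>W\<^esub> \<phi> y" if "b \<in> carrier (U_res \<epsilon>)" "y \<in> carrier V" for b y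
      using that phi by (intro phi_eq VW.graph_smult)
  qed
qed

lemma irreducible_hw_primitive:
  assumes "odd_root p \<epsilon>" "irreducible_hw p \<epsilon> l V"
  obtains v where "primitive p \<epsilon> V l v" "v \<noteq> \<zero>\<^bsub>V\<^esub>"
proof -
  obtain v where v: "v \<in> weight_space p \<epsilon> V l" "v \<noteq> \<zero>\<^bsub>V\<^esub>"
    "act \<epsilon> V (uq_gen GE) v = \<zero>\<^bsub>V\<^esub>" "act \<epsilon> V (e_div p) v = \<zero>\<^bsub>V\<^esub>"
    using assms(2) by (auto simp: irreducible_hw_def highest_weight_module_def)
  have "left_module (U_res \<epsilon>) V"
    using assms(2) by (simp add: irreducible_hw_def irreducible_module_def)
  then have "primitive p \<epsilon> V l v"
    using assms(1) v
    by (intro primitive.intro res_module.intro primitive_axioms.intro) (simp_all add: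
        primitive_vector_def)
  then show ?thesis using that v(2) by blast
qed

lemma irreducible_hw_iso:
  assumes "odd_root p \<epsilon>" "irreducible_hw p \<epsilon> l V" "irreducible_hw p \<epsilon> l W"
  shows "module_iso (U_res \<epsilon>) V W"
proof -
  obtain v where v: "primitive p \<epsilon> V l v" "v \<noteq> \<zero>\<^bsub>V\<^esub>"
    using irreducible_hw_primitive[OF assms(1,2)] .
  obtain w where w: "primitive p \<epsilon> W l w" "w \<noteq> \<zero>\<^bsub>W\<^esub>"
    using irreducible_hw_primitive[OF assms(1,3)] .
  show ?thesis
    using assms(2,3) by (intro primitive_pair_iso[OF v(1) _ v(2) w(1) _ w(2)])
      (simp_all add: irreducible_hw_def)
qed

section \<open>The irreducible subquotient generated by a primitive vector\<close>

text \<open>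
  The submodule \<open>N\<close> consists of the vectors whose whole orbit stays in the span of the \<open>f^(s) v\<close>
  with \<open>s \<ge> 1\<close>. A submodule that is not contained in \<open>N\<close> has an element with a nonzero coefficient
  at \<open>v\<close>, hence contains \<open>v\<close> and everything.
\<close>

lemma (in primitive) generated_quotient:
  assumes gen: "C = W UNIV" and nz: "v \<noteq> \<zero>\<^bsub>V\<^esub>"
  shows "\<exists>N. submodule N (U_res \<epsilon>) V \<and> irreducible_hw p \<epsilon> l (quot_module V N)"
proof -
  define N where "N = {y \<in> C. \<forall>b\<in>carrier (U_res \<epsilon>). b \<odot>\<^bsub>V\<^esub> y \<in> W {1..}}"
  have N: "submodule N (U_res \<epsilon>) V"
  proof (rule submodule_closedI)
    show "y \<oplus>\<^sub>V z \<in> N" if "y \<in> N" "z \<in> N" for y z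
      using that by (auto simp: N_def smult_r_distr wspan_plus)
    show "c \<odot>\<^bsub>V\<^esub> y \<in> N" if "c \<in> carrier (U_res \<epsilon>)" "y \<in> N" for c y
      using that by (auto simp: N_def smult_closed smult_assoc[symmetric])
  qed (auto simp: N_def smult_r_null wspan.zero)
  have N_W: "y \<in> W {1..}" if "y \<in> N" for y
  proof -
    have "\<one>\<^bsub>U_res \<epsilon>\<^esub> \<odot>\<^bsub>V\<^esub> y \<in> W {1..}" "y \<in> C"
      using that unfolding N_def by blast+
    then show ?thesis by (simp only: smult_one)
  qed
  define Q where "Q = quot_module V N"
  define \<pi> where "\<pi> = (\<lambda>x. N +>\<^bsub>V\<^esub> x)"
  note Q = quot_module_facts[OF N left_module_axioms, folded Q_def, folded \<pi>_def[THEN fun_cong]]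
  have Q_act: "act \<epsilon> Q x (\<pi> y) = \<pi> (x \<rhd> y)" if "x \<in> U_int" "y \<in> C" for x y
    using Q(3)[of "spec \<epsilon> x" y] that by simp
  have Q_scale: "cscale \<epsilon> Q c (\<pi> y) = \<pi> (c \<cdot> y)" if "y \<in> C" for c y
    using Q(3)[of "scal \<epsilon> c" y] that by (simp add: U_int.one)
  have pi0: "\<pi> \<zero>\<^bsub>V\<^esub> = \<zero>\<^bsub>Q\<^esub>"
    using Q(4)[of "\<zero>\<^bsub>V\<^esub>"] submodule_closed(2)[OF N] by simp
  have "primitive_vector p \<epsilon> Q l (\<pi> v)"
    using prim
    by (auto simp: primitive_vector_def weight_space_def Q_act Q_scale Q(1) pi0 uE_U_int U_int_gens
        K_binom_eq_K_gauss)
  then interpret Q: primitive p \<epsilon> Q l "\<pi> v"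
    using odd_root_axioms Q(5) by (intro primitive.intro res_module.intro primitive_axioms.intro)
  have nzQ: "\<pi> v \<noteq> \<zero>\<^bsub>Q\<^esub>"
    using Q(4)[of v] N_W v_notin_wspan[OF nz] by auto
  have "\<pi> y \<in> Q.W I" if "y \<in> W I" for y I
    using that
  proof induction
    case zero
    then show ?case by (simp add: pi0 wspan.zero)
  next
    case (add y s c)
    have "\<pi> (y \<oplus>\<^sub>V c \<cdot> u s) = \<pi> y \<oplus>\<^bsub>Q\<^esub> cscale \<epsilon> Q c (act \<epsilon> Q (f_div s) (\<pi> v))"
      using add(1) by (simp add: Q(2) Q_act Q_scale wspan_closed f_div_U_int)
    then show ?case
      using wspan.add[OF add.IH add.hyps(2)] by simp
  qed
  then have genQ: "carrier Q = Q.W UNIV"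
    using Q.wspan_closed unfolding Q(1) gen by blast
  have irr: "T = {\<zero>\<^bsub>Q\<^esub>} \<or> T = carrier Q" if T: "submodule T (U_res \<epsilon>) Q" for T
  proof (rule disjCI)
    assume "T \<noteq> carrier Q"
    define T0 where "T0 = {y \<in> C. \<pi> y \<in> T}"
    note Tc = Q.submodule_closed[OF T]
    have T0: "submodule T0 (U_res \<epsilon>) V"
      by (rule submodule_closedI) (auto simp: T0_def Q(2,3) pi0 Tc smult_closed)
    have "v \<notin> T0"
    proof
      assume "v \<in> T0"
      then have "\<pi> v \<in> T" by (simp add: T0_def)
      then have "carrier Q \<subseteq> T"
        using Q.wspan_subset_submodule[OF T] genQ by blast
      with Tc(1) \<open>T \<noteq> carrier Q\<close> show False by blast
    qed
    have "T0 \<subseteq> W {1..}"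
    proof
      fix y assume "y \<in> T0"
      then have "y \<in> W UNIV" using gen by (auto simp: T0_def)
      then obtain c z where z: "z \<in> W {1..}" "y = c \<cdot> v \<oplus>\<^sub>V z"
        by (rule wspan_split)
      then have "c \<cdot> v \<in> T0"
        using component_in_submodule[OF T0 z(1)] \<open>y \<in> T0\<close> by simp
      then have "inverse c \<cdot> c \<cdot> v \<in> T0"
        by (rule scale_submodule[OF T0])
      then have "c = 0"
        using \<open>v \<notin> T0\<close> by (cases "c = 0") (simp_all add: scale_scale act_one)
      then show "y \<in> W {1..}"
        using z wspan_closed[OF z(1)] by simp
    qed
    then have "T0 \<subseteq> N"
      using submodule_closed(1,4)[OF T0] by (auto simp: N_def)
    then have "T \<subseteq> {\<zero>\<^bsub>Q\<^esub>}"
      using Tc(1) Q(4) unfolding Q(1) T0_def by blast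
    with Tc(2) show "T = {\<zero>\<^bsub>Q\<^esub>}" by blast
  qed
  have "irreducible_module (U_res \<epsilon>) Q"
    using Q(5) irr nzQ Q.prim_carrier by (auto simp: irreducible_module_def)
  moreover have "highest_weight_module p \<epsilon> l Q"
    unfolding highest_weight_module_def
  proof (intro conjI bexI allI impI)
    show "type1 p \<epsilon> Q" by (rule Q.type1_generated[OF genQ])
    show "\<pi> v \<in> weight_space p \<epsilon> Q l" by (rule Q.prim_weight)
    show "T = carrier Q" if "submodule T (U_res \<epsilon>) Q" "\<pi> v \<in> T" for T
      using irr[OF that(1)] that(2) nzQ by blast
  qed (use Q.prim nzQ in \<open>auto simp: primitive_vector_def\<close>)
  ultimately show ?thesis
    using N by (auto simp: irreducible_hw_def Q_def)
qed

lemma wspan_restrict: "wspan \<epsilon> (V\<lparr>carrier := N\<rparr>) v I = wspan \<epsilon> V v I"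
proof
  show "wspan \<epsilon> (V\<lparr>carrier := N\<rparr>) v I \<subseteq> wspan \<epsilon> V v I"
  proof
    fix y assume "y \<in> wspan \<epsilon> (V\<lparr>carrier := N\<rparr>) v I"
    then show "y \<in> wspan \<epsilon> V v I"
      by induction (auto intro: wspan.intros)
  qed
  show "wspan \<epsilon> V v I \<subseteq> wspan \<epsilon> (V\<lparr>carrier := N\<rparr>) v I"
  proof
    fix y assume "y \<in> wspan \<epsilon> V v I"
    then show "y \<in> wspan \<epsilon> (V\<lparr>carrier := N\<rparr>) v I"
    proof induction
      case zero
      show ?case using wspan.zero[where V = "V\<lparr>carrier := N\<rparr>"] by simp
    next
      case (add y s c)
      show ?case using wspan.add[OF add.IH add.hyps(2), of c] by simp
    qed
  qed
qed

lemma (in primitive) irreducible_subquotient: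
  assumes nz: "v \<noteq> \<zero>\<^bsub>V\<^esub>"
  obtains S where "subquotient (U_res \<epsilon>) V S" "irreducible_hw p \<epsilon> l S"
proof -
  define M where "M = V\<lparr>carrier := W UNIV\<rparr>"
  have "left_module (U_res \<epsilon>) M"
    unfolding M_def by (rule submodule_left_module[OF submodule_wspan])
  moreover have "primitive_vector p \<epsilon> M l v"
    using prim v_in_wspan by (auto simp: primitive_vector_def weight_space_def M_def)
  ultimately interpret M: primitive p \<epsilon> M l v
    using odd_root_axioms by (intro primitive.intro res_module.intro primitive_axioms.intro)
  have "carrier M = M.W UNIV" "v \<noteq> \<zero>\<^bsub>M\<^esub>"
    using nz by (simp_all add: M_def wspan_restrict)
  then obtain N where "submodule N (U_res \<epsilon>) M" "irreducible_hw p \<epsilon> l (quot_module M N)"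
    using M.generated_quotient by blast
  then show ?thesis
    using that submodule_wspan by (auto simp: subquotient_def M_def)
qed

section \<open>Specialising an action on functions\<close>

abbreviation (input) "lookup \<equiv> Poly_Mapping.lookup"

text \<open>
  Functions need not have finite support here: a generator moves an index by a bounded amount, so
  that its action makes sense on all functions, and finite supports are merely preserved.
\<close>

locale gen_action =
  fixes op :: "gen \<Rightarrow> ('i \<Rightarrow> cq) \<Rightarrow> ('i \<Rightarrow> cq)"
  assumes op_linear: "op g (\<lambda>i. a * \<phi> i + b * \<psi> i) = (\<lambda>i. a * op g \<phi> i + b * op g \<psi> i)"
    and op_K_Kinv: "op GK (op GKinv \<phi>) = \<phi>" "op GKinv (op GK \<phi>) = \<phi>"
    and op_K_E: "op GK (op GE (op GKinv \<phi>)) = (\<lambda>i. qvar\<^sup>2 * op GE \<phi> i)"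
    and op_K_F: "op GK (op GF (op GKinv \<phi>)) = (\<lambda>i. inverse (qvar\<^sup>2) * op GF \<phi> i)"
    and op_E_F: "op GE (op GF \<phi>) i - op GF (op GE \<phi>) i
        = inverse qdelta * (op GK \<phi> i - op GKinv \<phi> i)"
    and op_finite: "finite {i. \<phi> i \<noteq> 0} \<Longrightarrow> finite {i. op g \<phi> i \<noteq> 0}"
begin

fun word_op :: "word \<Rightarrow> ('i \<Rightarrow> cq) \<Rightarrow> ('i \<Rightarrow> cq)" where
  "word_op (Word u) = foldr op u"

lemma word_op_add: "word_op (u + v) \<phi> = word_op u (word_op v \<phi>)"
  by (cases u; cases v) simp

lemma word_op_zero: "word_op 0 \<phi> = \<phi>"
  by (simp add: zero_word_def)

lemma word_op_linear:
  "word_op w (\<lambda>i. a * \<phi> i + b * \<psi> i) = (\<lambda>i. a * word_op w \<phi> i + b * word_op w \<psi> i)"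
proof (cases w)
  case (Word u)
  then show ?thesis
    by (induction u arbitrary: w) (simp_all add: op_linear)
qed

lemma word_op_finite: "finite {i. \<phi> i \<noteq> 0} \<Longrightarrow> finite {i. word_op w \<phi> i \<noteq> 0}"
proof (cases w)
  case (Word u)
  then show "finite {i. \<phi> i \<noteq> 0} \<Longrightarrow> ?thesis"
    by (induction u arbitrary: w) (simp_all add: op_finite)
qed

definition free_op :: "free_alg \<Rightarrow> ('i \<Rightarrow> cq) \<Rightarrow> ('i \<Rightarrow> cq)" where
  "free_op x \<phi> i = (\<Sum>w\<in>Poly_Mapping.keys x. lookup x w * word_op w \<phi> i)"

lemma free_op_superset:
  assumes "finite S" "Poly_Mapping.keys x \<subseteq> S"
  shows "free_op x \<phi> i = (\<Sum>w\<in>S. lookup x w * word_op w \<phi> i)"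
  unfolding free_op_def
  by (rule sum.mono_neutral_left[OF assms]) (auto simp: in_keys_iff)

lemma free_op_add: "free_op (x + y) \<phi> i = free_op x \<phi> i + free_op y \<phi> i"
proof -
  let ?S = "Poly_Mapping.keys x \<union> Poly_Mapping.keys y"
  have "free_op (x + y) \<phi> i = (\<Sum>w\<in>?S. lookup (x + y) w * word_op w \<phi> i)"
    by (rule free_op_superset) (auto simp: keys_add)
  also have "\<dots> = free_op x \<phi> i + free_op y \<phi> i"
    by (simp add: free_op_superset[of ?S x] free_op_superset[of ?S y] lookup_add
        distrib_right sum.distrib)
  finally show ?thesis .
qed

lemma free_op_zero: "free_op 0 \<phi> i = 0"
  by (simp add: free_op_def)

lemma free_op_single: "free_op (Poly_Mapping.single w c) \<phi> i = c * word_op w \<phi> i"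
  by (simp add: free_op_superset[of "{w}"])

lemma free_op_diff: "free_op (x - y) \<phi> i = free_op x \<phi> i - free_op y \<phi> i"
  using free_op_add[of "x - y" y] by simp

lemma free_op_linear:
  "free_op x (\<lambda>i. a * \<phi> i + b * \<psi> i) i = a * free_op x \<phi> i + b * free_op x \<psi> i"
  unfolding free_op_def word_op_linear
  by (simp add: distrib_left sum.distrib sum_distrib_left mult.left_commute)

lemma free_op_mult: "free_op (x * y) \<phi> = free_op x (free_op y \<phi>)"
proof -
  have single: "free_op (Poly_Mapping.single u c * y) \<phi> i = c * word_op u (free_op y \<phi>) i" for u c i
  proof (induction y arbitrary: i rule: poly_mapping_single_induct)
    case zero
    have "word_op u (\<lambda>i. 0 * 0 + 0 * 0) = (\<lambda>i. 0 * word_op u (\<lambda>i. 0) i + 0 * word_op u (\<lambda>i. 0) i)"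
      by (rule word_op_linear)
    moreover have "free_op 0 \<phi> = (\<lambda>i. 0)"
      by (rule ext) (rule free_op_zero)
    ultimately show ?case by (simp add: free_op_zero)
  next
    case (add y v d)
    have "free_op (Poly_Mapping.single v d + y) \<phi> = (\<lambda>i. d * word_op v \<phi> i + 1 * free_op y \<phi> i)"
      by (rule ext) (simp add: free_op_add free_op_single)
    then have "word_op u (free_op (Poly_Mapping.single v d + y) \<phi>) i =
        d * word_op u (word_op v \<phi>) i + 1 * word_op u (free_op y \<phi>) i"
      by (simp only: word_op_linear)
    moreover have "free_op (Poly_Mapping.single u c * (Poly_Mapping.single v d + y)) \<phi> i =
        c * (d * word_op u (word_op v \<phi>) i) + c * word_op u (free_op y \<phi>) i"
      using add by (simp add: distrib_left free_op_add mult_single free_op_single word_op_add)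
    ultimately show ?case
      by (simp only: distrib_left mult_1)
  qed
  have "free_op (x * y) \<phi> i = free_op x (free_op y \<phi>) i" for i
  proof (induction x rule: poly_mapping_single_induct)
    case (add x u c)
    then show ?case
      by (simp add: distrib_right free_op_add single free_op_single)
  qed (simp add: free_op_zero)
  then show ?thesis by blast
qed

lemma free_op_gen: "free_op (free_gen g) \<phi> = op g \<phi>"
  by (rule ext) (simp add: free_gen_def free_op_single)

lemma free_op_const: "free_op (free_const c) \<phi> = (\<lambda>i. c * \<phi> i)"
  by (rule ext) (simp add: free_const_def free_op_single word_op_zero)

lemma free_op_one: "free_op 1 \<phi> = \<phi>"
  using free_op_const[of 1 \<phi>] by (simp add: free_const_def single_one)

lemma free_op_rel: "r \<in> sl2_rels \<Longrightarrow> free_op r \<phi> i = 0"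
  by (auto simp: sl2_rels_def Let_def free_op_diff free_op_mult free_op_gen free_op_const
      free_op_one
      op_K_Kinv op_K_E op_K_F op_E_F)

lemma free_op_zero_fun: "free_op x (\<lambda>i. 0) i = 0"
  using free_op_linear[of x 0 "\<lambda>i. 0" 0 "\<lambda>i. 0" i] by simp

lemma free_op_ideal: "x \<in> sl2_ideal \<Longrightarrow> free_op x \<phi> i = 0"
proof (induction rule: sl2_ideal.induct)
  case (rel r a b)
  have "free_op r (free_op b \<phi>) = (\<lambda>i. 0)"
    using free_op_rel[OF rel] by blast
  then show ?case
    by (simp add: mult.assoc free_op_mult free_op_zero_fun)
qed (simp_all add: free_op_zero free_op_add)

definition uq_op :: "uq \<Rightarrow> ('i \<Rightarrow> cq) \<Rightarrow> ('i \<Rightarrow> cq)" where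
  "uq_op x = free_op (rep_uq x)"

lemma uq_op_abs: "uq_op (abs_uq a) \<phi> = free_op a \<phi>"
proof
  fix i
  have "sl2_cong (rep_uq (abs_uq a)) a"
    using Quotient3_uq Quotient3_rep_abs equivp_sl2_cong
    by (metis Quotient_uq Quotient_rep_abs equivp_reflp)
  then show "uq_op (abs_uq a) \<phi> i = free_op a \<phi> i"
    using free_op_ideal[of "rep_uq (abs_uq a) - a" \<phi> i]
    by (simp add: sl2_cong_def free_op_diff uq_op_def)
qed

lemma uq_op_add: "uq_op (x + y) \<phi> i = uq_op x \<phi> i + uq_op y \<phi> i"
  by (induction x rule: uq.abs_induct; induction y rule: uq.abs_induct)
    (simp add: plus_uq.abs_eq uq_op_abs free_op_add)

lemma uq_op_mult: "uq_op (x * y) \<phi> = uq_op x (uq_op y \<phi>)"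
  by (induction x rule: uq.abs_induct; induction y rule: uq.abs_induct)
    (simp add: times_uq.abs_eq uq_op_abs free_op_mult)

lemma uq_op_linear:
  "uq_op x (\<lambda>i. a * \<phi> i + b * \<psi> i) i = a * uq_op x \<phi> i + b * uq_op x \<psi> i"
  by (simp add: uq_op_def free_op_linear)

lemma uq_op_scale_fun: "uq_op x (\<lambda>i. a * \<phi> i) i = a * uq_op x \<phi> i"
  using uq_op_linear[of x a \<phi> 0 \<phi>] by simp

lemma uq_op_uconst: "uq_op (uconst c * x) \<phi> = (\<lambda>i. c * uq_op x \<phi> i)"
  by (simp add: uq_op_mult) (simp add: uconst_def uq_op_abs free_op_const)

lemma uq_op_one: "uq_op 1 \<phi> = \<phi>"
  by (simp add: one_uq.abs_eq uq_op_abs free_op_one)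

lemma uq_op_gen: "uq_op (uq_gen g) \<phi> = op g \<phi>"
  by (simp add: uq_gen_def uq_op_abs free_op_gen)

lemma uq_op_gen_power: "uq_op (uq_gen g ^ r) \<phi> = (op g ^^ r) \<phi>"
  by (induction r) (simp_all add: uq_op_one uq_op_mult uq_op_gen)

lemma uq_op_e_div: "uq_op (e_div r) \<phi> i = inverse (qfact r) * (op GE ^^ r) \<phi> i"
  and uq_op_f_div: "uq_op (f_div r) \<phi> i = inverse (qfact r) * (op GF ^^ r) \<phi> i"
  by (simp_all add: e_div_def f_div_def uq_scale_uconst uq_op_uconst uq_op_gen_power)

lemma uq_op_finite: "finite {i. \<phi> i \<noteq> 0} \<Longrightarrow> finite {i. uq_op x \<phi> i \<noteq> 0}"
proof -
  assume \<phi>: "finite {i. \<phi> i \<noteq> 0}"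
  have "{i. uq_op x \<phi> i \<noteq> 0} \<subseteq> (\<Union>w\<in>Poly_Mapping.keys (rep_uq x). {i. word_op w \<phi> i \<noteq> 0})"
    by (rule subsetI, rule ccontr) (simp add: uq_op_def free_op_def)
  then show ?thesis
    by (rule finite_subset) (simp add: word_op_finite[OF \<phi>])
qed

end

text \<open>
  The action of \<open>x\<close> at \<open>q = \<epsilon>\<close> is computed by lifting a complex function to constant functions,
  acting with \<open>x\<close>, and evaluating. The result does not depend on the lift, because functions with
  values in the ideal generated by \<open>q - \<epsilon>\<close> are preserved.
\<close>

locale integral_action = gen_action op for op :: "gen \<Rightarrow> ('i \<Rightarrow> cq) \<Rightarrow> ('i \<Rightarrow> cq)" +
  fixes \<epsilon> :: complex
  assumes eps_nz: "\<epsilon> \<noteq> 0"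
    and integral: "x \<in> U_gens \<Longrightarrow> (\<And>i. \<phi> i \<in> laurent_ring) \<Longrightarrow> uq_op x \<phi> i \<in> laurent_ring"
begin

abbreviation evl where "evl \<equiv> laurent_eval \<epsilon>"

lemmas evl_simps = laurent_eval_add[OF eps_nz] laurent_eval_mult[OF eps_nz]
  laurent_eval_0[OF eps_nz] laurent_eval_1[OF eps_nz] laurent_eval_const[OF eps_nz]
  laurent_eval_diff[OF eps_nz]

lemma uq_op_integral: "x \<in> U_int \<Longrightarrow> (\<And>i. \<phi> i \<in> laurent_ring) \<Longrightarrow> uq_op x \<phi> i \<in> laurent_ring"
proof (induction arbitrary: \<phi> i rule: U_int.induct)
  case one
  then show ?case by (simp add: uq_op_one)
next
  case (add x y)
  then show ?case by (auto simp: uq_op_add)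
next
  case (mult x y)
  then show ?case by (simp add: uq_op_mult)
next
  case (scale s x)
  then show ?case by (auto simp: uq_scale_uconst uq_op_uconst)
qed (auto intro!: integral simp: U_gens_def)

lemma laurent_eval_eq_0:
  assumes "x \<in> laurent_ring" "evl x = 0"
  obtains y where "y \<in> laurent_ring" "x = laurent [:- \<epsilon>, 1:] 0 * y"
proof -
  obtain P n where x: "x = laurent P n"
    using assms(1) by (rule laurent_ringE)
  then have "poly P \<epsilon> = 0"
    using assms(2) eps_nz by (simp add: laurent_eval_laurent)
  then obtain Q where "P = [:- \<epsilon>, 1:] * Q"
    unfolding poly_eq_0_iff_dvd by (rule dvdE)
  then show ?thesis
    using that[of "laurent Q n"] x by (simp only: laurent_mult laurent_in_ring) simp
qed

text \<open>
  A Laurent polynomial that vanishes at \<open>\<epsilon>\<close> is a multiple of \<open>q - \<epsilon>\<close>, and this factor commutes with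
  the action.
\<close>

lemma uq_op_eval_zero:
  assumes "x \<in> U_int" "\<And>i. \<phi> i \<in> laurent_ring" "\<And>i. evl (\<phi> i) = 0"
  shows "evl (uq_op x \<phi> i) = 0"
proof -
  let ?d = "laurent [:- \<epsilon>, 1:] 0"
  have "\<exists>y. y \<in> laurent_ring \<and> \<phi> i = ?d * y" for i
    using laurent_eval_eq_0[OF assms(2,3)] by metis
  then obtain \<psi> where \<psi>: "\<And>i. \<psi> i \<in> laurent_ring" "\<phi> = (\<lambda>i. ?d * \<psi> i)"
    by metis
  have "evl (uq_op x \<phi> i) = evl ?d * evl (uq_op x \<psi> i)"
    unfolding \<psi>(2) uq_op_scale_fun using uq_op_integral[OF assms(1)] \<psi>(1)
    by (simp add: evl_simps)
  also have "evl ?d = 0"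
    using eps_nz by (simp add: laurent_eval_laurent)
  finally show ?thesis by simp
qed

definition spec_op :: "uq \<Rightarrow> ('i \<Rightarrow> complex) \<Rightarrow> ('i \<Rightarrow> complex)" where
  "spec_op x \<psi> i = evl (uq_op x (\<lambda>j. lconst (\<psi> j)) i)"

lemma spec_op_lift:
  assumes "x \<in> U_int" "\<And>i. \<phi> i \<in> laurent_ring" "\<And>i. evl (\<phi> i) = \<psi> i"
  shows "evl (uq_op x \<phi> i) = spec_op x \<psi> i"
proof -
  let ?\<psi> = "\<lambda>j. lconst (\<psi> j)"
  have "uq_op x (\<lambda>j. 1 * \<phi> j + (- 1) * ?\<psi> j) i = 1 * uq_op x \<phi> i + (- 1) * uq_op x ?\<psi> i"
    by (rule uq_op_linear)
  moreover have "evl (uq_op x (\<lambda>j. 1 * \<phi> j + (- 1) * ?\<psi> j) i) = 0"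
    using assms by (intro uq_op_eval_zero) (auto simp: evl_simps laurent_ring_diff)
  ultimately have "evl (uq_op x \<phi> i - uq_op x ?\<psi> i) = 0"
    by simp
  then show ?thesis
    using uq_op_integral[OF assms(1)] assms(2) by (simp add: evl_simps spec_op_def)
qed

lemma spec_op_add: "x \<in> U_int \<Longrightarrow> y \<in> U_int \<Longrightarrow> spec_op (x + y) \<psi> i = spec_op x \<psi> i + spec_op y \<psi> i"
  by (simp add: spec_op_def uq_op_add evl_simps uq_op_integral)

lemma spec_op_uconst:
  "s \<in> laurent_ring \<Longrightarrow> x \<in> U_int \<Longrightarrow> spec_op (uconst s * x) \<psi> i = evl s * spec_op x \<psi> i"
  by (simp add: spec_op_def uq_op_uconst evl_simps uq_op_integral)

lemma spec_op_mult:
  "x \<in> U_int \<Longrightarrow> y \<in> U_int \<Longrightarrow> spec_op (x * y) \<psi> = spec_op x (spec_op y \<psi>)"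
  by (rule ext, subst spec_op_def, subst uq_op_mult, rule spec_op_lift)
    (auto simp: uq_op_integral spec_op_def)

lemma spec_op_one: "spec_op 1 \<psi> = \<psi>"
  by (rule ext) (simp add: spec_op_def uq_op_one evl_simps)

lemma spec_op_linear:
  assumes "x \<in> U_int"
  shows "spec_op x (\<lambda>i. a * \<phi> i + b * \<psi> i) i = a * spec_op x \<phi> i + b * spec_op x \<psi> i"
proof -
  have "spec_op x (\<lambda>i. a * \<phi> i + b * \<psi> i) i =
      evl (lconst a * uq_op x (\<lambda>i. lconst (\<phi> i)) i + lconst b * uq_op x (\<lambda>i. lconst (\<psi> i)) i)"
    unfolding spec_op_def uq_op_linear[symmetric] by (simp add: lconst_add lconst_mult)
  then show ?thesis
    using uq_op_integral[OF assms]
    by (simp add: spec_op_def evl_simps laurent_ring_mult)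
qed

lemma spec_op_finite: "finite {i. \<psi> i \<noteq> 0} \<Longrightarrow> finite {i. spec_op x \<psi> i \<noteq> 0}"
proof -
  assume fin: "finite {i. \<psi> i \<noteq> 0}"
  have "finite {i. uq_op x (\<lambda>j. lconst (\<psi> j)) i \<noteq> 0}"
    by (rule uq_op_finite, rule finite_subset[OF _ fin]) auto
  then show ?thesis
    by (rule finite_subset[rotated]) (auto simp: spec_op_def evl_simps)
qed

fun pair_op :: "tpair \<Rightarrow> ('i \<Rightarrow> complex) \<Rightarrow> ('i \<Rightarrow> complex)" where
  "pair_op (TPair x c) \<psi> i = c * spec_op x \<psi> i"

definition pre_op :: "pretensor \<Rightarrow> ('i \<Rightarrow> complex) \<Rightarrow> ('i \<Rightarrow> complex)" where
  "pre_op t \<psi> i = (\<Sum>w\<in>Poly_Mapping.keys t. of_int (lookup t w) * pair_op w \<psi> i)"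

lemma pre_op_superset:
  assumes "finite S" "Poly_Mapping.keys t \<subseteq> S"
  shows "pre_op t \<psi> i = (\<Sum>w\<in>S. of_int (lookup t w) * pair_op w \<psi> i)"
  unfolding pre_op_def
  by (rule sum.mono_neutral_left[OF assms]) (auto simp: in_keys_iff)

lemma pre_op_add: "pre_op (s + t) \<psi> i = pre_op s \<psi> i + pre_op t \<psi> i"
proof -
  let ?S = "Poly_Mapping.keys s \<union> Poly_Mapping.keys t"
  have "pre_op (s + t) \<psi> i = (\<Sum>w\<in>?S. of_int (lookup (s + t) w) * pair_op w \<psi> i)"
    by (rule pre_op_superset) (auto simp: keys_add)
  also have "\<dots> = pre_op s \<psi> i + pre_op t \<psi> i"
    by (simp add: pre_op_superset[of ?S s] pre_op_superset[of ?S t] lookup_add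
        distrib_right sum.distrib)
  finally show ?thesis .
qed

lemma pre_op_zero: "pre_op 0 \<psi> i = 0"
  by (simp add: pre_op_def)

lemma pre_op_diff: "pre_op (s - t) \<psi> i = pre_op s \<psi> i - pre_op t \<psi> i"
  using pre_op_add[of "s - t" t] by simp

lemma pre_op_single: "pre_op (Poly_Mapping.single (TPair x c) k) \<psi> i
    = of_int k * (c * spec_op x \<psi> i)"
  by (simp add: pre_op_superset[of "{TPair x c}"])

lemma pre_op_pt: "pre_op (pt x c) \<psi> i = c * spec_op x \<psi> i"
  by (simp add: pt_def pre_op_single)

lemma pre_op_rel: "r \<in> tensor_rels \<epsilon> \<Longrightarrow> pre_op r \<psi> i = 0"
  by (induction rule: tensor_rels.induct)
    (simp_all only: pre_op_diff pre_op_pt spec_op_add spec_op_uconst uq_scale_uconst,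
      simp_all add: algebra_simps)

lemma pre_op_null: "t \<in> tensor_null \<epsilon> \<Longrightarrow> pre_op t \<psi> i = 0"
  by (induction rule: tensor_null.induct) (simp_all add: pre_op_zero pre_op_add pre_op_diff
      pre_op_rel)

lemma pre_op_linear:
  assumes "t \<in> carrier pretensor_ring"
  shows "pre_op t (\<lambda>i. a * \<phi> i + b * \<psi> i) i = a * pre_op t \<phi> i + b * pre_op t \<psi> i"
  using assms
proof (induction t rule: pretensor_induct)
  case (add x c k s)
  then show ?case
    by (simp add: pre_op_add pre_op_single spec_op_linear) (simp add: algebra_simps)
qed (simp add: pre_op_zero)

lemma pre_op_mult:
  assumes s: "s \<in> carrier pretensor_ring" and t: "t \<in> carrier pretensor_ring"
  shows "pre_op (s * t) \<psi> = pre_op s (pre_op t \<psi>)"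
proof -
  have single: "pre_op (Poly_Mapping.single (TPair x c) k * t) \<psi> i =
      of_int k * (c * spec_op x (pre_op t \<psi>) i)" if x: "x \<in> U_int" for x c k i
    using t
  proof (induction t arbitrary: i rule: pretensor_induct)
    case zero
    have "pre_op 0 \<psi> = (\<lambda>i. 0 * 0 + 0 * 0)"
      by (rule ext) (simp add: pre_op_zero)
    then show ?case
      by (simp only: spec_op_linear[OF x]) (simp add: pre_op_zero)
  next
    case (add y d j t)
    have "pre_op (Poly_Mapping.single (TPair y d) j + t) \<psi> =
        (\<lambda>i. (of_int j * d) * spec_op y \<psi> i + 1 * pre_op t \<psi> i)"
      by (rule ext) (simp add: pre_op_add pre_op_single)
    then have "spec_op x (pre_op (Poly_Mapping.single (TPair y d) j + t) \<psi>) i =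
        (of_int j * d) * spec_op x (spec_op y \<psi>) i + 1 * spec_op x (pre_op t \<psi>) i"
      by (simp only: spec_op_linear[OF x])
    moreover have "pre_op (Poly_Mapping.single (TPair x c) k * (Poly_Mapping.single (TPair y d) j
        + t)) \<psi> i =
        of_int k * (c * ((of_int j * d) * spec_op x (spec_op y \<psi>) i))
            + of_int k * (c * spec_op x (pre_op t \<psi>) i)"
      using add x by (simp add: distrib_left pre_op_add mult_single pre_op_single spec_op_mult)
    ultimately show ?case
      by (simp only: distrib_left mult_1)
  qed
  have "pre_op (s * t) \<psi> i = pre_op s (pre_op t \<psi>) i" for i
    using s
  proof (induction s rule: pretensor_induct)
    case (add x c k s)
    then show ?case
      by (simp add: distrib_right pre_op_add single pre_op_single)
  qed (simp add: pre_op_zero)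
  then show ?thesis by blast
qed

lemma pre_op_finite:
  assumes fin: "finite {i. \<psi> i \<noteq> 0}"
  shows "finite {i. pre_op t \<psi> i \<noteq> 0}"
proof -
  have "finite {i. pair_op w \<psi> i \<noteq> 0}" for w
    by (cases w, rule finite_subset[OF _ spec_op_finite[OF fin]]) auto
  moreover have "{i. pre_op t \<psi> i \<noteq> 0} \<subseteq> (\<Union>w\<in>Poly_Mapping.keys t. {i. pair_op w \<psi> i \<noteq> 0})"
    by (rule subsetI, rule ccontr) (simp add: pre_op_def)
  ultimately show ?thesis
    by (auto intro: finite_subset)
qed

definition res_op :: "ures \<Rightarrow> ('i \<Rightarrow> complex) \<Rightarrow> ('i \<Rightarrow> complex)" where
  "res_op a = pre_op (SOME t. t \<in> carrier pretensor_ring \<and> tensor_class \<epsilon> t = a)"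

lemma res_op_class:
  assumes "t \<in> carrier pretensor_ring"
  shows "res_op (tensor_class \<epsilon> t) \<psi> = pre_op t \<psi>"
proof
  fix i
  let ?s = "SOME s. s \<in> carrier pretensor_ring \<and> tensor_class \<epsilon> s = tensor_class \<epsilon> t"
  have s: "?s \<in> carrier pretensor_ring \<and> tensor_class \<epsilon> ?s = tensor_class \<epsilon> t"
    by (rule someI[of _ t]) (simp add: assms)
  then have "?s - t \<in> tensor_null \<epsilon>"
    using assms ring.quotient_eq_iff_same_a_r_cos[OF ring_pretensor_ring ideal_tensor_null, of ?s t
        \<epsilon>]
    by (simp add: tensor_class_def pretensor_minus)
  then show "res_op (tensor_class \<epsilon> t) \<psi> i = pre_op t \<psi> i"
    using pre_op_null[of "?s - t" \<psi> i] by (simp add: res_op_def pre_op_diff)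
qed

lemma res_op_tensor: "x \<in> U_int \<Longrightarrow> res_op (tensor \<epsilon> x c) \<psi> i = c * spec_op x \<psi> i"
  by (simp add: tensor_eq_class res_op_class pt_carrier pre_op_pt)

lemma res_op_add:
  assumes "a \<in> carrier (U_res \<epsilon>)" "b \<in> carrier (U_res \<epsilon>)"
  shows "res_op (a \<oplus>\<^bsub>U_res \<epsilon>\<^esub> b) \<psi> i = res_op a \<psi> i + res_op b \<psi> i"
proof -
  obtain s t where "s \<in> carrier pretensor_ring" "a = tensor_class \<epsilon> s"
    "t \<in> carrier pretensor_ring" "b = tensor_class \<epsilon> t"
    using assms by (metis tensor_class_surj)
  then show ?thesis
    by (simp add: tensor_class_add[symmetric] res_op_class pretensor_carrier_add pre_op_add)
qed

lemma res_op_mult: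
  assumes "a \<in> carrier (U_res \<epsilon>)" "b \<in> carrier (U_res \<epsilon>)"
  shows "res_op (a \<otimes>\<^bsub>U_res \<epsilon>\<^esub> b) \<psi> = res_op a (res_op b \<psi>)"
proof -
  obtain s t where st: "s \<in> carrier pretensor_ring" "a = tensor_class \<epsilon> s"
    "t \<in> carrier pretensor_ring" "b = tensor_class \<epsilon> t"
    using assms by (metis tensor_class_surj)
  have "tensor_class \<epsilon> (s * t) = a \<otimes>\<^bsub>U_res \<epsilon>\<^esub> b"
    using ring_hom_mult[OF tensor_class_hom[of \<epsilon>] st(1,3)] st by (simp add: pretensor_ring_simps)
  then show ?thesis
    using st res_op_class[OF pretensor_carrier_mult[OF st(1,3)]]
    by (simp add: res_op_class pre_op_mult)
qed

lemma res_op_linear: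
  assumes "a \<in> carrier (U_res \<epsilon>)"
  shows "res_op a (\<lambda>i. c * \<phi> i + d * \<psi> i) i = c * res_op a \<phi> i + d * res_op a \<psi> i"
proof -
  obtain t where "t \<in> carrier pretensor_ring" "a = tensor_class \<epsilon> t"
    using assms by (rule tensor_class_surj)
  then show ?thesis by (simp add: res_op_class pre_op_linear)
qed

lemma res_op_finite: "finite {i. \<psi> i \<noteq> 0} \<Longrightarrow> finite {i. res_op a \<psi> i \<noteq> 0}"
  by (simp add: res_op_def pre_op_finite)

definition fun_module :: "(ures, 'i \<Rightarrow>\<^sub>0 complex) module" where
  "fun_module = \<lparr>carrier = UNIV, mult = (\<lambda>_ _. 0), one = 0, zero = 0, add = (+),
     smult = (\<lambda>a v. Abs_poly_mapping (res_op a (lookup v)))\<rparr>"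

lemma lookup_fun_module:
  "lookup (a \<odot>\<^bsub>fun_module\<^esub> v) = res_op a (lookup v)"
  by (simp add: fun_module_def res_op_finite)

lemma lookup_fun_module_spec:
  "x \<in> U_int \<Longrightarrow> lookup (spec \<epsilon> x \<odot>\<^bsub>fun_module\<^esub> v) i =
     evl (uq_op x (\<lambda>j. lconst (lookup v j)) i)"
  by (simp add: lookup_fun_module res_op_tensor spec_op_def)

lemma left_module_fun_module: "left_module (U_res \<epsilon>) fun_module"
proof (rule left_moduleI)
  show "ring (U_res \<epsilon>)" by (rule ring_U_res)
  show "abelian_group fun_module"
  proof (rule abelian_groupI)
    fix x assume "x \<in> carrier fun_module"
    show "\<exists>y\<in>carrier fun_module. y \<oplus>\<^bsub>fun_module\<^esub> x = \<zero>\<^bsub>fun_module\<^esub>"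
      by (intro bexI[of _ "- x"]) (simp_all add: fun_module_def)
  qed (simp_all add: fun_module_def add_ac)
  have add: "add fun_module = (+)" by (simp add: fun_module_def)
  show "a \<odot>\<^bsub>fun_module\<^esub> x \<in> carrier fun_module" for a x
    by (simp add: fun_module_def)
  show "(a \<oplus>\<^bsub>U_res \<epsilon>\<^esub> b) \<odot>\<^bsub>fun_module\<^esub> x = a \<odot>\<^bsub>fun_module\<^esub> x \<oplus>\<^bsub>fun_module\<^esub> b \<odot>\<^bsub>fun_module\<^esub> x"
    if "a \<in> carrier (U_res \<epsilon>)" "b \<in> carrier (U_res \<epsilon>)" for a b x
    using that by (intro poly_mapping_eqI) (simp add: add lookup_add lookup_fun_module res_op_add)
  show "(a \<otimes>\<^bsub>U_res \<epsilon>\<^esub> b) \<odot>\<^bsub>fun_module\<^esub> x = a \<odot>\<^bsub>fun_module\<^esub> (b \<odot>\<^bsub>fun_module\<^esub> x)"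
    if "a \<in> carrier (U_res \<epsilon>)" "b \<in> carrier (U_res \<epsilon>)" for a b x
    using that by (intro poly_mapping_eqI) (simp add: lookup_fun_module res_op_mult)
  show "a \<odot>\<^bsub>fun_module\<^esub> (x \<oplus>\<^bsub>fun_module\<^esub> y) = a \<odot>\<^bsub>fun_module\<^esub> x \<oplus>\<^bsub>fun_module\<^esub> a \<odot>\<^bsub>fun_module\<^esub> y"
    if "a \<in> carrier (U_res \<epsilon>)" for a x y
  proof (rule poly_mapping_eqI)
    fix i
    have "lookup (x + y) = (\<lambda>i. 1 * lookup x i + 1 * lookup y i)"
      by (rule ext) (simp add: lookup_add)
    then have "res_op a (lookup (x + y)) i =
        1 * res_op a (lookup x) i + 1 * res_op a (lookup y) i"
      by (simp only: res_op_linear[OF that])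
    then show "lookup (a \<odot>\<^bsub>fun_module\<^esub> (x \<oplus>\<^bsub>fun_module\<^esub> y)) i =
        lookup (a \<odot>\<^bsub>fun_module\<^esub> x \<oplus>\<^bsub>fun_module\<^esub> a \<odot>\<^bsub>fun_module\<^esub> y) i"
      by (simp add: add lookup_add lookup_fun_module)
  qed
  show "\<one>\<^bsub>U_res \<epsilon>\<^esub> \<odot>\<^bsub>fun_module\<^esub> x = x" for x
    by (rule poly_mapping_eqI)
      (simp add: lookup_fun_module tensor_one[symmetric] res_op_tensor U_int.one spec_op_one)
qed

lemma fun_module_scal:
  "lookup (scal \<epsilon> c \<odot>\<^bsub>fun_module\<^esub> x) i = c * lookup x i"
  by (simp add: lookup_fun_module res_op_tensor U_int.one spec_op_one)

end

section \<open>The restricted q-Fock spaces\<close>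

text \<open>
  Both actions are given in terms of coordinates: the value at \<open>(i, j)\<close> is the coefficient of the
  basis vector with index \<open>(i, j)\<close> in the image. In the first space truncated subtraction does no
  harm, because the factor \<open>[0] = 0\<close> cancels the wrong term; in the second space the case \<open>j = 0\<close>
  needs care.
\<close>

fun fock1_op :: "gen \<Rightarrow> (nat \<times> nat \<Rightarrow> cq) \<Rightarrow> nat \<times> nat \<Rightarrow> cq" where
  "fock1_op GE \<phi> (i, j) = qint (int i) * \<phi> (i - 1, j + 1)"
| "fock1_op GF \<phi> (i, j) = qint (int j) * \<phi> (i + 1, j - 1)"
| "fock1_op GK \<phi> (i, j) = qvar powi (int i - int j) * \<phi> (i, j)"
| "fock1_op GKinv \<phi> (i, j) = qvar powi (- (int i - int j)) * \<phi> (i, j)"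

fun fock2_op :: "gen \<Rightarrow> (nat \<times> nat \<Rightarrow> cq) \<Rightarrow> nat \<times> nat \<Rightarrow> cq" where
  "fock2_op GE \<phi> (i, j) = qint (int j + 1) * \<phi> (i + 1, j + 1)"
| "fock2_op GF \<phi> (i, j) = (if j = 0 then 0 else - qint (int i) * \<phi> (i - 1, j - 1))"
| "fock2_op GK \<phi> (i, j) = qvar powi (- (int i + int j + 1)) * \<phi> (i, j)"
| "fock2_op GKinv \<phi> (i, j) = qvar powi (int i + int j + 1) * \<phi> (i, j)"

lemma qvar_powi_cancel:
  "qvar powi n * (qvar powi (- n) * x) = x" "qvar powi (- n) * (qvar powi n * x) = x"
  using qvar_nonzero by (simp_all add: power_int_minus)

lemma qvar_powi_conj: "qvar powi m * (x * (qvar powi n * y)) = qvar powi (m + n) * (x * y)"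
  using qvar_nonzero by (simp add: power_int_add)

lemma qint_commutator: "qint (m + 1) * qint n - qint m * qint (n + 1) = qint (n - m)"
proof -
  have "qint (m + 1) = qvar * qint m + qvar powi (- m)" "qint (n + 1)
      = qvar * qint n + qvar powi (- n)"
    using qint_add[of m 1] qint_add[of n 1] by simp_all
  moreover have "qint (n - m) = qvar powi (- m) * qint n - qvar powi (- n) * qint m"
    using qint_add[of n "- m"] by (simp add: qint_uminus)
  ultimately show ?thesis
    by (simp add: algebra_simps)
qed

lemma qint_inverse_qdelta: "inverse qdelta * (qvar powi n * x - qvar powi (- n) * x) = qint n * x"
  by (simp add: qint_def field_simps)

lemma finite_support_image:
  assumes "finite {i. \<phi> i \<noteq> (0::cq)}" "\<And>i. \<psi> i \<noteq> (0::cq) \<Longrightarrow> \<exists>k. \<phi> k \<noteq> 0 \<and> i \<in> h k" "\<And>k. finite (h k)"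
  shows "finite {i. \<psi> i \<noteq> 0}"
proof (rule finite_subset)
  show "{i. \<psi> i \<noteq> 0} \<subseteq> (\<Union>k\<in>{i. \<phi> i \<noteq> 0}. h k)"
    using assms(2) by blast
qed (use assms in blast)

text \<open>A finite set that contains every index to which a generator can move \<open>k\<close>.\<close>

definition neighbours :: "nat \<times> nat \<Rightarrow> (nat \<times> nat) set" where
  "neighbours k = {..fst k + 1} \<times> {..snd k + 1}"

lemma finite_neighbours: "finite (neighbours k)"
  by (simp add: neighbours_def)

interpretation F1: gen_action fock1_op
proof
  fix g :: gen and a b :: cq and \<phi> \<psi> :: "nat \<times> nat \<Rightarrow> cq"
  show "fock1_op g (\<lambda>i. a * \<phi> i + b * \<psi> i) = (\<lambda>i. a * fock1_op g \<phi> i + b * fock1_op g \<psi> i)"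
  proof
    fix i show "fock1_op g (\<lambda>i. a * \<phi> i + b * \<psi> i) i = a * fock1_op g \<phi> i + b * fock1_op g \<psi> i"
      by (cases g; cases i) (simp_all add: algebra_simps)
  qed
  show "fock1_op GK (fock1_op GKinv \<phi>) = \<phi>" "fock1_op GKinv (fock1_op GK \<phi>) = \<phi>"
    by (rule ext; clarsimp simp: qvar_powi_cancel simp del: minus_diff_eq)+
  show "fock1_op GK (fock1_op GE (fock1_op GKinv \<phi>)) = (\<lambda>i. qvar\<^sup>2 * fock1_op GE \<phi> i)"
  proof
    fix i :: "nat \<times> nat"
    obtain a b where i: "i = (a, b)" by (cases i)
    show "fock1_op GK (fock1_op GE (fock1_op GKinv \<phi>)) i = qvar\<^sup>2 * fock1_op GE \<phi> i"
      by (cases a) (simp_all add: i qvar_powi_conj)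
  qed
  show "fock1_op GK (fock1_op GF (fock1_op GKinv \<phi>)) = (\<lambda>i. inverse (qvar\<^sup>2) * fock1_op GF \<phi> i)"
  proof
    fix i :: "nat \<times> nat"
    obtain a b where i: "i = (a, b)" by (cases i)
    show "fock1_op GK (fock1_op GF (fock1_op GKinv \<phi>)) i = inverse (qvar\<^sup>2) * fock1_op GF \<phi> i"
      by (cases b) (simp_all add: i qvar_powi_conj power_int_minus)
  qed
  show "fock1_op GE (fock1_op GF \<phi>) i - fock1_op GF (fock1_op GE \<phi>) i =
      inverse qdelta * (fock1_op GK \<phi> i - fock1_op GKinv \<phi> i)" for i
  proof -
    obtain a b where i: "i = (a, b)" by (cases i)
    have "fock1_op GE (fock1_op GF \<phi>) i - fock1_op GF (fock1_op GE \<phi>) i =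
        (qint (int b + 1) * qint (int a) - qint (int b) * qint (int a + 1)) * \<phi> (a, b)"
      by (cases a; cases b) (simp_all add: i algebra_simps)
    then show ?thesis
      unfolding qint_commutator i fock1_op.simps qint_inverse_qdelta .
  qed
  assume fin: "finite {i. \<phi> i \<noteq> 0}"
  show "finite {i. fock1_op g \<phi> i \<noteq> 0}"
  proof (rule finite_support_image[OF fin _ finite_neighbours])
    fix i assume nz: "fock1_op g \<phi> i \<noteq> 0"
    obtain a b where i: "i = (a, b)" by (cases i)
    show "\<exists>k. \<phi> k \<noteq> 0 \<and> i \<in> neighbours k"
    proof (cases g)
      case GE
      with nz i show ?thesis by (intro exI[of _ "(a - 1, b + 1)"]) (auto simp: neighbours_def)
    next
      case GF
      with nz i show ?thesis by (intro exI[of _ "(a + 1, b - 1)"]) (auto simp: neighbours_def)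
    next
      case GK
      with nz i show ?thesis by (intro exI[of _ "(a, b)"]) (auto simp: neighbours_def)
    next
      case GKinv
      with nz i show ?thesis by (intro exI[of _ "(a, b)"]) (auto simp: neighbours_def)
    qed
  qed
qed

interpretation F2: gen_action fock2_op
proof
  fix g :: gen and a b :: cq and \<phi> \<psi> :: "nat \<times> nat \<Rightarrow> cq"
  show "fock2_op g (\<lambda>i. a * \<phi> i + b * \<psi> i) = (\<lambda>i. a * fock2_op g \<phi> i + b * fock2_op g \<psi> i)"
  proof
    fix i show "fock2_op g (\<lambda>i. a * \<phi> i + b * \<psi> i) i = a * fock2_op g \<phi> i + b * fock2_op g \<psi> i"
      by (cases g; cases i) (simp_all add: algebra_simps)
  qed
  show "fock2_op GK (fock2_op GKinv \<phi>) = \<phi>" "fock2_op GKinv (fock2_op GK \<phi>) = \<phi>"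
    by (rule ext; clarsimp simp: qvar_powi_cancel simp del: minus_add_distrib)+
  show "fock2_op GK (fock2_op GE (fock2_op GKinv \<phi>)) = (\<lambda>i. qvar\<^sup>2 * fock2_op GE \<phi> i)"
  proof
    fix i :: "nat \<times> nat"
    obtain a b where i: "i = (a, b)" by (cases i)
    show "fock2_op GK (fock2_op GE (fock2_op GKinv \<phi>)) i = qvar\<^sup>2 * fock2_op GE \<phi> i"
      by (simp add: i qvar_powi_conj)
  qed
  show "fock2_op GK (fock2_op GF (fock2_op GKinv \<phi>)) = (\<lambda>i. inverse (qvar\<^sup>2) * fock2_op GF \<phi> i)"
  proof
    fix i :: "nat \<times> nat"
    obtain a b where i: "i = (a, b)" by (cases i)
    show "fock2_op GK (fock2_op GF (fock2_op GKinv \<phi>)) i = inverse (qvar\<^sup>2) * fock2_op GF \<phi> i"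
      by (cases a; cases b) (simp_all add: i qvar_powi_conj power_int_minus)
  qed
  show "fock2_op GE (fock2_op GF \<phi>) i - fock2_op GF (fock2_op GE \<phi>) i =
      inverse qdelta * (fock2_op GK \<phi> i - fock2_op GKinv \<phi> i)" for i
  proof -
    obtain a b where i: "i = (a, b)" by (cases i)
    have "qint (- int b - 1 + 1) * qint (int a) - qint (- int b - 1) * qint (int a + 1) =
        qint (int a + int b + 1)"
      unfolding qint_commutator by (rule arg_cong) simp
    moreover have "qint (- int b - 1) = - qint (int b + 1)" "qint (- int b - 1 + 1)
        = - qint (int b)"
      using qint_uminus[of "int b + 1"] qint_uminus[of "int b"] by simp_all
    ultimately have "qint (int a) * qint (int b) - qint (int a + 1) * qint (int b + 1)
        = qint (- (int a + int b + 1))"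
      by (simp only: qint_uminus) (simp add: algebra_simps)
    moreover have "fock2_op GE (fock2_op GF \<phi>) i - fock2_op GF (fock2_op GE \<phi>) i =
        (qint (int a) * qint (int b) - qint (int a + 1) * qint (int b + 1)) * \<phi> (a, b)"
      by (cases a; cases b) (simp_all add: i algebra_simps)
    ultimately show ?thesis
      using qint_inverse_qdelta[of "- (int a + int b + 1)" "\<phi> (a, b)"]
          by (simp only: i fock2_op.simps minus_minus)
  qed
  assume fin: "finite {i. \<phi> i \<noteq> 0}"
  show "finite {i. fock2_op g \<phi> i \<noteq> 0}"
  proof (rule finite_support_image[OF fin _ finite_neighbours])
    fix i assume nz: "fock2_op g \<phi> i \<noteq> 0"
    obtain a b where i: "i = (a, b)" by (cases i)
    show "\<exists>k. \<phi> k \<noteq> 0 \<and> i \<in> neighbours k"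
    proof (cases g)
      case GE
      with nz i show ?thesis by (intro exI[of _ "(a + 1, b + 1)"]) (auto simp: neighbours_def)
    next
      case GF
      with nz i show ?thesis
        by (intro exI[of _ "(a - 1, b - 1)"]) (auto simp: neighbours_def split: if_splits)
    next
      case GK
      with nz i show ?thesis by (intro exI[of _ "(a, b)"]) (auto simp: neighbours_def)
    next
      case GKinv
      with nz i show ?thesis by (intro exI[of _ "(a, b)"]) (auto simp: neighbours_def)
    qed
  qed
qed

lemma fock1_GE_power:
  "(fock1_op GE ^^ r) \<phi> (i, j) = qfact r * qbinom (int i) (int r) * \<phi> (i - r, j + r)"
proof (induction r arbitrary: i j)
  case (Suc r)
  show ?case
  proof (cases i)
    case 0
    then show ?thesis by (simp add: qbinom_eq_0 del: of_nat_Suc)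
  next
    case (Suc k)
    have "qint (int i) * (qfact r * qbinom (int k) (int r))
        = qfact (Suc r) * qbinom (int i) (int (Suc r))"
      using qbinom_Suc_shift[of r "int i"] Suc by (simp add: qfact_Suc mult_ac del: of_nat_Suc)
          (simp add: mult_ac)
    then show ?thesis
      using Suc.IH[of k "j + 1"] Suc by (simp add: mult.assoc[symmetric] del: of_nat_Suc)
  qed
qed simp

lemma fock1_GF_power:
  "(fock1_op GF ^^ r) \<phi> (i, j) = qfact r * qbinom (int j) (int r) * \<phi> (i + r, j - r)"
proof (induction r arbitrary: i j)
  case (Suc r)
  show ?case
  proof (cases j)
    case 0
    then show ?thesis by (simp add: qbinom_eq_0 del: of_nat_Suc)
  next
    case (Suc k)
    have "qint (int j) * (qfact r * qbinom (int k) (int r))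
        = qfact (Suc r) * qbinom (int j) (int (Suc r))"
      using qbinom_Suc_shift[of r "int j"] Suc by (simp add: qfact_Suc mult_ac del: of_nat_Suc)
          (simp add: mult_ac)
    then show ?thesis
      using Suc.IH[of "i + 1" k] Suc by (simp add: mult.assoc[symmetric] del: of_nat_Suc)
  qed
qed simp

lemma fock2_GE_power:
  "(fock2_op GE ^^ r) \<phi> (i, j) = qfact r * qbinom (int (j + r)) (int r) * \<phi> (i + r, j + r)"
proof (induction r arbitrary: i j)
  case (Suc r)
  have "qint (int j + 1) * (qfact r * qbinom (int (Suc j + r)) (int r)) =
      qfact (Suc r) * qbinom (int (j + Suc r)) (int (Suc r))"
    using qbinom_Suc[of r "int (j + Suc r)"] by (simp add: qfact_Suc mult_ac del: of_nat_Suc) (simp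
        add: mult_ac add_ac)
  then show ?case
    using Suc.IH[of "i + 1" "j + 1"] by (simp add: mult.assoc[symmetric] del: of_nat_Suc of_nat_add)
qed simp

lemma fock2_GF_power:
  "(fock2_op GF ^^ r) \<phi> (i, j) =
     (if r \<le> j then (- 1) ^ r * qfact r * qbinom (int i) (int r) * \<phi> (i - r, j - r) else 0)"
proof (induction r arbitrary: i j)
  case (Suc r)
  show ?case
  proof (cases "i = 0 \<or> j = 0")
    case True
    then show ?thesis by (auto simp: qbinom_eq_0 simp del: of_nat_Suc)
  next
    case False
    then obtain k m where km: "i = Suc k" "j = Suc m" by (meson not0_implies_Suc)
    have "qint (int i) * (qfact r * qbinom (int k) (int r))
        = qfact (Suc r) * qbinom (int i) (int (Suc r))"
      using qbinom_Suc_shift[of r "int i"] km by (simp add: qfact_Suc mult_ac del: of_nat_Suc) (simp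
          add: mult_ac)
    then have "- qint (int i) * ((- 1) ^ r * qfact r * qbinom (int k) (int r) * x) =
      (- 1) ^ Suc r * qfact (Suc r) * qbinom (int i) (int (Suc r)) * x" for x
      by (simp add: mult_ac del: of_nat_Suc)
    then show ?thesis
      using Suc.IH[of k m] km by (simp del: of_nat_Suc)
  qed
qed simp

lemma F1_e_div: "F1.uq_op (e_div r) \<phi> (i, j) = qbinom (int i) (int r) * \<phi> (i - r, j + r)"
  and F1_f_div: "F1.uq_op (f_div r) \<phi> (i, j) = qbinom (int j) (int r) * \<phi> (i + r, j - r)"
  using qfact_nonzero[of r]
  by (simp_all add: F1.uq_op_e_div F1.uq_op_f_div fock1_GE_power fock1_GF_power)

lemma F2_e_div: "F2.uq_op (e_div r) \<phi> (i, j) = qbinom (int (j + r)) (int r) * \<phi> (i + r, j + r)"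
  and F2_f_div: "F2.uq_op (f_div r) \<phi> (i, j) =
     (if r \<le> j then (- 1) ^ r * qbinom (int i) (int r) * \<phi> (i - r, j - r) else 0)"
  using qfact_nonzero[of r]
  by (simp_all add: F2.uq_op_e_div F2.uq_op_f_div fock2_GE_power fock2_GF_power)

lemma fock_scale_lookup: "lookup (fock_scale c x) k = c * lookup x k"
  by (simp add: fock_scale_def map.rep_eq when_def)

lemma fock_basis_lookup:
  "lookup (fock_basis m n) (i, j) = (if m = int i \<and> n = int j then 1 else 0)"
  by (auto simp: fock_basis_def lookup_single when_def)

context odd_root
begin

interpretation F1: integral_action fock1_op \<epsilon>
proof
  fix x :: uq and \<phi> :: "nat \<times> nat \<Rightarrow> cq" and i :: "nat \<times> nat"
  assume "x \<in> U_gens" "\<And>i. \<phi> i \<in> laurent_ring"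
  then show "F1.uq_op x \<phi> i \<in> laurent_ring"
    by (cases i) (auto simp: U_gens_def F1_e_div F1_f_div F1.uq_op_gen
        intro!: laurent_ring_mult)
qed (rule eps_nonzero)

interpretation F2: integral_action fock2_op \<epsilon>
proof
  fix x :: uq and \<phi> :: "nat \<times> nat \<Rightarrow> cq" and i :: "nat \<times> nat"
  assume "x \<in> U_gens" "\<And>i. \<phi> i \<in> laurent_ring"
  then show "F2.uq_op x \<phi> i \<in> laurent_ring"
    by (cases i) (auto simp: U_gens_def F2_e_div F2_f_div F2.uq_op_gen intro!: laurent_ring_mult
        laurent_ring_power laurent_ring_uminus)
qed (rule eps_nonzero)

lemma fock1_exists: "fock1 \<epsilon> F1.fun_module"
proof -
  let ?act = "\<lambda>x v. spec \<epsilon> x \<odot>\<^bsub>F1.fun_module\<^esub> v"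
  have K: "lookup (?act uK v) (a, b) = \<epsilon> powi (int a - int b) * lookup v (a, b)"
    "lookup (?act uKi v) (a, b) = \<epsilon> powi (- (int a - int b)) * lookup v (a, b)" for v a b
    by (simp_all only: F1.lookup_fun_module_spec U_int.K U_int.Kinv F1.uq_op_gen fock1_op.simps
        ev_simps lconst_in_ring qvar_powi_in_ring)
  have e: "lookup (?act (e_div r) v) (a, b)
      = ev (qbinom (int a) (int r)) * lookup v (a - r, b + r)" for r v a b
    by (simp only: F1.lookup_fun_module_spec e_div_U_int F1_e_div ev_simps lconst_in_ring
        qbinom_in_ring)
  have f: "lookup (?act (f_div r) v) (a, b) =
      ev (qbinom (int b) (int r)) * lookup v (a + r, b - r)" for r v a b
    by (simp only: F1.lookup_fun_module_spec f_div_U_int F1_f_div ev_simps lconst_in_ring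
        qbinom_in_ring)
  have zero: "ev (qbinom (int a) (int r)) = 0" if "a < r" for a r
    using that by (simp add: qbinom_eq_0 ev_simps)
  have "fock_module \<epsilon> F1.fun_module"
    unfolding fock_module_def
    using F1.left_module_fun_module
    by (auto simp: F1.fun_module_scal fock_scale_lookup intro!: poly_mapping_eqI)
      (simp_all add: F1.fun_module_def)
  then show ?thesis
    unfolding fock1_def
  proof (intro conjI allI impI)
    fix i j :: int and r :: nat assume ij: "0 \<le> i" "0 \<le> j"
    show "?act uK (fock_basis i j) = fock_scale (\<epsilon> powi (i - j)) (fock_basis i j)"
      "?act uKi (fock_basis i j) = fock_scale (\<epsilon> powi (- (i - j))) (fock_basis i j)"
      by (rule poly_mapping_eqI; clarsimp simp only: split_paired_all K fock_scale_lookup;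
          simp add: fock_basis_lookup)+
    show "?act (e_div r) (fock_basis i j) = fock_scale (ev (qbinom (int r
        + i) (int r))) (fock_basis (i + int r) (j - int r))"
    proof (rule poly_mapping_eqI, clarify)
      fix a b
      show "lookup (?act (e_div r) (fock_basis i j)) (a, b)
          = lookup (fock_scale (ev (qbinom (int r + i) (int r))) (fock_basis (i + int r) (j
          - int r))) (a, b)"
        unfolding e fock_scale_lookup fock_basis_lookup
        using ij zero[of a r] by (cases "r \<le> a") (auto simp: of_nat_diff)
    qed
    show "?act (f_div r) (fock_basis i j) = fock_scale (ev (qbinom (int r
        + j) (int r))) (fock_basis (i - int r) (j + int r))"
    proof (rule poly_mapping_eqI, clarify)
      fix a b
      show "lookup (?act (f_div r) (fock_basis i j)) (a, b)
          = lookup (fock_scale (ev (qbinom (int r + j) (int r))) (fock_basis (i - int r) (j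
          + int r))) (a, b)"
        unfolding f fock_scale_lookup fock_basis_lookup
        using ij zero[of b r] by (cases "r \<le> b") (auto simp: of_nat_diff)
    qed
  qed
qed

lemma fock2_exists: "fock2 \<epsilon> F2.fun_module"
proof -
  let ?act = "\<lambda>x v. spec \<epsilon> x \<odot>\<^bsub>F2.fun_module\<^esub> v"
  have K: "lookup (?act uK v) (a, b) = \<epsilon> powi (- (int a + int b + 1)) * lookup v (a, b)"
    "lookup (?act uKi v) (a, b) = \<epsilon> powi (int a + int b + 1) * lookup v (a, b)" for v a b
    by (simp_all only: F2.lookup_fun_module_spec U_int.K U_int.Kinv F2.uq_op_gen fock2_op.simps
        ev_simps lconst_in_ring qvar_powi_in_ring)
  have e: "lookup (?act (e_div r) v) (a, b)
      = ev (qbinom (int (b + r)) (int r)) * lookup v (a + r, b + r)" for r v a b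
    by (simp only: F2.lookup_fun_module_spec e_div_U_int F2_e_div ev_simps lconst_in_ring
        qbinom_in_ring)
  have m1: "ev ((- 1) ^ r) = (- 1) ^ r" for r
    by (simp only: ev_simps laurent_ring_uminus laurent_ring_1)
  have f: "lookup (?act (f_div r) v) (a, b) =
      (if r \<le> b then (- 1) ^ r * ev (qbinom (int a) (int r)) * lookup v (a - r, b
          - r) else 0)" for r v a b
    by (simp add: F2.lookup_fun_module_spec f_div_U_int F2_f_div)
      (simp only: ev_simps lconst_in_ring qbinom_in_ring laurent_ring_mult laurent_ring_power
        laurent_ring_uminus laurent_ring_1 m1 simp_thms)
  have zero: "ev (qbinom (int a) (int r)) = 0" if "a < r" for a r
    using that by (simp add: qbinom_eq_0 ev_simps)
  have "fock_module \<epsilon> F2.fun_module"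
    unfolding fock_module_def
    using F2.left_module_fun_module
    by (auto simp: F2.fun_module_scal fock_scale_lookup intro!: poly_mapping_eqI)
      (simp_all add: F2.fun_module_def)
  then show ?thesis
    unfolding fock2_def
  proof (intro conjI allI impI)
    fix i j :: int and r :: nat assume ij: "0 \<le> i" "0 \<le> j"
    show "?act uK (fock_basis i j) = fock_scale (\<epsilon> powi (- (i + j + 1))) (fock_basis i j)"
      "?act uKi (fock_basis i j) = fock_scale (\<epsilon> powi (i + j + 1)) (fock_basis i j)"
      by (rule poly_mapping_eqI; clarsimp simp only: split_paired_all K fock_scale_lookup;
          simp add: fock_basis_lookup)+
    show "?act (e_div r) (fock_basis i j) = fock_scale (ev (qbinom j (j - int r))) (fock_basis (i
        - int r) (j - int r))"
    proof (rule poly_mapping_eqI, clarify)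
      fix a b
      show "lookup (?act (e_div r) (fock_basis i j)) (a, b)
          = lookup (fock_scale (ev (qbinom j (j - int r))) (fock_basis (i - int r) (j
          - int r))) (a, b)"
        unfolding e fock_scale_lookup fock_basis_lookup
        using qbinom_sym[of b r] by auto
    qed
    show "?act (f_div r) (fock_basis i j) = fock_scale ((- 1) ^ r * ev (qbinom (int r
        + i) (int r))) (fock_basis (i + int r) (j + int r))"
    proof (rule poly_mapping_eqI, clarify)
      fix a b
      show "lookup (?act (f_div r) (fock_basis i j)) (a, b)
          = lookup (fock_scale ((- 1) ^ r * ev (qbinom (int r + i) (int r))) (fock_basis (i
          + int r) (j + int r))) (a, b)"
        unfolding f fock_scale_lookup fock_basis_lookup
        using ij zero[of a r] by (cases "r \<le> a") (auto simp: of_nat_diff)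
    qed
  qed
qed

section \<open>Highest weight vectors in the Fock spaces\<close>

lemma fock1_primitive:
  assumes F: "fock1 \<epsilon> F" and l: "0 \<le> l"
  shows "primitive p \<epsilon> F l (fock_basis l 0)" "fock_basis l 0 \<noteq> \<zero>\<^bsub>F\<^esub>"
proof -
  have mod: "left_module (U_res \<epsilon>) F" and C: "carrier F = UNIV" and z: "\<zero>\<^bsub>F\<^esub> = 0"
    and sc: "fock_scale c x = cscale \<epsilon> F c x" for c x
    using F by (auto simp: fock1_def fock_module_def)
  interpret res_module p \<epsilon> F
    using mod odd_root_axioms by (rule res_module.intro[rotated])
  show nz: "fock_basis l 0 \<noteq> \<zero>\<^bsub>F\<^esub>"
    using l fock_basis_lookup[of l 0 "nat l" 0] by (auto simp: z)
  have basis_0: "fock_basis i j = \<zero>\<^bsub>F\<^esub>" if "i < 0 \<or> j < 0" for i j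
    using that by (auto simp: z fock_basis_def)
  have K: "act \<epsilon> F uK (fock_basis i j) = cscale \<epsilon> F (\<epsilon> powi (i - j)) (fock_basis i j)"
    and e: "1 \<le> r \<Longrightarrow> act \<epsilon> F (e_div r) (fock_basis i j)
        = cscale \<epsilon> F (ev (qbinom (int r + i) (int r))) (fock_basis (i + int r) (j - int r))"
    and f: "1 \<le> r \<Longrightarrow> act \<epsilon> F (f_div r) (fock_basis i j)
        = cscale \<epsilon> F (ev (qbinom (int r + j) (int r))) (fock_basis (i - int r) (j + int r))"
    if "0 \<le> i" "0 \<le> j" for i j r
    using F that unfolding fock1_def sc by blast+
  have "primitive_vector p \<epsilon> F l (fock_basis l 0)"
  proof (rule primitive_vectorI)
    show "act \<epsilon> F (e_div p) (act \<epsilon> F (f_div p) (fock_basis l 0))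
        = cscale \<epsilon> F (ev (qbinom l (int p))) (fock_basis l 0)"
    proof (cases "l < int p")
      case True
      then show ?thesis
        using f[of l 0 p] l p_gt_1 by (simp add: basis_0 C e_div_U_int qbinom_eq_0 ev_simps)
    next
      case False
      then show ?thesis
        using f[of l 0 p] e[of "l - int p" "int p" p] l p_gt_1
        by (simp add: C act_scale scale_scale e_div_U_int ev_qbinom_p act_one)
    qed
  qed (use l K[of l 0] e[of l 0] in \<open>auto simp: C basis_0\<close>)
  then show "primitive p \<epsilon> F l (fock_basis l 0)"
    by (intro primitive.intro primitive_axioms.intro res_module_axioms)
qed

text \<open>
  The scalar \<open>[k + p; k] = (k + p) div p\<close> with \<open>k = -l - 1\<close> is the negative of \<open>l div p\<close>; the sign
  \<open>(-1)^p = -1\<close> in the action of \<open>f^(p)\<close> compensates for this.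
\<close>

lemma fock2_primitive:
  assumes F: "fock2 \<epsilon> F" and l: "l < 0"
  shows "primitive p \<epsilon> F l (fock_basis 0 (- l - 1))" "fock_basis 0 (- l - 1) \<noteq> \<zero>\<^bsub>F\<^esub>"
proof -
  have mod: "left_module (U_res \<epsilon>) F" and C: "carrier F = UNIV" and z: "\<zero>\<^bsub>F\<^esub> = 0"
    and sc: "fock_scale c x = cscale \<epsilon> F c x" for c x
    using F by (auto simp: fock2_def fock_module_def)
  interpret res_module p \<epsilon> F
    using mod odd_root_axioms by (rule res_module.intro[rotated])
  define k where "k = nat (- l - 1)"
  have k: "- l - 1 = int k" using l by (simp add: k_def)
  show nz: "fock_basis 0 (- l - 1) \<noteq> \<zero>\<^bsub>F\<^esub>"
    using fock_basis_lookup[of 0 "int k" 0 k] by (auto simp: z k)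
  have basis_0: "fock_basis i j = \<zero>\<^bsub>F\<^esub>" if "i < 0 \<or> j < 0" for i j
    using that by (auto simp: z fock_basis_def)
  have K: "act \<epsilon> F uK (fock_basis i j) = cscale \<epsilon> F (\<epsilon> powi (- (i + j + 1))) (fock_basis i j)"
    and e: "1 \<le> r \<Longrightarrow> act \<epsilon> F (e_div r) (fock_basis i j)
        = cscale \<epsilon> F (ev (qbinom j (j - int r))) (fock_basis (i - int r) (j - int r))"
    and f: "1 \<le> r \<Longrightarrow> act \<epsilon> F (f_div r) (fock_basis i j)
        = cscale \<epsilon> F (((- 1) ^ r * ev (qbinom (int r + i) (int r)))) (fock_basis (i + int r) (j
        + int r))"
    if "0 \<le> i" "0 \<le> j" for i j r
    using F that unfolding fock2_def sc by blast+
  have "primitive_vector p \<epsilon> F l (fock_basis 0 (int k))"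
  proof (rule primitive_vectorI)
    have "ev (qbinom (int (k + p)) (int k)) = of_int (int (k + p) div int p)"
      by (subst qbinom_sym) (rule ev_qbinom_p)
    also have "int (k + p) div int p = - (l div int p)"
    proof -
      have l_eq: "l = int p * (- (int k div int p) - 1) + (int p - 1 - int k mod int p)"
        using k mult_div_mod_eq[of "int p" "int k"] by (simp add: algebra_simps)
      have "0 \<le> int p - 1 - int k mod int p" "int p - 1 - int k mod int p < int p"
        using p_gt_1 pos_mod_bound[of "int p" "int k"] pos_mod_sign[of "int p" "int k"] by linarith+
      then have "l div int p = - (int k div int p) - 1"
        by (rule int_div_pos_eq[OF l_eq])
      then show ?thesis
        using p_gt_1 by simp
    qed
    finally have "ev (qbinom (int (k + p)) (int k)) = - of_int (l div int p)"
      by simp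
    then show "act \<epsilon> F (e_div p) (act \<epsilon> F (f_div p) (fock_basis 0 (int k)))
        = cscale \<epsilon> F (ev (qbinom l (int p))) (fock_basis 0 (int k))"
      using f[of 0 "int k" p] e[of "int p" "int k + int p" p] p_gt_1 p_odd
      by (simp add: C act_scale scale_scale e_div_U_int ev_qbinom_p)
    show "act \<epsilon> F uK (fock_basis 0 (int k)) = cscale \<epsilon> F (\<epsilon> powi l) (fock_basis 0 (int k))"
    proof -
      have "- (0 + int k + 1) = l" using k by simp
      with K[of 0 "int k"] show ?thesis by (simp only:)
    qed
  qed (use e[of 0 "int k"] in \<open>auto simp: C basis_0\<close>)
  then show "primitive p \<epsilon> F l (fock_basis 0 (- l - 1))"
    unfolding k by (intro primitive.intro primitive_axioms.intro res_module_axioms)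
qed

lemma fock_subquotient:
  assumes "fock1 \<epsilon> F1" "fock2 \<epsilon> F2"
  shows "\<exists>S. (subquotient (U_res \<epsilon>) F1 S \<or> subquotient (U_res \<epsilon>) F2 S) \<and> irreducible_hw p \<epsilon> l S"
proof (cases "0 \<le> l")
  case True
  show ?thesis
    using primitive.irreducible_subquotient[OF fock1_primitive[OF assms(1) True]] by blast
next
  case False
  then have "l < 0" by simp
  show ?thesis
    using primitive.irreducible_subquotient[OF fock2_primitive[OF assms(2) \<open>l < 0\<close>]] by blast
qed

end

theorem mainTheorem1:
  fixes p :: nat and \<epsilon> :: complex
  assumes "1 < p" and "odd p" and "primitive_root_of_unity p \<epsilon>"
  shows
    "(\<exists>F1. fock1 \<epsilon> F1) \<and> (\<exists>F2. fock2 \<epsilon> F2) \<and>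
     (\<forall>F1 F2. fock1 \<epsilon> F1 \<longrightarrow> fock2 \<epsilon> F2 \<longrightarrow>
        (\<forall>l :: int. \<exists>S.
            (subquotient (U_res \<epsilon>) F1 S \<or> subquotient (U_res \<epsilon>) F2 S) \<and>
            irreducible_hw p \<epsilon> l S \<and>
            (\<forall>V :: (ures, 'v) module.
               irreducible_hw p \<epsilon> l V \<longrightarrow> module_iso (U_res \<epsilon>) V S)) \<and>
        (\<forall>V :: (ures, 'v) module.
            irreducible_module (U_res \<epsilon>) V \<and> (\<exists>l. highest_weight_module p \<epsilon> l V) \<longrightarrow>
            (\<exists>S. (subquotient (U_res \<epsilon>) F1 S \<or> subquotient (U_res \<epsilon>) F2 S) \<and>
                 module_iso (U_res \<epsilon>) V S)))"
proof -
  have root: "odd_root p \<epsilon>"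
    using assms by (rule odd_root.intro)
  have each: "\<exists>S. (subquotient (U_res \<epsilon>) F1 S \<or> subquotient (U_res \<epsilon>) F2 S) \<and>
      irreducible_hw p \<epsilon> l S \<and>
      (\<forall>V :: (ures, 'v) module. irreducible_hw p \<epsilon> l V \<longrightarrow> module_iso (U_res \<epsilon>) V S)"
    if "fock1 \<epsilon> F1" "fock2 \<epsilon> F2" for F1 F2 l
  proof -
    note fock = that
    obtain S where "subquotient (U_res \<epsilon>) F1 S \<or> subquotient (U_res \<epsilon>) F2 S"
        "irreducible_hw p \<epsilon> l S"
      using odd_root.fock_subquotient[OF root fock] by blast
    then show ?thesis
      using irreducible_hw_iso[OF root] by blast
  qed
  then have all: "\<exists>S. (subquotient (U_res \<epsilon>) F1 S \<or> subquotient (U_res \<epsilon>) F2 S)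
      \<and> module_iso (U_res \<epsilon>) V S"
    if "fock1 \<epsilon> F1" "fock2 \<epsilon> F2" "irreducible_module (U_res \<epsilon>) V" "highest_weight_module p \<epsilon> l V"
    for F1 F2 l and V :: "(ures, 'v) module"
    using that unfolding irreducible_hw_def by blast
  show ?thesis
    using odd_root.fock1_exists[OF root] odd_root.fock2_exists[OF root] each all by blast
qed

end
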